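(* Let $Y$ be the affine curve (of genus 5) over $\mathbb{Q}$ in coordinates $(x,y,z)$ defined by \[ y^2 = -(x^2-3)(x^2+1), \qquad z^2 = -2(x^3-x^2-x-1). \] Then $Y(\mathbb{Q},2) = Y(\mathbb{Q}) = \{(\pm1,\pm2,\pm2)\}$.
   Context: For a curve $X$ defined over $\mathbb{Q}$, $X(\mathbb{Q},2)$ denotes the set of points $P \in X(\overline{\mathbb{Q}})$ with $[\mathbb{Q}(P):\mathbb{Q}] \le 2$. Sign choices are independent. *)

theory Defs
  imports "HOL-Algebra.Algebraic_Closure_Type" "HOL-Algebra.Embedded_Algebras"
    "HOL-Algebra.Generated_Fields"
begin

type_synonym qbar = "rat alg_closure"

abbreviation Qbar :: "qbar ring" where
  "Qbar \<equiv> ring_of_type_algebra"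

text \<open>
  A curve in affine 3-space over the rationals is represented by its set of geometric points,
  that is, by a subset of the triples over the algebraic closure.
\<close>

type_synonym point = "qbar \<times> qbar \<times> qbar"

definition Y_points :: "point set" where
  "Y_points = {(x, y, z).
     y\<^sup>2 = - ((x\<^sup>2 - 3) * (x\<^sup>2 + 1)) \<and> z\<^sup>2 = - 2 * (x ^ 3 - x\<^sup>2 - x - 1)}"

definition rational_points :: "point set \<Rightarrow> point set" where
  "rational_points V = {(x, y, z) \<in> V. x \<in> \<rat> \<and> y \<in> \<rat> \<and> z \<in> \<rat>}"

text \<open>
  For an affine point the residue field is generated by the coordinates. The prime field is
  contained in every field generated inside \<^term>\<open>Qbar\<close>, so it need not be added to the generators.
\<close>

fun point_field :: "point \<Rightarrow> qbar set" where
  "point_field (x, y, z) = generate_field Qbar {x, y, z}"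

text \<open>
  The degree is bounded through the relation \<^const>\<open>ring.dimension\<close> rather than through
  \<^const>\<open>ring.dim\<close>, whose value is unspecified on infinite-dimensional spaces.
\<close>

definition points_of_degree_le :: "nat \<Rightarrow> point set \<Rightarrow> point set" where
  "points_of_degree_le d V =
     {P \<in> V. \<exists>n\<le>d. ring.dimension Qbar n \<rat> (point_field P)}"

end

theory Submission
  imports Defs "HOL-Computational_Algebra.Nth_Powers"
begin

text \<open>
  The two equations define genus one curves \<open>E1: y\<^sup>2 = (3 - x\<^sup>2)(x\<^sup>2 + 1)\<close> and
  \<open>E2: z\<^sup>2 = -2(x\<^sup>3 - x\<^sup>2 - x - 1)\<close>, both with finitely many rational points, all having
  \<open>x = \<plusminus>1\<close>. For \<open>E1\<close> this is a Fermat-style descent. For \<open>E2\<close> it is a 2-descent over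
  \<open>\<int>[\<theta>]\<close> with \<open>\<theta>\<^sup>3 = \<theta>\<^sup>2 + \<theta> + 1\<close>, which is norm-Euclidean with units \<open>\<plusminus>\<theta>\<^sup>n\<close>: every rational
  point is the double of another one, and doubling increases the height.

  If \<open>x\<close> is rational and neither \<open>y\<close> nor \<open>z\<close> is, then \<open>z = b y\<close> with \<open>b\<close> rational, and the values of
  the two right-hand sides share so few primes that the first one is a square up to sign; the sign \<open>-1\<close>
  leads to the concordant forms \<open>p\<^sup>2 + q\<^sup>2\<close> and \<open>p\<^sup>2 - 3q\<^sup>2\<close>. If \<open>x\<close> is quadratic, then \<open>y\<close> and \<open>z\<close> are
  linear in \<open>x\<close> over the rationals. The line through a conjugate pair of points of \<open>E2\<close> meets \<open>E2\<close> in a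
  third point, which is rational, and likewise for the parabola through a conjugate pair on \<open>E1\<close>
  and the point \<open>(1, 2)\<close>. Hence the minimal polynomial of \<open>x\<close> lies in two one-parameter families for \<open>E2\<close> and in three for \<open>E1\<close>,
  and all common members are reducible.
\<close>

section \<open>Squares and coprimality of integers\<close>

text \<open>With \<open>u = (1 - x)/2\<close> and \<open>v = z/2\<close>, E2 becomes
  \<open>v^2 = 4u^3 - 4u^2 + 1\<close>, a model of the modular curve X_1(11). Its five rational
  points form a group of odd order; this is why every point is a double and why the only class the
  2-descent has to exclude is that of the unit \<theta>. A rational \<open>x\<close> with
  \<open>y\<close> and \<open>z\<close> in the same quadratic field gives a rational point
  \<open>(x, yz)\<close> on a hyperelliptic curve of genus 3. That curve is never treated as such:
  the two right-hand sides, made homogeneous, have only the prime 2 in common, so of all quadratic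
  twists of E1 only those by 1 and -1 survive. The numbers of families count rational points. On E2
  the point at infinity would force a rational \<open>x\<close>, and the sign of \<open>z\<close>
  identifies the four affine points in pairs, leaving two families. On E1, which has no rational
  point at infinity, a residual point (1, -2) would force a rational \<open>x\<close>, so three of
  the four rational points remain.\<close>

lemma odd_square_int:
  fixes x :: int
  assumes "odd x"
  obtains k where "x\<^sup>2 = 8 * k + 1"
proof -
  obtain l where l: "x = 2 * l + 1" using assms by (elim oddE)
  have "even (l * (l + 1))" by simp
  then obtain k where "l * (l + 1) = 2 * k" by (elim evenE)
  then have "x\<^sup>2 = 8 * k + 1" unfolding l by (simp add: power2_eq_square algebra_simps)
  then show thesis by (rule that)
qed

lemma even_square_int:
  fixes x :: int
  assumes "even x"
  obtains k where "x\<^sup>2 = 4 * k"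
  using assms by (auto elim!: evenE simp: power2_eq_square)

lemma coprime_mult_square_nonneg:
  fixes a b c :: int
  assumes "coprime a b" "a * b = c\<^sup>2" "0 \<le> a"
  obtains d where "a = d\<^sup>2"
proof (cases "b = 0")
  case True
  then have "a = 1" using assms by auto
  then show thesis using that[of 1] by simp
next
  case False
  have "0 \<le> a * b" by (simp add: assms(2))
  then have "0 < b \<or> a = 0" using False assms(3) by (auto simp: zero_le_mult_iff)
  then show thesis
  proof
    assume b: "0 < b"
    have "int (nat a * nat b) = int (nat \<bar>c\<bar> ^ 2)"
      using assms b by simp
    then have "nat a * nat b = nat \<bar>c\<bar> ^ 2" by (simp only: of_nat_eq_iff)
    moreover have "coprime (int (nat a)) (int (nat b))"
      using assms b by simp
    then have "coprime (nat a) (nat b)" by (simp only: coprime_int_iff)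
    ultimately have "is_nth_power 2 (nat a)"
      using b assms(3) is_nth_power_mult_coprime_natD(1)[of "nat a" "nat b" 2]
      by (cases "a = 0") (auto simp: is_nth_power_nth_power)
    then obtain d where "nat a = d ^ 2" by (auto elim: is_nth_powerE)
    then have "a = (int d)\<^sup>2" using assms(3) by (metis int_nat_eq of_nat_power)
    then show thesis by (rule that)
  next
    assume "a = 0"
    then show thesis using that[of 0] by simp
  qed
qed

text \<open>The sign of \<open>y\<close> is free and is chosen so that \<open>x * y = c\<close>
  holds exactly: the descents compare two factorizations of the same integer and cannot afford an
  unknown sign.\<close>

lemma coprime_mult_square:
  fixes a b c :: int
  assumes "coprime a b" "a * b = c\<^sup>2" "c \<noteq> 0"
  obtains e x y where "e \<in> {1, -1}" "a = e * x\<^sup>2" "b = e * y\<^sup>2" "x * y = c"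
proof -
  define e where "e = sgn a"
  have nz: "a \<noteq> 0" "b \<noteq> 0" and pos: "0 < a * b" using assms by auto
  then have e: "e \<in> {1, -1}" "sgn b = e"
    by (auto simp: e_def sgn_if zero_less_mult_iff)
  have ab: "a = e * \<bar>a\<bar>" "b = e * \<bar>b\<bar>"
    using mult_sgn_abs[of a] mult_sgn_abs[of b] e(2) by (simp_all add: e_def)
  have 1: "\<bar>a\<bar> * \<bar>b\<bar> = c\<^sup>2" "coprime \<bar>a\<bar> \<bar>b\<bar>"
    using assms pos by (simp_all flip: abs_mult)
  obtain x where x: "\<bar>a\<bar> = x\<^sup>2"
    using coprime_mult_square_nonneg[OF 1(2,1)] by auto
  obtain y where y: "\<bar>b\<bar> = y\<^sup>2"
    using coprime_mult_square_nonneg[of "\<bar>b\<bar>" "\<bar>a\<bar>" c] 1 by (auto simp: mult.commute coprime_commute)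
  have "(x * y)\<^sup>2 = c\<^sup>2" using 1 x y by (simp add: power_mult_distrib)
  then consider "x * y = c" | "x * (- y) = c" by (auto simp: power2_eq_iff)
  then show thesis
  proof cases
    case 1
    then show ?thesis using that[of e x y] e ab x y by simp
  next
    case 2
    then show ?thesis using that[of e x "- y"] e ab x y by simp
  qed
qed

lemma coprime_mult_three_square:
  fixes a b c :: int
  assumes "coprime a b" "a * b = 3 * c\<^sup>2" "c \<noteq> 0"
  obtains e x y where "e \<in> {1, -1}" "x * y = c"
    "a = e * x\<^sup>2 \<and> b = e * (3 * y\<^sup>2) \<or> a = e * (3 * y\<^sup>2) \<and> b = e * x\<^sup>2"
proof -
  have "prime (3 :: int)" by simp
  then have "3 dvd a \<or> 3 dvd b"
    using assms(2) by (metis dvd_triv_left prime_dvd_mult_iff)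
  then show thesis
  proof
    assume "3 dvd a"
    then obtain a' where a: "a = 3 * a'" ..
    with assms have "coprime a' b" "a' * b = c\<^sup>2" by auto
    then obtain e x y where "e \<in> {1, -1}" "a' = e * x\<^sup>2" "b = e * y\<^sup>2" "x * y = c"
      using assms(3) by (rule coprime_mult_square)
    then show thesis using that[of e y x] a by (auto simp: mult.commute)
  next
    assume "3 dvd b"
    then obtain b' where b: "b = 3 * b'" ..
    with assms have "coprime a b'" "a * b' = c\<^sup>2" by auto
    then obtain e x y where "e \<in> {1, -1}" "a = e * x\<^sup>2" "b' = e * y\<^sup>2" "x * y = c"
      using assms(3) by (rule coprime_mult_square)
    then show thesis using that[of e x y] b by auto
  qed
qed

text \<open>\<open>x\<close> is the gcd of \<open>a\<close> and \<open>c\<close>. Two factorizations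
  of one integer acquire a common refinement, and the smaller solution in each descent is read off
  from its entries.\<close>

lemma four_number_lemma:
  fixes a b c d :: int
  assumes "a * b = c * d" "a \<noteq> 0"
  obtains x y z w where "a = x * y" "b = z * w" "c = x * z" "d = y * w" "coprime y z"
proof -
  define x where "x = gcd a c"
  have x: "x \<noteq> 0" using assms by (simp add: x_def)
  obtain y z where "a = y * gcd a c" "c = z * gcd a c" "coprime y z"
    using gcd_coprime_exists[of a c] x unfolding x_def by blast
  then have yz: "a = x * y" "c = x * z" "coprime y z"
    unfolding x_def by (simp_all only: mult.commute)
  then have "x * (y * b) = x * (z * d)" using assms(1) by (simp add: mult.assoc)
  then have eq: "y * b = z * d" using x by simp
  then have "y dvd z * d" by (metis dvd_triv_left)
  then have "y dvd d" using yz(3) by (simp add: coprime_dvd_mult_right_iff)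
  then obtain w where w: "d = y * w" ..
  have "y \<noteq> 0" using yz assms by auto
  moreover have "y * b = y * (z * w)" using eq w by (simp add: algebra_simps)
  ultimately have "b = z * w" by simp
  then show thesis using that yz w by blast
qed

lemma prime_square_dvd_three_square:
  fixes l h :: int
  assumes "prime l" "l\<^sup>2 dvd 3 * h\<^sup>2"
  shows "l dvd h"
proof (rule ccontr)
  assume "\<not> l dvd h"
  then have "coprime (l\<^sup>2) (h\<^sup>2)" using assms(1) by (simp add: prime_imp_coprime)
  then have "l\<^sup>2 dvd 3" using assms(2) by (simp add: coprime_dvd_mult_left_iff)
  then have "l\<^sup>2 \<le> 3" by (rule zdvd_imp_le) simp
  moreover have "2 \<le> l" using assms(1) by (rule prime_ge_2_int)
  then have "2\<^sup>2 \<le> l\<^sup>2" by (rule power_mono) simp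
  ultimately show False by simp
qed

lemma coprimeI_prime_int:
  fixes a b :: int
  assumes "\<And>l. prime l \<Longrightarrow> l dvd a \<Longrightarrow> l dvd b \<Longrightarrow> False"
  shows "coprime a b"
proof (rule ccontr)
  assume "\<not> coprime a b"
  then have "\<not> is_unit (gcd a b)" by (simp add: coprime_iff_gcd_eq_1)
  then have "gcd a b \<noteq> 0 \<Longrightarrow> \<exists>l. prime l \<and> l dvd gcd a b"
    using prime_divisor_exists by blast
  moreover have "gcd a b = 0 \<Longrightarrow> \<exists>l::int. prime l \<and> l dvd gcd a b"
    by (auto intro!: exI[of _ 2])
  ultimately show False using assms by (metis gcd_greatest_iff)
qed

section \<open>Two descents over the integers\<close>

text \<open>Since \<open>r^2 - s^2 = 4q^2\<close>, the halves of \<open>|r| - s\<close> and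
  \<open>|r| + s\<close> are coprime squares. This writes \<open>p^2\<close> as
  \<open>D^2 + 3q^2\<close>; factoring \<open>p^2 - D^2\<close> in the same way and refining the two
  factorizations returns the initial system, with the new \<open>q'\<close> a proper divisor of
  \<open>q\<close>.\<close>

lemma concordant_forms_descent:
  fixes p q r s :: int
  assumes "p\<^sup>2 + q\<^sup>2 = r\<^sup>2" "p\<^sup>2 - 3 * q\<^sup>2 = s\<^sup>2" "coprime p q" "q \<noteq> 0"
  obtains p' q' r' s' :: int where "p'\<^sup>2 + q'\<^sup>2 = r'\<^sup>2" "p'\<^sup>2 - 3 * q'\<^sup>2 = s'\<^sup>2" "coprime p' q'" "q' \<noteq> 0"
    "\<bar>q'\<bar> < \<bar>q\<bar>"
proof -
  \<comment> \<open>Squares modulo 8: for odd \<open>q\<close>, an odd \<open>p\<close> makes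
    \<open>r^2\<close> equal to 2 modulo 8, and an even \<open>p\<close> needs
    \<open>p^2 / 4\<close> even by the first equation and odd by the second.\<close>
  have par: "odd p \<and> even q"
  proof (rule ccontr)
    assume "\<not> (odd p \<and> even q)"
    then have q: "odd q" using assms(3) by (metis coprime_common_divisor odd_one)
    then obtain k where k: "q\<^sup>2 = 8 * k + 1" by (rule odd_square_int)
    show False
    proof (cases "even p")
      case False
      then obtain l where l: "p\<^sup>2 = 8 * l + 1" by (rule odd_square_int)
      then have "r\<^sup>2 = 8 * (k + l) + 2" using assms(1) k by simp
      moreover from this have "even (r\<^sup>2)" by presburger
      then have "even r" by simp
      then obtain m where "r\<^sup>2 = 4 * m" by (rule even_square_int)
      ultimately show False by presburger
    next
      case True
      then obtain l where l: "p\<^sup>2 = 4 * l" by (rule even_square_int)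
      have "r\<^sup>2 = 8 * k + 4 * l + 1" "s\<^sup>2 = 4 * l - 24 * k - 3" using assms k l by auto
      moreover from this have "odd (r\<^sup>2)" "odd (s\<^sup>2)" by presburger+
      then have "odd r" "odd s" by simp_all
      from odd_square_int[OF this(1)] odd_square_int[OF this(2)]
      obtain m n where "r\<^sup>2 = 8 * m + 1" "s\<^sup>2 = 8 * n + 1" by metis
      ultimately show False by presburger
    qed
  qed
  have "odd (r\<^sup>2)" "odd (s\<^sup>2)" using assms(1,2) par by (metis even_add even_power odd_pos even_diff even_mult_iff)+
  then have odd: "odd \<bar>r\<bar>" "odd s" by simp_all
  define g where "g = (\<bar>r\<bar> - s) div 2"
  define h where "h = (\<bar>r\<bar> + s) div 2"
  have gh: "\<bar>r\<bar> = g + h" "s = h - g" using odd unfolding g_def h_def by presburger+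
  have "r\<^sup>2 = (g + h)\<^sup>2" by (metis gh(1) power2_abs)
  then have "4 * (g * h) = 4 * q\<^sup>2"
    using assms(1,2) by (simp add: gh(2) power2_eq_square algebra_simps)
  then have prod: "g * h = q\<^sup>2" by simp
  have cop: "coprime g h"
  proof (rule coprimeI_prime_int)
    fix l :: int assume l: "prime l" "l dvd g" "l dvd h"
    then have "l dvd q" using prod by (metis dvd_mult2 prime_dvd_power)
    moreover have "l dvd r" using l gh by (metis dvd_abs_iff dvd_add)
    then have "l dvd r\<^sup>2 - q\<^sup>2" using \<open>l dvd q\<close> by (simp add: power2_eq_square)
    then have "l dvd p" using l(1) assms(1) prime_dvd_power by (metis add_diff_cancel_right')
    ultimately show False using assms(3) l(1) by (meson coprime_common_divisor not_prime_unit)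
  qed
  obtain e x y where e: "e \<in> {1, -1}" "g = e * x\<^sup>2" "h = e * y\<^sup>2" "x * y = q"
    using coprime_mult_square[OF cop prod assms(4)] .
  have "r \<noteq> 0" using odd by auto
  then have "0 < g + h" using gh by simp
  then have "e = 1" using e by (auto dest!: leD)
       (smt (verit) zero_le_power2)
  \<comment> \<open>This is \<open>(x^2 + y^2)^2 - (xy)^2\<close>, rearranged to split off three
    times a square.\<close>
  then have p2: "p\<^sup>2 = (x\<^sup>2 - y\<^sup>2)\<^sup>2 + 3 * (x * y)\<^sup>2"
    using assms(1) e \<open>r\<^sup>2 = (g + h)\<^sup>2\<close> by (simp add: power2_eq_square algebra_simps)
  have "coprime x y" using cop e \<open>e = 1\<close> by simp
  have "odd (h - g)" using gh odd by simp
  then have "odd x \<noteq> odd y" using e \<open>e = 1\<close> by simp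
  then obtain c d where cd: "odd c" "even d" "p\<^sup>2 = (c\<^sup>2 - d\<^sup>2)\<^sup>2 + 3 * (c * d)\<^sup>2" "c * d = q" "coprime c d"
    using p2 e(4) \<open>coprime x y\<close>
    by (metis coprime_commute mult.commute power2_commute)
  from \<open>even d\<close> obtain d' where d': "d = 2 * d'" ..
  define D where "D = c\<^sup>2 - d\<^sup>2"
  have "odd D" using cd by (simp add: D_def)
  define U where "U = (p - D) div 2"
  define V where "V = (p + D) div 2"
  have UV: "p = U + V" "D = V - U" using \<open>odd D\<close> par unfolding U_def V_def by presburger+
  have "4 * (U * V) = (U + V)\<^sup>2 - (V - U)\<^sup>2" by (simp add: power2_eq_square algebra_simps)
  also have "\<dots> = 3 * (c * d)\<^sup>2" using cd(3) unfolding D_def[symmetric] UV[symmetric] by simp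
  also have "\<dots> = 4 * (3 * (c * d')\<^sup>2)" by (simp add: d' power_mult_distrib)
  finally have "4 * (U * V) = 4 * (3 * (c * d')\<^sup>2)" .
  then have UVprod: "U * V = 3 * (c * d')\<^sup>2" by simp
  have copUV: "coprime U V"
  proof (rule coprimeI_prime_int)
    fix l :: int assume l: "prime l" "l dvd U" "l dvd V"
    then have "l\<^sup>2 dvd 3 * (c * d')\<^sup>2" unfolding power2_eq_square[of l] UVprod[symmetric]
      by (simp add: mult_dvd_mono)
    then have cd': "l dvd c * d'" by (rule prime_square_dvd_three_square[OF l(1)])
    have "l dvd D" using l UV by simp
    then have "l dvd c \<and> l dvd d"
    proof (cases "l dvd c")
      case True
      then have "l dvd c\<^sup>2 - D" using \<open>l dvd D\<close> by (simp add: power2_eq_square)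
      then have "l dvd d\<^sup>2" by (simp add: D_def)
      then show ?thesis using True l(1) prime_dvd_power by blast
    next
      case False
      then have "l dvd d" using cd' l(1) d' by (simp add: prime_dvd_mult_iff)
      moreover from this have "l dvd D + d\<^sup>2" using \<open>l dvd D\<close> by (simp add: power2_eq_square)
      then have "l dvd c\<^sup>2" by (simp add: D_def)
      ultimately show ?thesis using l(1) prime_dvd_power by blast
    qed
    then show False using cd(5) l(1) by (meson coprime_common_divisor not_prime_unit)
  qed
  have "c * d' \<noteq> 0" using cd(4) assms(4) d' by auto
  then obtain f n m where f: "f \<in> {1, -1}" "m * n = c * d'"
    "U = f * m\<^sup>2 \<and> V = f * (3 * n\<^sup>2) \<or> U = f * (3 * n\<^sup>2) \<and> V = f * m\<^sup>2"
    by (rule coprime_mult_three_square[OF copUV UVprod]) blast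
  then have "D = m\<^sup>2 - 3 * n\<^sup>2 \<or> D = 3 * n\<^sup>2 - m\<^sup>2" using UV by auto
  \<comment> \<open>As \<open>c\<close> is odd and \<open>d\<close> even, \<open>D\<close> is 1
    modulo 4, whereas an odd value of \<open>3n^2 - m^2\<close> is 3 modulo 4.\<close>
  moreover have "D \<noteq> 3 * n\<^sup>2 - m\<^sup>2"
  proof
    assume D: "D = 3 * n\<^sup>2 - m\<^sup>2"
    obtain k l where kl: "c\<^sup>2 = 8 * k + 1" "d\<^sup>2 = 4 * l"
      using odd_square_int[OF cd(1)] even_square_int[OF cd(2)] by metis
    obtain m' where m': "m\<^sup>2 = 4 * m' \<or> m\<^sup>2 = 8 * m' + 1"
      using odd_square_int[of m] even_square_int[of m] by metis
    obtain n' where n': "n\<^sup>2 = 4 * n' \<or> n\<^sup>2 = 8 * n' + 1"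
      using odd_square_int[of n] even_square_int[of n] by metis
    have "8 * k + 1 - 4 * l = 3 * n\<^sup>2 - m\<^sup>2" using D kl by (simp add: D_def)
    with m' n' show False by (elim disjE) (simp_all, presburger+)
  qed
  ultimately have D: "c\<^sup>2 - 4 * d'\<^sup>2 = m\<^sup>2 - 3 * n\<^sup>2" by (simp add: D_def d' power_mult_distrib)
  have "c \<noteq> 0" using cd by auto
  obtain x y z w where xyzw: "c = x * y" "d' = z * w" "m = x * z" "n = y * w" "coprime y z"
    using four_number_lemma[OF f(2)[symmetric] \<open>c \<noteq> 0\<close>] .
  have nz: "x \<noteq> 0" "y \<noteq> 0" "z \<noteq> 0" "w \<noteq> 0" using \<open>c * d' \<noteq> 0\<close> xyzw by auto
  have "coprime x w" using cd(5) xyzw d' by simp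
  \<comment> \<open>\<open>x\<close> and \<open>w\<close> are coprime, so the two brackets are
    \<open>w^2 k\<close> and \<open>x^2 k\<close>. Solving for \<open>y^2\<close> and
    \<open>z^2\<close> shows that \<open>k\<close> divides both, whence \<open>k = 1\<close>, and
    \<open>(z, w)\<close> is the next pair.\<close>
  have eq: "x\<^sup>2 * (y\<^sup>2 - z\<^sup>2) = w\<^sup>2 * (4 * z\<^sup>2 - 3 * y\<^sup>2)"
    using D unfolding xyzw by (simp add: power_mult_distrib algebra_simps)
  have "x\<^sup>2 dvd w\<^sup>2 * (4 * z\<^sup>2 - 3 * y\<^sup>2)" by (metis eq dvd_triv_left)
  moreover have "coprime (x\<^sup>2) (w\<^sup>2)" using \<open>coprime x w\<close> by simp
  ultimately have "x\<^sup>2 dvd 4 * z\<^sup>2 - 3 * y\<^sup>2" by (simp add: coprime_dvd_mult_right_iff)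
  then obtain k where k: "4 * z\<^sup>2 - 3 * y\<^sup>2 = x\<^sup>2 * k" ..
  then have "x\<^sup>2 * (y\<^sup>2 - z\<^sup>2) = x\<^sup>2 * (w\<^sup>2 * k)" using eq by (simp add: algebra_simps)
  then have k2: "y\<^sup>2 - z\<^sup>2 = w\<^sup>2 * k" using nz by simp
  have "z\<^sup>2 = (x\<^sup>2 + 3 * w\<^sup>2) * k" "y\<^sup>2 = (x\<^sup>2 + 4 * w\<^sup>2) * k" using k k2 by (simp_all add: algebra_simps)
  then have "k dvd z\<^sup>2" "k dvd y\<^sup>2" by (metis dvd_triv_right)+
  moreover have "coprime (y\<^sup>2) (z\<^sup>2)" using xyzw(5) by simp
  ultimately have "is_unit k" by (meson coprime_common_divisor)
  moreover have "0 < k"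
  proof -
    have "0 < y\<^sup>2" "0 \<le> x\<^sup>2 + 4 * w\<^sup>2" using nz by auto
    then show ?thesis using \<open>y\<^sup>2 = (x\<^sup>2 + 4 * w\<^sup>2) * k\<close> by (simp add: zero_less_mult_iff)
  qed
  ultimately have "k = 1" by simp
  then have "z\<^sup>2 + w\<^sup>2 = y\<^sup>2" "z\<^sup>2 - 3 * w\<^sup>2 = x\<^sup>2" using k k2 by simp_all
  moreover have "coprime z w"
  proof (rule coprimeI_prime_int)
    fix l :: int assume l: "prime l" "l dvd z" "l dvd w"
    then have "l dvd z\<^sup>2 + w\<^sup>2" by (simp add: power2_eq_square)
    then have "l dvd y" using l(1) \<open>z\<^sup>2 + w\<^sup>2 = y\<^sup>2\<close> prime_dvd_power by metis
    then show False using xyzw(5) l by (meson coprime_common_divisor not_prime_unit)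
  qed
  moreover have "\<bar>w\<bar> < \<bar>q\<bar>"
  proof -
    have "q = w * (2 * (x * y * z))" using cd(4) d' xyzw by (simp add: ac_simps)
    then have "\<bar>q\<bar> = \<bar>w\<bar> * (2 * \<bar>x * y * z\<bar>)" by (simp add: abs_mult)
    moreover have "x * y * z \<noteq> 0" using nz by simp
    then have "1 \<le> \<bar>x * y * z\<bar>" by linarith
    moreover have "0 < \<bar>w\<bar>" using nz by simp
    then have "\<bar>w\<bar> * 1 < \<bar>w\<bar> * (2 * \<bar>x * y * z\<bar>)"
      using \<open>1 \<le> \<bar>x * y * z\<bar>\<close> by (intro mult_strict_left_mono) linarith+
    ultimately show ?thesis by simp
  qed
  ultimately show thesis using that nz by blast
qed

lemma concordant_forms:
  fixes p q r s :: int
  assumes "p\<^sup>2 + q\<^sup>2 = r\<^sup>2" "p\<^sup>2 - 3 * q\<^sup>2 = s\<^sup>2" "coprime p q"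
  shows "q = 0"
  using assms
proof (induction "nat \<bar>q\<bar>" arbitrary: p q r s rule: less_induct)
  case less
  show ?case
  proof (rule ccontr)
    assume q: "q \<noteq> 0"
    obtain p' q' r' s' :: int where "p'\<^sup>2 + q'\<^sup>2 = r'\<^sup>2" "p'\<^sup>2 - 3 * q'\<^sup>2 = s'\<^sup>2" "coprime p' q'"
      "q' \<noteq> 0" "\<bar>q'\<bar> < \<bar>q\<bar>"
      using concordant_forms_descent[OF less.prems q] .
    then show False using less.hyps[of q' p' r' s'] by auto
  qed
qed

section \<open>Descent on E1\<close>

lemma mod4_odd_even:
  fixes c d :: int
  assumes "odd c \<noteq> odd d" "c\<^sup>2 + 3 * d\<^sup>2 = 4 * k + 1"
  shows "odd c \<and> even d"
proof (rule ccontr)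
  assume "\<not> (odd c \<and> even d)"
  then have "even c" "odd d" using assms(1) by auto
  then obtain m n where "c\<^sup>2 = 4 * m" "d\<^sup>2 = 8 * n + 1"
    by (metis even_square_int odd_square_int)
  with assms(2) show False by presburger
qed

text \<open>\<open>s^2\<close> is \<open>W^2 - 12(ab)^2\<close>. Refining
  \<open>U * V = 3(ab)^2\<close> against \<open>a * b\<close> leaves a relation quadratic in
  \<open>x / w\<close>; its discriminant has to be a square, and this is the equation of E1 again,
  now for \<open>y\<close> and \<open>z\<close>.\<close>

lemma pythagorean_descent:
  fixes a b s :: int
  assumes "odd a" "even b" "coprime a b" "b \<noteq> 0"
    and s: "s\<^sup>2 = (a\<^sup>2 + b\<^sup>2)\<^sup>2 + 8 * (a * b * (a\<^sup>2 - b\<^sup>2))"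
  obtains y z g :: int where "(3 * y\<^sup>2 - z\<^sup>2) * (y\<^sup>2 + z\<^sup>2) = g\<^sup>2" "coprime y z" "y\<^sup>2 \<noteq> z\<^sup>2"
    "y\<^sup>2 + z\<^sup>2 \<le> a\<^sup>2 + b\<^sup>2"
proof -
  have "a \<noteq> 0" using assms(1) by auto
  define W where "W = a\<^sup>2 + 4 * a * b - b\<^sup>2"
  have Ws: "W\<^sup>2 - s\<^sup>2 = 12 * (a * b)\<^sup>2"
    unfolding W_def s by (simp add: power2_eq_square algebra_simps)
  have "odd W" using assms by (simp add: W_def)
  have "odd (s\<^sup>2)" using assms unfolding s by simp
  then have "odd s" by simp
  define U where "U = (W - s) div 2"
  define V where "V = (W + s) div 2"
  have UV: "W = U + V" "s = V - U" using \<open>odd W\<close> \<open>odd s\<close> unfolding U_def V_def by presburger+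
  have "4 * (U * V) = 4 * (3 * (a * b)\<^sup>2)"
    using Ws unfolding UV by (simp add: power2_eq_square algebra_simps)
  then have prod: "U * V = 3 * (a * b)\<^sup>2" by simp
  have cop: "coprime U V"
  proof (rule coprimeI_prime_int)
    fix l :: int assume l: "prime l" "l dvd U" "l dvd V"
    then have "l\<^sup>2 dvd 3 * (a * b)\<^sup>2" unfolding power2_eq_square[of l] prod[symmetric]
      by (simp add: mult_dvd_mono)
    then have ab: "l dvd a * b" by (rule prime_square_dvd_three_square[OF l(1)])
    have W: "l dvd W" using l UV by simp
    have "l dvd a \<and> l dvd b"
    proof (cases "l dvd a")
      case True
      then have "l dvd (a\<^sup>2 + 4 * a * b) - W" using W by (simp add: power2_eq_square)
      then have "l dvd b\<^sup>2" by (simp add: W_def)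
      then show ?thesis using True l(1) prime_dvd_power by blast
    next
      case False
      then have "l dvd b" using ab l(1) by (simp add: prime_dvd_mult_iff)
      moreover from this have "l dvd W - 4 * a * b + b\<^sup>2" using W by (simp add: power2_eq_square)
      then have "l dvd a\<^sup>2" by (simp add: W_def)
      ultimately show ?thesis using l(1) prime_dvd_power by blast
    qed
    then show False using assms(3) l(1) by (meson coprime_common_divisor not_prime_unit)
  qed
  have "a * b \<noteq> 0" using \<open>a \<noteq> 0\<close> assms by simp
  then obtain e d c where e: "e \<in> {1, -1}" "c * d = a * b"
    "U = e * c\<^sup>2 \<and> V = e * (3 * d\<^sup>2) \<or> U = e * (3 * d\<^sup>2) \<and> V = e * c\<^sup>2"
    by (rule coprime_mult_three_square[OF cop prod]) blast
  then have We: "W = e * (c\<^sup>2 + 3 * d\<^sup>2)" using UV by (auto simp: algebra_simps)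
  have "odd (c\<^sup>2 + 3 * d\<^sup>2)" using \<open>odd W\<close> We e(1) by auto
  then have par: "odd c \<noteq> odd d" by auto
  obtain x y z w where xyzw: "a = x * y" "b = z * w" "c = x * z" "d = y * w" "coprime y z"
    using four_number_lemma[OF e(2)[symmetric] \<open>a \<noteq> 0\<close>] .
  have nz: "x \<noteq> 0" "y \<noteq> 0" "z \<noteq> 0" "w \<noteq> 0" using \<open>a * b \<noteq> 0\<close> xyzw by auto
  have odd: "odd x" "odd y" using assms(1) xyzw by auto
  obtain ka where ka: "a\<^sup>2 = 8 * ka + 1" using odd_square_int[OF assms(1)] .
  obtain b' where b': "b = 2 * b'" using assms(2) ..
  have W4: "W = 4 * (2 * ka + 2 * a * b' - b'\<^sup>2) + 1"
    using ka b' by (simp add: W_def power2_eq_square algebra_simps)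
  \<comment> \<open>For \<open>e = -1\<close>, reduction modulo 4 makes \<open>c\<close> even and
    \<open>d\<close> odd; the relation between the refined factors then asks a number that is 4
    modulo 8 to vanish.\<close>
  have "e = 1"
  proof (rule ccontr)
    assume "e \<noteq> 1"
    then have W: "W = - (c\<^sup>2 + 3 * d\<^sup>2)" using We e(1) by auto
    have "odd d \<and> even c"
    proof (rule ccontr)
      assume "\<not> (odd d \<and> even c)"
      then have "odd c" "even d" using par by auto
      then obtain m n where "c\<^sup>2 = 8 * m + 1" "d\<^sup>2 = 4 * n"
        by (metis even_square_int odd_square_int)
      with W4 W show False by presburger
    qed
    then have "odd w" "even z" using xyzw odd by auto
    from \<open>even z\<close> obtain z' where z': "z = 2 * z'" ..
    obtain kx where kx: "x\<^sup>2 = 8 * kx + 1" using odd_square_int[OF odd(1)] .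
    obtain kw where kw: "w\<^sup>2 = 8 * kw + 1" using odd_square_int[OF \<open>odd w\<close>] .
    have "odd (w * y)" using \<open>odd w\<close> odd by simp
    then obtain kv where kv: "(w * y)\<^sup>2 = 8 * kv + 1" by (rule odd_square_int)
    have "a\<^sup>2 + 4 * a * b + z\<^sup>2 * (x\<^sup>2 - w\<^sup>2) + 3 * (w * y)\<^sup>2 = 0"
      using W unfolding W_def xyzw by (simp add: power2_eq_square algebra_simps)
    then have "8 * ka + 1 + 8 * (a * b') + 8 * (z\<^sup>2 * (kx - kw)) + 24 * kv + 3 = 0"
      unfolding ka kx kw kv by (simp add: b' algebra_simps)
    then show False by presburger
  qed
  then have W: "W = c\<^sup>2 + 3 * d\<^sup>2" using We by simp
  then have "odd c \<and> even d" using mod4_odd_even[OF par] W4 by metis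
  then have odd': "odd z" "even w" using xyzw odd by auto
  have eq: "x\<^sup>2 * (y\<^sup>2 - z\<^sup>2) + 4 * (x * y * z * w) = w\<^sup>2 * (z\<^sup>2 + 3 * y\<^sup>2)"
    using W unfolding W_def xyzw by (simp add: power2_eq_square algebra_simps)
  \<comment> \<open>Half the derivative in \<open>x\<close> of the relation \<open>eq\<close>, as in
    completing the square.\<close>
  define G where "G = x * (y\<^sup>2 - z\<^sup>2) + 2 * y * z * w"
  have "G\<^sup>2 = (y\<^sup>2 - z\<^sup>2) * (x\<^sup>2 * (y\<^sup>2 - z\<^sup>2) + 4 * (x * y * z * w)) + 4 * y\<^sup>2 * z\<^sup>2 * w\<^sup>2"
    unfolding G_def by (simp add: power2_eq_square algebra_simps)
  also have "\<dots> = w\<^sup>2 * ((3 * y\<^sup>2 - z\<^sup>2) * (y\<^sup>2 + z\<^sup>2))"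
    unfolding eq by (simp add: power2_eq_square algebra_simps)
  finally have G: "G\<^sup>2 = w\<^sup>2 * ((3 * y\<^sup>2 - z\<^sup>2) * (y\<^sup>2 + z\<^sup>2))" .
  then have "w dvd G" by (metis dvd_triv_left pow_divides_pow_iff zero_less_numeral)
  then obtain g where "G = w * g" ..
  then have 1: "(3 * y\<^sup>2 - z\<^sup>2) * (y\<^sup>2 + z\<^sup>2) = g\<^sup>2" using G nz by (simp add: power_mult_distrib)
  have 2: "y\<^sup>2 \<noteq> z\<^sup>2"
  proof
    assume yz: "y\<^sup>2 = z\<^sup>2"
    then have "4 * (x * y * z * w) = w\<^sup>2 * (4 * y\<^sup>2)" using eq by simp
    then have "4 * (y * w) * (x * z) = 4 * (y * w) * (y * w)"
      by (simp add: power2_eq_square ac_simps)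
    then have "x * z = y * w" using nz by simp
    then show False using odd odd' by (metis even_mult_iff)
  qed
  have sq: "u\<^sup>2 \<le> (u * v)\<^sup>2" if "v \<noteq> 0" for u v :: int
    unfolding power_mult_distrib using that mult_left_mono[of 1 "v\<^sup>2" "u\<^sup>2"] by (simp add: int_one_le_iff_zero_less)
  have "y\<^sup>2 + z\<^sup>2 \<le> a\<^sup>2 + b\<^sup>2"
    unfolding xyzw using sq[OF nz(1), of y] sq[OF nz(4), of z] by (simp add: mult.commute)
  then show thesis using that 1 2 xyzw(5) by blast
qed

text \<open>Parametrizing the Pythagorean triple \<open>m\<close>, \<open>n\<close>,
  \<open>r\<close> by \<open>a\<close> and \<open>b\<close> turns \<open>s^2 = r^2 + 4mn\<close>
  into the hypothesis of \<open>pythagorean_descent\<close>.\<close>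

lemma quartic_descent:
  fixes m n r s :: int
  assumes "odd m" "even n" "coprime m n" "n \<noteq> 0" "r\<^sup>2 = m\<^sup>2 + n\<^sup>2" "s\<^sup>2 = m\<^sup>2 + 4 * m * n + n\<^sup>2"
  obtains y z g :: int where "(3 * y\<^sup>2 - z\<^sup>2) * (y\<^sup>2 + z\<^sup>2) = g\<^sup>2" "coprime y z" "y\<^sup>2 \<noteq> z\<^sup>2"
    "y\<^sup>2 + z\<^sup>2 \<le> m\<^sup>2 + n\<^sup>2"
proof -
  obtain n' where n': "n = 2 * n'" using assms(2) ..
  have "odd (r\<^sup>2)" using assms by simp
  then have "odd \<bar>r\<bar>" by simp
  define U where "U = (\<bar>r\<bar> - m) div 2"
  define V where "V = (\<bar>r\<bar> + m) div 2"
  have UV: "\<bar>r\<bar> = U + V" "m = V - U" using \<open>odd m\<close> \<open>odd \<bar>r\<bar>\<close> unfolding U_def V_def by presburger+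
  have r2: "r\<^sup>2 = (U + V)\<^sup>2" by (metis UV(1) power2_abs)
  have "4 * (U * V) = 4 * n'\<^sup>2"
    using assms(5) unfolding r2 UV(2) n' by (simp add: power2_eq_square algebra_simps)
  then have prod: "U * V = n'\<^sup>2" by simp
  have cop: "coprime U V"
  proof (rule coprimeI_prime_int)
    fix l :: int assume l: "prime l" "l dvd U" "l dvd V"
    then have "l dvd n'" using prod by (metis dvd_mult2 prime_dvd_power)
    then have "l dvd n" by (simp add: n')
    moreover have "l dvd m" using l UV by simp
    ultimately show False using assms(3) l(1) by (meson coprime_common_divisor not_prime_unit)
  qed
  have "n' \<noteq> 0" using assms n' by simp
  obtain e b a where e: "e \<in> {1, -1}" "U = e * b\<^sup>2" "V = e * a\<^sup>2" "b * a = n'"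
    using coprime_mult_square[OF cop prod \<open>n' \<noteq> 0\<close>] .
  have "r \<noteq> 0" using \<open>odd \<bar>r\<bar>\<close> by auto
  then have "0 < U + V" using UV by simp
  then have "e = 1" using e by (auto dest!: leD) (smt (verit) zero_le_power2)
  then have m: "m = a\<^sup>2 - b\<^sup>2" and r: "r\<^sup>2 = (a\<^sup>2 + b\<^sup>2)\<^sup>2" and n: "n = 2 * (a * b)"
    using e UV r2 n' by (simp_all add: algebra_simps)
  have "coprime a b" using cop e \<open>e = 1\<close> by (simp add: coprime_commute)
  have s: "s\<^sup>2 = (a\<^sup>2 + b\<^sup>2)\<^sup>2 + 8 * (a * b * (a\<^sup>2 - b\<^sup>2))"
    using assms(5,6) r m n by (simp add: algebra_simps)
  have nz: "a \<noteq> 0" "b \<noteq> 0" using \<open>n' \<noteq> 0\<close> e(4) by auto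
  have le: "a\<^sup>2 + b\<^sup>2 \<le> m\<^sup>2 + n\<^sup>2"
  proof -
    have "0 < a\<^sup>2 + b\<^sup>2" using nz by (simp add: sum_power2_gt_zero_iff)
    then have "(a\<^sup>2 + b\<^sup>2) * 1 \<le> (a\<^sup>2 + b\<^sup>2) * (a\<^sup>2 + b\<^sup>2)" by (intro mult_left_mono) auto
    then show ?thesis using r assms(5) by (simp add: power2_eq_square)
  qed
  have "odd a \<noteq> odd b" using assms(1) m by auto
  then consider "odd a" "even b" | "odd b" "even (- a)" by auto
  then show thesis
  proof cases
    case 1
    show thesis
      by (rule pythagorean_descent[OF 1 \<open>coprime a b\<close> nz(2) s]) (use that le in force)
  next
    case 2
    \<comment> \<open>Passing from \<open>(a, b)\<close> to \<open>(b, -a)\<close> preserves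
      \<open>a * b * (a^2 - b^2)\<close> and exchanges the parities.\<close>
    have *: "coprime b (- a)" using \<open>coprime a b\<close> by (simp add: coprime_commute)
    have **: "s\<^sup>2 = (b\<^sup>2 + (- a)\<^sup>2)\<^sup>2 + 8 * (b * - a * (b\<^sup>2 - (- a)\<^sup>2))"
      unfolding s by (simp add: algebra_simps)
    have "- a \<noteq> 0" using nz by simp
    then show thesis
      by (rule pythagorean_descent[OF 2 * _ **]) (use that le in force)
  qed
qed

text \<open>Modulo 4 both \<open>p\<close> and \<open>q\<close> are odd. The halves of the two
  factors are coprime, hence squares, and become \<open>m^2 + n^2\<close> and
  \<open>m^2 + 4mn + n^2\<close> for the half sum \<open>m\<close> and half difference
  \<open>n\<close>. The later steps only give weak inequalities; the descent is strict because
  \<open>q^2 + p^2 = 2(m^2 + n^2)\<close>.\<close>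

lemma E1_descent:
  fixes p q g :: int
  assumes "(3 * q\<^sup>2 - p\<^sup>2) * (q\<^sup>2 + p\<^sup>2) = g\<^sup>2" "coprime q p" "q\<^sup>2 \<noteq> p\<^sup>2"
  obtains y z h :: int where "(3 * y\<^sup>2 - z\<^sup>2) * (y\<^sup>2 + z\<^sup>2) = h\<^sup>2" "coprime y z" "y\<^sup>2 \<noteq> z\<^sup>2"
    "y\<^sup>2 + z\<^sup>2 < q\<^sup>2 + p\<^sup>2"
proof -
  have g4: "\<exists>k. g\<^sup>2 = 4 * k \<or> g\<^sup>2 = 4 * (2 * k) + 1"
  proof (cases "even g")
    case True
    then obtain k where "g\<^sup>2 = 4 * k" by (rule even_square_int)
    then show ?thesis by blast
  next
    case False
    then obtain k where "g\<^sup>2 = 8 * k + 1" by (rule odd_square_int)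
    then show ?thesis by (intro exI[of _ k]) simp
  qed
  have odd: "odd p \<and> odd q"
  proof (rule ccontr)
    assume "\<not> (odd p \<and> odd q)"
    then consider "even p" "odd q" | "odd p" "even q"
      using assms(2) by (metis coprime_common_divisor odd_one)
    then show False
    proof cases
      case 1
      from even_square_int[OF 1(1)] odd_square_int[OF 1(2)]
      obtain m n where mn: "p\<^sup>2 = 4 * m" "q\<^sup>2 = 8 * n + 1" by metis
      have "g\<^sup>2 = 4 * ((6 * n - m) * (8 * n + 4 * m + 1) + 3 * m + 6 * n) + 3"
        using assms(1) unfolding mn by (simp add: algebra_simps)
      then show False using g4 by presburger
    next
      case 2
      from even_square_int[OF 2(2)] odd_square_int[OF 2(1)]
      obtain m n where mn: "q\<^sup>2 = 4 * m" "p\<^sup>2 = 8 * n + 1" by metis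
      have "g\<^sup>2 = 4 * ((3 * m - 2 * n) * (8 * n + 4 * m + 1) - m - 2 * n - 1) + 3"
        using assms(1) unfolding mn by (simp add: algebra_simps)
      then show False using g4 by presburger
    qed
  qed
  obtain i j where ij: "p\<^sup>2 = 8 * i + 1" "q\<^sup>2 = 8 * j + 1"
    using odd_square_int[of p] odd_square_int[of q] odd by metis
  define U where "U = 12 * j - 4 * i + 1"
  define V where "V = 4 * j + 4 * i + 1"
  have UV: "3 * q\<^sup>2 - p\<^sup>2 = 2 * U" "q\<^sup>2 + p\<^sup>2 = 2 * V" by (simp_all add: U_def V_def ij)
  have "even (g\<^sup>2)" unfolding assms(1)[symmetric] UV by simp
  then obtain h where h: "g = 2 * h" by (auto elim: evenE)
  have prod: "V * U = h\<^sup>2" using assms(1) unfolding UV h by (simp add: power_mult_distrib mult.commute)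
  have cop: "coprime V U"
  proof (rule coprimeI_prime_int)
    fix l :: int assume l: "prime l" "l dvd V" "l dvd U"
    have "2 * q\<^sup>2 = U + V" "2 * p\<^sup>2 = 3 * V - U" using UV by auto
    then have "l dvd 2 * q\<^sup>2" "l dvd 2 * p\<^sup>2" using l by simp_all
    moreover have "\<not> l dvd 2"
    proof
      assume "l dvd 2"
      then have "l = 2" using l(1) by (simp add: primes_dvd_imp_eq)
      then show False using l(2) by (simp add: V_def)
    qed
    ultimately have "l dvd q" "l dvd p" using l(1) by (metis prime_dvd_mult_iff prime_dvd_power)+
    then show False using assms(2) l(1) by (meson coprime_common_divisor not_prime_unit)
  qed
  have "0 < q\<^sup>2 + p\<^sup>2" using odd by (auto simp: sum_power2_gt_zero_iff)
  then have V: "0 < V" using UV by simp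
  obtain r where r: "V = r\<^sup>2" using coprime_mult_square_nonneg[OF cop prod] V by auto
  have "0 \<le> U" using prod V by (metis mult_pos_neg not_le zero_le_power2)
  then obtain s where s: "U = s\<^sup>2"
    using coprime_mult_square_nonneg[of U V h] cop prod by (auto simp: coprime_commute mult.commute)
  define m where "m = (q + p) div 2"
  define n where "n = (q - p) div 2"
  have mn: "q = m + n" "p = m - n" using odd unfolding m_def n_def by presburger+
  have cop': "coprime m n"
  proof (rule coprimeI_prime_int)
    fix l :: int assume l: "prime l" "l dvd m" "l dvd n"
    then have "l dvd q" "l dvd p" by (simp_all add: mn)
    then show False using assms(2) l(1) by (meson coprime_common_divisor not_prime_unit)
  qed
  have "2 * r\<^sup>2 = 2 * (m\<^sup>2 + n\<^sup>2)" "2 * s\<^sup>2 = 2 * (m\<^sup>2 + 4 * m * n + n\<^sup>2)"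
    using UV unfolding r s mn by (simp_all add: power2_eq_square algebra_simps)
  then have rs: "r\<^sup>2 = m\<^sup>2 + n\<^sup>2" "s\<^sup>2 = m\<^sup>2 + 4 * m * n + n\<^sup>2" by simp_all
  have nz: "m \<noteq> 0" "n \<noteq> 0" using assms(3) by (auto simp: mn)
  have lt: "m\<^sup>2 + n\<^sup>2 < q\<^sup>2 + p\<^sup>2" using UV(2) V unfolding r rs(1) by simp
  have "odd m \<noteq> odd n" using odd mn by auto
  then consider "odd m" "even n" | "odd n" "even m" by auto
  then show thesis
  proof cases
    case 1
    show thesis
      by (rule quartic_descent[OF 1 cop' nz(2) rs]) (use that lt in force)
  next
    case 2
    have *: "r\<^sup>2 = n\<^sup>2 + m\<^sup>2" "s\<^sup>2 = n\<^sup>2 + 4 * n * m + m\<^sup>2" using rs by (simp_all add: algebra_simps)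
    have "coprime n m" using cop' by (simp add: coprime_commute)
    then show thesis
      by (rule quartic_descent[OF 2 _ nz(1) *]) (use that lt in force)
  qed
qed

lemma E1_int:
  fixes p q g :: int
  assumes "(3 * q\<^sup>2 - p\<^sup>2) * (q\<^sup>2 + p\<^sup>2) = g\<^sup>2" "coprime q p"
  shows "q\<^sup>2 = p\<^sup>2"
  using assms
proof (induction "nat (q\<^sup>2 + p\<^sup>2)" arbitrary: p q g rule: less_induct)
  case less
  show ?case
  proof (rule ccontr)
    assume ne: "q\<^sup>2 \<noteq> p\<^sup>2"
    obtain y z h :: int where yz: "(3 * y\<^sup>2 - z\<^sup>2) * (y\<^sup>2 + z\<^sup>2) = h\<^sup>2" "coprime y z" "y\<^sup>2 \<noteq> z\<^sup>2"
      "y\<^sup>2 + z\<^sup>2 < q\<^sup>2 + p\<^sup>2"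
      using E1_descent[OF less.prems ne] .
    have "0 \<le> y\<^sup>2 + z\<^sup>2" by simp
    then have "nat (y\<^sup>2 + z\<^sup>2) < nat (q\<^sup>2 + p\<^sup>2)" using yz(4) by linarith
    then show False using less.hyps[OF _ yz(1,2)] yz(3) by blast
  qed
qed

section \<open>The cubic ring of discriminant -44\<close>

text \<open>\<open>Cub a b c\<close> stands for \<open>a + b\<theta> + c\<theta>\<^sup>2\<close> with \<open>\<theta>\<^sup>3 = \<theta>\<^sup>2 + \<theta> + 1\<close>.\<close>

datatype cub = Cub (co0: int) (co1: int) (co2: int)

instantiation cub :: comm_ring_1
begin

definition "0 = Cub 0 0 0"
definition "1 = Cub 1 0 0"
definition "- x = Cub (- co0 x) (- co1 x) (- co2 x)"
definition "x + y = Cub (co0 x + co0 y) (co1 x + co1 y) (co2 x + co2 y)"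
definition "x - y = Cub (co0 x - co0 y) (co1 x - co1 y) (co2 x - co2 y)"
text \<open>\<open>s\<close> and \<open>t\<close> are the coefficients of \<open>\<theta>^3\<close>
  and \<open>\<theta>^4\<close>, and
  \<open>\<theta>^4 = 2\<theta>^2 + 2\<theta> + 1\<close>.\<close>

definition "x * y =
  (let p = co0 x * co0 y;
       q = co0 x * co1 y + co1 x * co0 y;
       r = co0 x * co2 y + co1 x * co1 y + co2 x * co0 y;
       s = co1 x * co2 y + co2 x * co1 y;
       t = co2 x * co2 y
   in Cub (p + s + t) (q + s + 2 * t) (r + s + 2 * t))"

lemmas cub_simps = zero_cub_def one_cub_def uminus_cub_def plus_cub_def minus_cub_def times_cub_def Let_def

instance
  by standard (auto simp: cub_simps algebra_simps)

end

section \<open>Norm and cofactor\<close>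

lemma of_int_cub: "of_int k = Cub k 0 0"
proof (induction k rule: int_induct[of _ 0])
  case base
  then show ?case by (simp add: cub_simps)
next
  case (step1 i)
  then show ?case by (simp add: cub_simps)
next
  case (step2 i)
  then show ?case by (simp add: cub_simps)
qed

text \<open>The determinant of multiplication by \<open>a + b\<theta> + c\<theta>^2\<close>. It is
  polymorphic because the Euclidean bound evaluates it at real coordinates.\<close>

definition norm_form :: "'a::comm_ring_1 \<Rightarrow> 'a \<Rightarrow> 'a \<Rightarrow> 'a" where
  "norm_form a b c = a ^ 3 + b ^ 3 + c ^ 3 + a\<^sup>2 * b + 3 * (a\<^sup>2 * c) - a * b\<^sup>2 + b\<^sup>2 * c - a * c\<^sup>2 - b * c\<^sup>2
     - 4 * (a * b * c)"

definition cub_norm :: "cub \<Rightarrow> int" where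
  "cub_norm x = norm_form (co0 x) (co1 x) (co2 x)"

text \<open>The product of the two other conjugates of \<open>x\<close>, in the basis 1, \<theta>,
  \<open>\<theta>^2\<close>.\<close>

definition cub_adj :: "cub \<Rightarrow> cub" where
  "cub_adj x = (let a = co0 x; b = co1 x; c = co2 x in
     Cub ((a + c) * (a + b + 2 * c) - (b + c) * (b + 2 * c))
         (c * (b + 2 * c) - b * (a + b + 2 * c))
         (b * (b + c) - c * (a + c)))"

lemma cub_norm_simps [simp]: "cub_norm 0 = 0" "cub_norm 1 = 1"
  by (simp_all add: cub_norm_def norm_form_def cub_simps)

lemma cub_mult_adj: "x * cub_adj x = of_int (cub_norm x)"
  by (cases x)
     (simp add: cub_norm_def norm_form_def cub_adj_def of_int_cub cub_simps power2_eq_square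
        power3_eq_cube algebra_simps)

lemma cub_adj_mult: "cub_adj (x * y) = cub_adj x * cub_adj y"
  by (cases x; cases y) (simp add: cub_adj_def cub_simps algebra_simps)

lemma of_int_cub_eq_iff [simp]: "(of_int k :: cub) = of_int l \<longleftrightarrow> k = l"
  by (simp add: of_int_cub)

lemma cub_norm_mult [simp]: "cub_norm (x * y) = cub_norm x * cub_norm y"
proof -
  have "of_int (cub_norm (x * y)) = (x * y) * cub_adj (x * y)" by (simp only: cub_mult_adj)
  also have "\<dots> = (x * cub_adj x) * (y * cub_adj y)" by (simp add: cub_adj_mult ac_simps)
  finally have "(of_int (cub_norm (x * y)) :: cub) = of_int (cub_norm x * cub_norm y)"
    by (simp only: cub_mult_adj of_int_mult)
  then show ?thesis by (simp only: of_int_cub_eq_iff)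
qed

lemma cub_norm_power [simp]: "cub_norm (x ^ n) = cub_norm x ^ n"
  by (induction n) simp_all

lemma cub_norm_of_int [simp]: "cub_norm (of_int k) = k ^ 3"
  by (simp add: cub_norm_def norm_form_def of_int_cub)

lemma cub_norm_adj:
  assumes "cub_norm x \<noteq> 0"
  shows "cub_norm (cub_adj x) = (cub_norm x)\<^sup>2"
proof -
  have "cub_norm x * cub_norm (cub_adj x) = cub_norm x * (cub_norm x)\<^sup>2"
    using arg_cong[OF cub_mult_adj[of x], of cub_norm] by (simp add: power2_eq_square power3_eq_cube)
  then show ?thesis using assms by simp
qed

text \<open>2 is totally ramified, the cubic being \<open>(X + 1)^3\<close> modulo 2. Each factor 2
  of the norm therefore yields one more parity condition: on \<open>a + b + c\<close>, then on
  \<open>b\<close>, then on \<open>c\<close>.\<close>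

lemma norm_form_zero_even:
  fixes a b c :: int
  assumes "norm_form a b c = 0"
  shows "even a \<and> even b \<and> even c"
proof -
  have "even (norm_form a b c) = even (a + b + c)" unfolding norm_form_def by auto
  then have "even (a + b + c)" using assms by simp
  then obtain k where "a + b + c = 2 * k" ..
  then have a: "a = 2 * k - b - c" by simp
  have "norm_form a b c = 2 * (2 * (2 * k^3 - 2 * k\<^sup>2 * b - 3 * (k * b * c) + 2 * b\<^sup>2 * c - 2 * k * c\<^sup>2
      + 2 * b * c\<^sup>2 + c ^ 3) + b ^ 3)"
    unfolding a norm_form_def by (simp add: power2_eq_square power3_eq_cube algebra_simps)
  then have b0: "2 * (2 * k^3 - 2 * k\<^sup>2 * b - 3 * (k * b * c) + 2 * b\<^sup>2 * c - 2 * k * c\<^sup>2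
      + 2 * b * c\<^sup>2 + c ^ 3) + b ^ 3 = 0" using assms by simp
  have "even (2 * (2 * k^3 - 2 * k\<^sup>2 * b - 3 * (k * b * c) + 2 * b\<^sup>2 * c - 2 * k * c\<^sup>2
      + 2 * b * c\<^sup>2 + c ^ 3) + b ^ 3)" unfolding b0 by simp
  then have "even b" by simp
  then obtain j where b: "b = 2 * j" ..
  have "2 * (2 * (k ^ 3 - 2 * k\<^sup>2 * j - 3 * (k * j * c) + 4 * j\<^sup>2 * c - k * c\<^sup>2 + 2 * j * c\<^sup>2
      + 2 * j ^ 3) + c ^ 3) = 2 * 0"
    using b0 unfolding b by (simp add: power2_eq_square power3_eq_cube algebra_simps)
  then have c0: "2 * (k ^ 3 - 2 * k\<^sup>2 * j - 3 * (k * j * c) + 4 * j\<^sup>2 * c - k * c\<^sup>2 + 2 * j * c\<^sup>2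
      + 2 * j ^ 3) + c ^ 3 = 0" by simp
  have "even (2 * (k ^ 3 - 2 * k\<^sup>2 * j - 3 * (k * j * c) + 4 * j\<^sup>2 * c - k * c\<^sup>2 + 2 * j * c\<^sup>2
      + 2 * j ^ 3) + c ^ 3)" unfolding c0 by simp
  then have "even c" by simp
  then show ?thesis using \<open>even b\<close> a by simp
qed

text \<open>Infinite descent: an element of norm 0 is twice another one of norm 0.\<close>

lemma cub_norm_eq_0_iff: "cub_norm x = 0 \<longleftrightarrow> x = 0"
proof
  assume "cub_norm x = 0"
  then show "x = 0"
  proof (induction "nat (\<bar>co0 x\<bar> + \<bar>co1 x\<bar> + \<bar>co2 x\<bar>)" arbitrary: x rule: less_induct)
    case less
    show ?case
    proof (rule ccontr)
      assume x: "x \<noteq> 0"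
      from less.prems have "norm_form (co0 x) (co1 x) (co2 x) = 0" by (simp add: cub_norm_def)
      from norm_form_zero_even[OF this] obtain a b c where abc: "co0 x = 2 * a" "co1 x = 2 * b" "co2 x = 2 * c"
        by (auto elim!: evenE)
      have xe: "x = of_int 2 * Cub a b c" using abc by (cases x) (simp add: of_int_cub cub_simps)
      have "cub_norm (Cub a b c) = 0" using less.prems unfolding xe by (simp only: cub_norm_mult cub_norm_of_int) simp
      moreover have "nat (\<bar>a\<bar> + \<bar>b\<bar> + \<bar>c\<bar>) < nat (\<bar>co0 x\<bar> + \<bar>co1 x\<bar> + \<bar>co2 x\<bar>)"
        using x abc by (cases x) (auto simp: cub_simps)
      ultimately have "Cub a b c = 0" using less.hyps[of "Cub a b c"] by simp
      then show False using x xe by simp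
    qed
  qed
qed simp

section \<open>The norm-Euclidean algorithm\<close>

text \<open>A linear relaxation: \<open>a\<close>, \<open>b\<close>, \<open>c\<close> stand for the
  cubes of \<open>x\<close>, \<open>y\<close>, \<open>z\<close> and \<open>p\<close> for their
  product. For nonpositive \<open>t\<close> the cube lies below its tangent \<open>3t + 2\<close> at
  -1, so that each pattern of signs is a problem of linear arithmetic.\<close>

lemma signed_cubes_bound:
  fixes x y z p a b c :: real
  assumes "\<bar>x\<bar> \<le> 1" "\<bar>y\<bar> \<le> 1" "\<bar>z\<bar> \<le> 1" "\<bar>p\<bar> \<le> \<bar>x\<bar>" "\<bar>p\<bar> \<le> \<bar>y\<bar>" "\<bar>p\<bar> \<le> \<bar>z\<bar>"
    and "a \<le> 1" "b \<le> 1" "c \<le> 1"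
    and "x \<le> 0 \<Longrightarrow> a \<le> 3 * x + 2 \<and> a \<le> 0" "y \<le> 0 \<Longrightarrow> b \<le> 3 * y + 2 \<and> b \<le> 0" "z \<le> 0 \<Longrightarrow> c \<le> 3 * z + 2 \<and> c \<le> 0"
    and "sgn p = sgn x * sgn y * sgn z"
  shows "a + 44/27 * b + 34/27 * c - 34/9 * p \<le> 6"
proof -
  consider "0 \<le> p" | "p < 0" "x < 0" "0 < y" "0 < z" | "p < 0" "0 < x" "y < 0" "0 < z"
    | "p < 0" "0 < x" "0 < y" "z < 0" | "p < 0" "x < 0" "y < 0" "z < 0"
    using assms(13) by (auto simp: sgn_if split: if_splits)
  then show ?thesis
    by cases (use assms in linarith)+
qed

text \<open>The argument is \<open>x\<theta> + y(\<theta>\<^sup>2 - (2/3)\<theta> - 1/3) + z(1 + \<theta>/3)\<close>. These three vectors arise from \<open>\<theta>\<close>, \<open>\<theta>\<^sup>2\<close>, \<open>1\<close>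
  by a unitriangular change of basis, so rounding one coordinate after the other brings every
  element of the field into the box of half this size, where the norm is smaller than 1.\<close>

lemma norm_form_bound:
  fixes x y z :: real
  assumes x: "\<bar>x\<bar> \<le> 1" and y: "\<bar>y\<bar> \<le> 1" and z: "\<bar>z\<bar> \<le> 1"
  shows "\<bar>norm_form (z - y / 3) (x - 2 * y / 3 + z / 3) y\<bar> < 8"
proof -
  have exp: "norm_form (z - y / 3) (x - 2 * y / 3 + z / 3) y =
     x ^ 3 + 44/27 * y ^ 3 + 34/27 * z ^ 3 - 2/3 * (x\<^sup>2 * y) + 2/3 * (z\<^sup>2 * x)
      + 4/27 * (z\<^sup>2 * y) - 34/9 * (x * y * z)"
    unfolding norm_form_def by (simp add: power2_eq_square power3_eq_cube field_simps)
  have cube: "(t \<le> 0 \<longrightarrow> t ^ 3 \<le> 3 * t + 2 \<and> t ^ 3 \<le> 0) \<and> \<bar>t ^ 3\<bar> \<le> 1" if "\<bar>t\<bar> \<le> 1" for t :: real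
  proof (intro conjI impI)
    have "0 \<le> (t + 1)\<^sup>2 * (2 - t)"
      using that by (intro mult_nonneg_nonneg) simp_all
    then show "t ^ 3 \<le> 3 * t + 2"
      by (simp add: power2_eq_square power3_eq_cube algebra_simps)
    show "\<bar>t ^ 3\<bar> \<le> 1" using that by (simp add: power_abs power_le_one)
    show "t ^ 3 \<le> 0" if "t \<le> 0" using that by (simp add: power_le_zero_eq)
  qed
  \<comment> \<open>The three mixed terms have total weight 2/3 + 2/3 + 4/27 < 2, so a bound of 6 on
    the other terms is enough.\<close>
  have small: "\<bar>s\<^sup>2 * t\<bar> \<le> 1" if "\<bar>s\<bar> \<le> 1" "\<bar>t\<bar> \<le> 1" for s t :: real
    unfolding abs_mult using that by (intro mult_le_one) (simp_all add: abs_square_le_1)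
  have prod: "\<bar>r * s * t\<bar> \<le> \<bar>r\<bar>" if "\<bar>s\<bar> \<le> 1" "\<bar>t\<bar> \<le> 1" for r s t :: real
    unfolding abs_mult mult.assoc using that by (intro mult_left_le mult_le_one) simp_all
  have up: "x ^ 3 + 44/27 * y ^ 3 + 34/27 * z ^ 3 - 34/9 * (x * y * z) \<le> 6"
    if xyz: "\<bar>x\<bar> \<le> 1" "\<bar>y\<bar> \<le> 1" "\<bar>z\<bar> \<le> 1" for x y z :: real
  proof (rule signed_cubes_bound[OF xyz])
    show "\<bar>x * y * z\<bar> \<le> \<bar>x\<bar>" "\<bar>x * y * z\<bar> \<le> \<bar>y\<bar>" "\<bar>x * y * z\<bar> \<le> \<bar>z\<bar>"
      using prod[of y z x] prod[of x z y] prod[of x y z] xyz by (simp_all add: ac_simps)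
    show "x ^ 3 \<le> 1" "y ^ 3 \<le> 1" "z ^ 3 \<le> 1"
      using cube[OF xyz(1)] cube[OF xyz(2)] cube[OF xyz(3)] by linarith+
    show "x ^ 3 \<le> 3 * x + 2 \<and> x ^ 3 \<le> 0" if "x \<le> 0" using that cube[OF xyz(1)] by blast
    show "y ^ 3 \<le> 3 * y + 2 \<and> y ^ 3 \<le> 0" if "y \<le> 0" using that cube[OF xyz(2)] by blast
    show "z ^ 3 \<le> 3 * z + 2 \<and> z ^ 3 \<le> 0" if "z \<le> 0" using that cube[OF xyz(3)] by blast
  qed (simp add: sgn_mult)
  have "x ^ 3 + 44/27 * y ^ 3 + 34/27 * z ^ 3 - 34/9 * (x * y * z) \<le> 6"
    by (rule up[OF x y z])
  \<comment> \<open>These terms form an odd function, so the lower bound is the upper bound at the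
    negated arguments.\<close>
  moreover have "(- x) ^ 3 + 44/27 * (- y) ^ 3 + 34/27 * (- z) ^ 3 - 34/9 * (- x * - y * - z) \<le> 6"
    by (rule up) (use x y z in simp_all)
  then have "- 6 \<le> x ^ 3 + 44/27 * y ^ 3 + 34/27 * z ^ 3 - 34/9 * (x * y * z)" by simp
  ultimately show ?thesis
    unfolding exp abs_less_iff using small[OF x y] small[OF z x] small[OF z y] unfolding abs_le_iff by linarith
qed

lemma norm_form_of_int: "norm_form (of_int a) (of_int b) (of_int c) = of_int (norm_form a b c)"
  by (simp add: norm_form_def)

lemma norm_form_scale: "norm_form (k * a) (k * b) (k * c) = k ^ 3 * norm_form a b c"
  unfolding norm_form_def by (simp add: power2_eq_square power3_eq_cube algebra_simps)

lemma cub_division: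
  assumes "\<beta> \<noteq> 0"
  obtains \<kappa> where "\<bar>cub_norm (\<alpha> - \<kappa> * \<beta>)\<bar> < \<bar>cub_norm \<beta>\<bar>"
proof -
  define n where "n = cub_norm \<beta>"
  have n: "n \<noteq> 0" using assms by (simp add: n_def cub_norm_eq_0_iff)
  define \<mu> where "\<mu> = \<alpha> * cub_adj \<beta>"
  define a b c :: real where "a = co0 \<mu> / n" and "b = co1 \<mu> / n" and "c = co2 \<mu> / n"
  \<comment> \<open>The \<open>\<theta>^2\<close> coordinate is rounded first, because the vector
    belonging to \<open>y\<close> also has components along 1 and \<theta>; then the coordinate
    along 1, because the vector belonging to \<open>z\<close> still has one along \<theta>.\<close>
  define k3 where "k3 = round c"
  define y where "y = c - k3"
  define k1 where "k1 = round (a + y / 3)"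
  define z where "z = a - k1 + y / 3"
  define k2 where "k2 = round (b + 2 * y / 3 - z / 3)"
  define x where "x = b - k2 + 2 * y / 3 - z / 3"
  have rd: "\<bar>t - round t\<bar> \<le> 1 / 2" for t :: real
    using of_int_round_abs_le[of t] by (simp add: abs_minus_commute)
  have "y = c - round c" "z = (a + y / 3) - round (a + y / 3)"
    "x = (b + 2 * y / 3 - z / 3) - round (b + 2 * y / 3 - z / 3)"
    unfolding x_def y_def z_def k1_def k2_def k3_def by simp_all
  then have "\<bar>x\<bar> \<le> 1 / 2" "\<bar>y\<bar> \<le> 1 / 2" "\<bar>z\<bar> \<le> 1 / 2" using rd by metis+
  then have small: "\<bar>2 * x\<bar> \<le> 1" "\<bar>2 * y\<bar> \<le> 1" "\<bar>2 * z\<bar> \<le> 1" by linarith+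
  have abc: "a - k1 = z - y / 3" "b - k2 = x - 2 * y / 3 + z / 3" "c - k3 = y"
    by (simp_all add: x_def y_def z_def)
  define \<kappa> where "\<kappa> = Cub k1 k2 k3"
  define \<rho> where "\<rho> = \<alpha> - \<kappa> * \<beta>"
  have "\<rho> * cub_adj \<beta> = \<mu> - \<kappa> * of_int n"
    unfolding \<rho>_def \<mu>_def n_def cub_mult_adj[symmetric] by (simp add: algebra_simps)
  also have "\<dots> = Cub (co0 \<mu> - n * k1) (co1 \<mu> - n * k2) (co2 \<mu> - n * k3)"
    by (simp add: \<kappa>_def of_int_cub cub_simps mult.commute)
  finally have "cub_norm (\<rho> * cub_adj \<beta>) = norm_form (co0 \<mu> - n * k1) (co1 \<mu> - n * k2) (co2 \<mu> - n * k3)"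
    by (simp add: cub_norm_def)
  moreover have "cub_norm (\<rho> * cub_adj \<beta>) = cub_norm \<rho> * n\<^sup>2"
    using n cub_norm_adj[of \<beta>] by (simp add: n_def)
  ultimately have "cub_norm \<rho> * n\<^sup>2 = norm_form (co0 \<mu> - n * k1) (co1 \<mu> - n * k2) (co2 \<mu> - n * k3)"
    by simp
  then have "real_of_int (cub_norm \<rho>) * (real_of_int n)\<^sup>2
      = norm_form (of_int (co0 \<mu> - n * k1)) (of_int (co1 \<mu> - n * k2)) (of_int (co2 \<mu> - n * k3))"
    unfolding norm_form_of_int by (metis of_int_mult of_int_power)
  \<comment> \<open>The doubled coordinates lie in the unit box of \<open>norm_form_bound\<close>,
    and the factor 8 lost by homogeneity is exactly the bound proved there.\<close>
  also have "\<dots> = norm_form (of_int n / 2 * (2 * (a - k1))) (of_int n / 2 * (2 * (b - k2))) (of_int n / 2 * (2 * (c - k3)))"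
    using n by (simp add: a_def b_def c_def right_diff_distrib)
  also have "\<dots> = (of_int n / 2) ^ 3 * norm_form (2 * (a - k1)) (2 * (b - k2)) (2 * (c - k3))"
    by (rule norm_form_scale)
  also have "norm_form (2 * (a - k1)) (2 * (b - k2)) (2 * (c - k3)) =
      norm_form (2 * z - 2 * y / 3) (2 * x - 2 * (2 * y) / 3 + 2 * z / 3) (2 * y)"
    unfolding abc by (simp add: algebra_simps)
  finally have "real_of_int (cub_norm \<rho>) = of_int n / 8 *
      norm_form (2 * z - 2 * y / 3) (2 * x - 2 * (2 * y) / 3 + 2 * z / 3) (2 * y)"
    using n by (simp add: field_simps power2_eq_square power3_eq_cube)
  then have "\<bar>real_of_int (cub_norm \<rho>)\<bar> = \<bar>of_int n\<bar> / 8 *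
      \<bar>norm_form (2 * z - 2 * y / 3) (2 * x - 2 * (2 * y) / 3 + 2 * z / 3) (2 * y)\<bar>"
    by (simp only: abs_mult abs_divide abs_numeral)
  also have "\<dots> < \<bar>of_int n\<bar> / 8 * 8"
    using norm_form_bound[OF small] n by (intro mult_strict_left_mono) simp_all
  finally have "\<bar>cub_norm \<rho>\<bar> < \<bar>n\<bar>" by linarith
  then show thesis using that by (simp add: \<rho>_def n_def)
qed

lemma cub_bezout:
  obtains \<gamma> s t \<sigma> \<tau> :: cub where "\<gamma> = s * \<alpha> + t * \<beta>" "\<alpha> = \<gamma> * \<sigma>" "\<beta> = \<gamma> * \<tau>"
proof -
  have "\<exists>\<gamma> s t \<sigma> \<tau>. \<gamma> = s * \<alpha> + t * \<beta> \<and> \<alpha> = \<gamma> * \<sigma> \<and> \<beta> = \<gamma> * \<tau>"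
  proof (induction "nat \<bar>cub_norm \<beta>\<bar>" arbitrary: \<alpha> \<beta> rule: less_induct)
    case less
    show ?case
    proof (cases "\<beta> = 0")
      case True
      then show ?thesis by (intro exI[of _ \<alpha>] exI[of _ 1] exI[of _ 0]) simp
    next
      case False
      then obtain \<kappa> where "\<bar>cub_norm (\<alpha> - \<kappa> * \<beta>)\<bar> < \<bar>cub_norm \<beta>\<bar>" by (rule cub_division)
      then have "nat \<bar>cub_norm (\<alpha> - \<kappa> * \<beta>)\<bar> < nat \<bar>cub_norm \<beta>\<bar>" by simp
      from less.hyps[OF this, of \<beta>] obtain \<gamma> s t \<sigma> \<tau> where
        *: "\<gamma> = s * \<beta> + t * (\<alpha> - \<kappa> * \<beta>)" "\<beta> = \<gamma> * \<sigma>" "\<alpha> - \<kappa> * \<beta> = \<gamma> * \<tau>" by blast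
      have "\<gamma> = t * \<alpha> + (s - t * \<kappa>) * \<beta>" unfolding *(1) by (simp add: algebra_simps)
      moreover have "\<alpha> = \<gamma> * (\<tau> + \<kappa> * \<sigma>)" using *(2,3) by (simp add: algebra_simps)
      ultimately show ?thesis using *(2) by blast
    qed
  qed
  then show thesis using that by blast
qed

section \<open>Units modulo squares\<close>

definition \<theta> :: cub where "\<theta> = Cub 0 1 0"
definition \<theta>inv :: cub where "\<theta>inv = Cub (- 1) (- 1) 1"

lemma \<theta>_inv: "\<theta> * \<theta>inv = 1"
  by (simp add: \<theta>_def \<theta>inv_def cub_simps)

lemma norm_\<theta> [simp]: "cub_norm \<theta> = 1" "cub_norm \<theta>inv = 1"
  by (simp_all add: \<theta>_def \<theta>inv_def cub_norm_def norm_form_def)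

lemma tribonacci_root:
  obtains t :: real where "t ^ 3 = t\<^sup>2 + t + 1" "1.83 \<le> t" "t \<le> 1.84"
proof -
  have "\<exists>t\<ge>1.83. t \<le> 1.84 \<and> t ^ 3 - t\<^sup>2 - t - 1 = (0::real)"
    by (rule IVT) (auto simp: power2_eq_square power3_eq_cube intro!: continuous_intros)
  then obtain t :: real where "t ^ 3 - t\<^sup>2 - t - 1 = 0" "1.83 \<le> t" "t \<le> 1.84" by blast
  then show thesis using that[of t] by simp
qed

definition emb :: "real \<Rightarrow> cub \<Rightarrow> real" where
  "emb t x = of_int (co0 x) + of_int (co1 x) * t + of_int (co2 x) * t\<^sup>2"

lemma emb_mult:
  assumes "t ^ 3 = t\<^sup>2 + t + 1"
  shows "emb t (x * y) = emb t x * emb t y"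
proof -
  have t4: "t ^ 4 = 2 * t\<^sup>2 + 2 * t + 1"
    using assms by (simp add: power_numeral_even power_numeral_odd power2_eq_square power3_eq_cube algebra_simps)
  have "emb t x * emb t y = of_int (co0 x * co0 y) + of_int (co0 x * co1 y + co1 x * co0 y) * t
     + of_int (co0 x * co2 y + co1 x * co1 y + co2 x * co0 y) * t\<^sup>2 + of_int (co1 x * co2 y + co2 x * co1 y) * t ^ 3
     + of_int (co2 x * co2 y) * t ^ 4"
    unfolding emb_def by (simp add: power2_eq_square power3_eq_cube power4_eq_xxxx algebra_simps)
  also have "\<dots> = emb t (x * y)"
    unfolding t4 assms by (simp add: emb_def cub_simps algebra_simps)
  finally show ?thesis by simp
qed

lemma emb_power:
  assumes "t ^ 3 = t\<^sup>2 + t + 1"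
  shows "emb t (x ^ n) = emb t x ^ n"
  by (induction n) (simp_all add: emb_mult[OF assms], simp add: emb_def cub_simps)

text \<open>The second factor is the squared modulus of the complex embedding, written in terms of the real
  root \<open>t\<close> alone.\<close>

lemma cub_norm_emb:
  assumes t: "t ^ 3 = t\<^sup>2 + t + 1"
  defines "U \<equiv> \<lambda>x. of_int (co0 x) - of_int (co2 x) * (t\<^sup>2 - t - 1)" and "V \<equiv> \<lambda>x. of_int (co1 x) + of_int (co2 x) * (1 - t)"
  shows "cub_norm x = emb t x * ((U x)\<^sup>2 + U x * V x * (1 - t) + (t\<^sup>2 - t - 1) * (V x)\<^sup>2)"
proof (cases x)
  case (Cub a b c)
  have "norm_form a b c =
     (a + b * t + c * t\<^sup>2) * ((a - c * (t\<^sup>2 - t - 1))\<^sup>2 + (a - c * (t\<^sup>2 - t - 1)) * (b + c * (1 - t)) * (1 - t)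
        + (t\<^sup>2 - t - 1) * (b + c * (1 - t))\<^sup>2)" for a b c :: real
  proof -
    have t3: "t * (t * t) = t * t + t + 1" "\<And>x. t * (t * (t * x)) = t * (t * x) + t * x + x"
      using t by (simp_all add: power2_eq_square power3_eq_cube) (metis distrib_right mult.assoc mult_1)+
    show ?thesis
      unfolding norm_form_def by (simp add: power2_eq_square power3_eq_cube algebra_simps t3)
  qed
  then show ?thesis
    unfolding cub_norm_def norm_form_of_int[symmetric] by (simp add: emb_def U_def V_def Cub)
qed

text \<open>Norm 1 and \<open>emb t x\<close> at least 1 keep the squared modulus \<open>M\<close>
  of the complex embedding at most 1. As \<open>M\<close> is a positive definite form in
  \<open>U\<close> and \<open>V\<close>, both are bounded, hence so are the three coordinates, and a
  finite check remains.\<close>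

lemma small_unit:
  assumes x: "cub_norm x = 1" and t: "t ^ 3 = t\<^sup>2 + t + 1" "1.83 \<le> t" "t \<le> 1.84"
    and L: "1 \<le> emb t x" "emb t x < t\<^sup>2"
  shows "\<exists>\<delta>. x = \<delta>\<^sup>2 \<or> x = \<theta> * \<delta>\<^sup>2"
proof (cases x)
  case (Cub a b c)
  define U V where "U = of_int a - of_int c * (t\<^sup>2 - t - 1)" and "V = of_int b + of_int c * (1 - t)"
  define M where "M = U\<^sup>2 + U * V * (1 - t) + (t\<^sup>2 - t - 1) * V\<^sup>2"
  have LM: "emb t x * M = 1"
    using cub_norm_emb[OF t(1), of x] x unfolding M_def U_def V_def Cub by simp
  have "M \<le> 1"
  proof (rule ccontr)
    assume "\<not> M \<le> 1"
    then have "1 * 1 < emb t x * M" using L(1) by (intro mult_le_less_imp_less) simp_all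
    then show False using LM by simp
  qed
  have t2: "1.83 * 1.83 \<le> t * t" "t * t \<le> 1.84 * 1.84"
    using t by (intro mult_mono; simp)+
  have "1.83 * 3.49 \<le> t * (3 * t - 2)" using t by (intro mult_mono) simp_all
  then have k: "1.3867 \<le> 3 * t\<^sup>2 - 2 * t - 5" by (simp add: power2_eq_square algebra_simps)
  have "0.83 * 1.83 \<le> t * (t - 1)" "t * (t - 1) \<le> 1.84 * 0.84"
    using t mult_mono[of "1.83" t "0.83" "t - 1"] mult_mono[of t "1.84" "t - 1" "0.84"] by simp_all
  then have n: "0.5 \<le> t\<^sup>2 - t - 1" "t\<^sup>2 - t - 1 \<le> 0.5456" by (simp_all add: power2_eq_square algebra_simps)
  \<comment> \<open>\<open>3t^2 - 2t - 5\<close> equals \<open>4(t^2 - t - 1) - (1 - t)^2\<close>,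
    minus the discriminant of the form \<open>M\<close>; the same constant therefore serves for
    \<open>V\<close> and for \<open>U\<close>.\<close>
  have "4 * M = (2 * U + (1 - t) * V)\<^sup>2 + (3 * t\<^sup>2 - 2 * t - 5) * V\<^sup>2"
    unfolding M_def by (simp add: power2_eq_square algebra_simps)
  moreover have "1.3867 * V\<^sup>2 \<le> (3 * t\<^sup>2 - 2 * t - 5) * V\<^sup>2" using k by (intro mult_right_mono) simp_all
  moreover have "0 \<le> (2 * U + (1 - t) * V)\<^sup>2" by simp
  ultimately have "1.3867 * V\<^sup>2 \<le> 4" using \<open>M \<le> 1\<close> by linarith
  then have "V\<^sup>2 < 1.7\<^sup>2" by (simp add: power2_eq_square)
  then have V: "\<bar>V\<bar> < 1.7" using power2_less_imp_less[of "\<bar>V\<bar>" "1.7"] by simp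
  have "(4 * (t\<^sup>2 - t - 1)) * M \<le> (4 * (t\<^sup>2 - t - 1)) * 1"
    using n \<open>M \<le> 1\<close> by (intro mult_left_mono) simp_all
  also have "\<dots> \<le> 4 * 0.5456" unfolding mult_1_right by (intro mult_left_mono[OF n(2)]) simp
  finally have up: "4 * (t\<^sup>2 - t - 1) * M \<le> 4 * 0.5456" .
  have "4 * (t\<^sup>2 - t - 1) * M = (2 * (t\<^sup>2 - t - 1) * V + (1 - t) * U)\<^sup>2 + (3 * t\<^sup>2 - 2 * t - 5) * U\<^sup>2"
    unfolding M_def by (simp add: power2_eq_square algebra_simps)
  moreover note up
  moreover have "1.3867 * U\<^sup>2 \<le> (3 * t\<^sup>2 - 2 * t - 5) * U\<^sup>2" using k by (intro mult_right_mono) simp_all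
  moreover have "0 \<le> (2 * (t\<^sup>2 - t - 1) * V + (1 - t) * U)\<^sup>2" by simp
  ultimately have "1.3867 * U\<^sup>2 \<le> 4 * 0.5456" by linarith
  then have "U\<^sup>2 < 1.255\<^sup>2" by (simp add: power2_eq_square)
  then have U: "\<bar>U\<bar> < 1.255" using power2_less_imp_less[of "\<bar>U\<bar>" "1.255"] by simp
  \<comment> \<open>\<open>emb t x\<close> and \<open>U + V * t\<close> differ by \<open>c\<close>
    times the derivative of \<open>X^3 - X^2 - X - 1\<close> at \<open>t\<close>. This bounds
    \<open>c\<close>; the bounds on \<open>b\<close> and \<open>a\<close> then follow from
    \<open>V\<close> and \<open>U\<close>.\<close>
  define Q where "Q = of_int c * (3 * t\<^sup>2 - 2 * t - 1)"
  have "\<bar>V * t\<bar> \<le> 1.7 * 1.84" unfolding abs_mult using V t by (intro mult_mono) simp_all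
  moreover have "emb t x = U + V * t + Q"
    unfolding emb_def Cub U_def V_def Q_def by (simp add: power2_eq_square algebra_simps)
  moreover have "emb t x < 3.3856" using L(2) t2 by (simp add: power2_eq_square)
  ultimately have "\<bar>Q\<bar> < 7.8" using L(1) U by (simp add: abs_less_iff abs_le_iff)
  moreover have "\<bar>of_int c :: real\<bar> * 5.3 \<le> \<bar>of_int c\<bar> * \<bar>3 * t\<^sup>2 - 2 * t - 1\<bar>"
    using k by (intro mult_left_mono) simp_all
  ultimately have "\<bar>of_int c :: real\<bar> < 2" unfolding Q_def abs_mult by simp
  then have c: "c = - 1 \<or> c = 0 \<or> c = 1" by linarith
  have "\<bar>of_int b :: real\<bar> < 3" using V c t(2,3) unfolding V_def abs_less_iff by (elim disjE) auto
  then have b: "b = - 2 \<or> b = - 1 \<or> b = 0 \<or> b = 1 \<or> b = 2" by linarith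
  have "\<bar>of_int a :: real\<bar> < 2" using U c n unfolding U_def abs_less_iff by (elim disjE) auto
  then have a: "a = - 1 \<or> a = 0 \<or> a = 1" by linarith
  have "norm_form a b c = 1" using x by (simp add: cub_norm_def Cub)
  \<comment> \<open>The elements of norm 1 in this box are \<open>\<theta>^n\<close> for
    \<open>n\<close> from -2 to 3; \<open>Cub 1 1 (- 1)\<close> is
    \<open>-1/\<theta>\<close>.\<close>
  then consider "x = 1\<^sup>2" | "x = \<theta> * 1\<^sup>2" | "x = (Cub 0 1 0)\<^sup>2" | "x = \<theta> * (Cub 0 1 0)\<^sup>2" | "x = (Cub 1 1 (- 1))\<^sup>2"
    | "x = \<theta> * (Cub 1 1 (- 1))\<^sup>2"
    using a b c unfolding Cub norm_form_def power2_eq_square[of "_ :: cub"] \<theta>_def cub_simps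
    by (elim disjE) simp_all
  then show ?thesis by cases blast+
qed

text \<open>\<open>emb t x\<close> is positive because its cofactor in the norm is nonnegative.
  Multiplying by an even power of \<theta> changes nothing modulo squares and brings
  \<open>emb t x\<close> into the range of \<open>small_unit\<close>.\<close>

lemma unit_mod_squares:
  assumes x: "cub_norm x = 1"
  shows "\<exists>\<delta>. x = \<delta>\<^sup>2 \<or> x = \<theta> * \<delta>\<^sup>2"
proof -
  obtain t :: real where t: "t ^ 3 = t\<^sup>2 + t + 1" "1.83 \<le> t" "t \<le> 1.84" by (rule tribonacci_root)
  have emb_\<theta>: "emb t \<theta> = t" by (simp add: emb_def \<theta>_def)
  have emb_1: "emb t 1 = 1" by (simp add: emb_def cub_simps)
  have "emb t x \<noteq> 0" using cub_norm_emb[OF t(1), of x] x by auto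
  have pos: "0 < emb t x"
  proof (rule ccontr)
    assume "\<not> 0 < emb t x"
    then have neg: "emb t x < 0" using \<open>emb t x \<noteq> 0\<close> by simp
    define U V where "U = of_int (co0 x) - of_int (co2 x) * (t\<^sup>2 - t - 1)"
      and "V = of_int (co1 x) + of_int (co2 x) * (1 - t)"
    have "1.83 * 3.49 \<le> t * (3 * t - 2)" using t by (intro mult_mono) simp_all
    then have k: "0 \<le> 3 * t\<^sup>2 - 2 * t - 5" by (simp add: power2_eq_square algebra_simps)
    have "4 * (U\<^sup>2 + U * V * (1 - t) + (t\<^sup>2 - t - 1) * V\<^sup>2) = (2 * U + (1 - t) * V)\<^sup>2 + (3 * t\<^sup>2 - 2 * t - 5) * V\<^sup>2"
      by (simp add: power2_eq_square algebra_simps)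
    also have "0 \<le> \<dots>" using k by simp
    finally have "0 \<le> U\<^sup>2 + U * V * (1 - t) + (t\<^sup>2 - t - 1) * V\<^sup>2" by simp
    then have "emb t x * (U\<^sup>2 + U * V * (1 - t) + (t\<^sup>2 - t - 1) * V\<^sup>2) \<le> 0"
      using neg by (simp add: mult_nonpos_nonneg)
    then show False using cub_norm_emb[OF t(1), of x] x unfolding U_def V_def by simp
  qed
  have t1: "1 < t\<^sup>2" using t by (simp add: one_less_power)
  show ?thesis
  proof (cases "1 \<le> emb t x")
    case True
    obtain m where "emb t x < (t\<^sup>2) ^ m" using real_arch_pow[OF t1] by blast
    then have ex: "\<exists>m. emb t x < (t\<^sup>2) ^ m" ..
    define m where "m = (LEAST m. emb t x < (t\<^sup>2) ^ m)"
    have m: "emb t x < (t\<^sup>2) ^ m" unfolding m_def using ex by (rule LeastI_ex)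
    then obtain n where n: "m = Suc n" using True by (cases m) simp_all
    have n': "(t\<^sup>2) ^ n \<le> emb t x" using not_less_Least[of n "\<lambda>m. emb t x < (t\<^sup>2) ^ m"] n m_def by auto
    define y where "y = x * (\<theta>inv ^ n)\<^sup>2"
    have "x = x * (\<theta> ^ n * \<theta>inv ^ n)\<^sup>2" by (simp add: power_mult_distrib[symmetric] \<theta>_inv)
    then have xy: "x = y * (\<theta> ^ n)\<^sup>2" by (simp add: y_def power_mult_distrib ac_simps)
    then have "emb t x = emb t y * (t\<^sup>2) ^ n"
      by (simp add: emb_mult[OF t(1)] emb_power[OF t(1)] emb_\<theta> mult.commute flip: power_mult)
    then have "1 * (t\<^sup>2) ^ n \<le> emb t y * (t\<^sup>2) ^ n" "emb t y * (t\<^sup>2) ^ n < t\<^sup>2 * (t\<^sup>2) ^ n"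
      using n' m n by simp_all
    moreover have "0 < (t\<^sup>2) ^ n" by (rule zero_less_power) (use t1 in linarith)
    ultimately have "1 \<le> emb t y" "emb t y < t\<^sup>2"
      using mult_le_cancel_right_pos mult_less_cancel_right_pos by blast+
    moreover have "cub_norm y = 1" using x by (simp add: y_def)
    ultimately obtain \<delta> where "y = \<delta>\<^sup>2 \<or> y = \<theta> * \<delta>\<^sup>2" using small_unit t by blast
    then have "x = (\<delta> * \<theta> ^ n)\<^sup>2 \<or> x = \<theta> * (\<delta> * \<theta> ^ n)\<^sup>2"
      unfolding xy by (auto simp: power_mult_distrib mult.assoc)
    then show ?thesis by blast
  next
    case False
    obtain m where "1 / emb t x < (t\<^sup>2) ^ m" using real_arch_pow[OF t1] by blast
    then have "1 \<le> emb t x * (t\<^sup>2) ^ m" using pos by (simp add: field_simps)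
    then have ex: "\<exists>m. 1 \<le> emb t x * (t\<^sup>2) ^ m" ..
    define m where "m = (LEAST m. 1 \<le> emb t x * (t\<^sup>2) ^ m)"
    have m: "1 \<le> emb t x * (t\<^sup>2) ^ m" unfolding m_def using ex by (rule LeastI_ex)
    then obtain n where n: "m = Suc n" using False by (cases m) simp_all
    have n': "emb t x * (t\<^sup>2) ^ n < 1"
      using not_less_Least[of n "\<lambda>m. 1 \<le> emb t x * (t\<^sup>2) ^ m"] n m_def by auto
    define y where "y = x * (\<theta> ^ m)\<^sup>2"
    have "x = x * (\<theta> ^ m * \<theta>inv ^ m)\<^sup>2" by (simp add: power_mult_distrib[symmetric] \<theta>_inv)
    then have xy: "x = y * (\<theta>inv ^ m)\<^sup>2" by (simp add: y_def power_mult_distrib ac_simps)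
    have y: "emb t y = emb t x * (t\<^sup>2) ^ m"
      by (simp add: y_def emb_mult[OF t(1)] emb_power[OF t(1)] emb_\<theta> mult.commute flip: power_mult)
    have "emb t y = t\<^sup>2 * (emb t x * (t\<^sup>2) ^ n)" unfolding y n by simp
    also have "\<dots> < t\<^sup>2 * 1" using n' by (rule mult_strict_left_mono) (use t1 in linarith)
    finally have "emb t y < t\<^sup>2" by simp
    moreover have "1 \<le> emb t y" using m y by simp
    moreover have "cub_norm y = 1" using x by (simp add: y_def)
    ultimately obtain \<delta> where "y = \<delta>\<^sup>2 \<or> y = \<theta> * \<delta>\<^sup>2" using small_unit t by blast
    then have "x = (\<delta> * \<theta>inv ^ m)\<^sup>2 \<or> x = \<theta> * (\<delta> * \<theta>inv ^ m)\<^sup>2"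
      unfolding xy by (auto simp: power_mult_distrib mult.assoc)
    then show ?thesis by blast
  qed
qed

section \<open>Descent on the second curve\<close>

text \<open>The hypotheses on \<open>d\<close> make \<open>\<xi>\<close>, its cofactor and \<open>c\<close> generate the unit ideal, so that the square
  of the ideal \<open>(\<xi>, c)\<close> is \<open>(\<xi>)\<close>.\<close>

lemma square_norm_imp_square:
  assumes norm: "cub_norm \<xi> = c\<^sup>2" and c: "c \<noteq> 0" and cop: "coprime d c" and d: "cub_adj \<xi> - of_int d = \<xi> * \<kappa>"
  shows "\<exists>\<delta>. \<xi> = \<delta>\<^sup>2 \<or> \<xi> = \<theta> * \<delta>\<^sup>2"
proof -
  obtain \<gamma> s t \<sigma> \<tau> where g: "\<gamma> = s * \<xi> + t * of_int c" and x: "\<xi> = \<gamma> * \<sigma>" and ct: "of_int c = \<gamma> * \<tau>"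
    by (rule cub_bezout)
  have c2: "\<xi> * cub_adj \<xi> = of_int c * of_int c"
    by (simp add: cub_mult_adj norm power2_eq_square)
  obtain u v where uv: "u * d + v * c = 1" using cop
    by (metis bezout_int coprime_imp_gcd_eq_1)
  have "\<gamma>\<^sup>2 = \<xi> * (s * s * \<xi> + 2 * (s * t * of_int c)) + t * t * (of_int c * of_int c)"
    unfolding g by (simp add: power2_eq_square algebra_simps)
  \<comment> \<open>\<open>c^2\<close> is the norm of \<xi>, hence a multiple of \<xi>, and so \<xi>
    divides \<open>\<gamma>^2\<close>.\<close>
  then have A: "\<gamma>\<^sup>2 = \<xi> * (s * s * \<xi> + 2 * (s * t * of_int c) + t * t * cub_adj \<xi>)" (is "_ = _ * ?A")
    unfolding c2[symmetric] by (simp add: algebra_simps)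
  \<comment> \<open>\<open>cub_adj \<xi> - \<xi> * \<kappa>\<close> is the integer \<open>d\<close>,
    coprime to \<open>c\<close>. Multiplied by \<xi>, every term of this relation becomes a multiple
    of \<open>\<gamma>^2\<close>, the converse divisibility.\<close>
  have "of_int u * (cub_adj \<xi> - \<xi> * \<kappa>) + of_int v * of_int c = (1 :: cub)"
    using d uv by (metis (no_types, lifting) diff_diff_eq2 add_diff_cancel_left' of_int_1 of_int_add of_int_mult)
  then have "\<xi> = \<xi> * (of_int u * (cub_adj \<xi> - \<xi> * \<kappa>) + of_int v * of_int c)" by simp
  also have "\<dots> = of_int u * (\<xi> * cub_adj \<xi>) - of_int u * (\<xi> * \<xi> * \<kappa>) + of_int v * (\<xi> * of_int c)"
    by (simp add: algebra_simps)
  also have "\<dots> = of_int u * (\<gamma> * \<tau> * (\<gamma> * \<tau>)) - of_int u * (\<gamma> * \<sigma> * (\<gamma> * \<sigma>) * \<kappa>) + of_int v * (\<gamma> * \<sigma> * (\<gamma> * \<tau>))"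
    unfolding c2 ct by (simp only: x[symmetric])
  also have "\<dots> = \<gamma>\<^sup>2 * (of_int u * (\<tau> * \<tau>) - of_int u * (\<sigma> * \<sigma> * \<kappa>) + of_int v * (\<sigma> * \<tau>))" (is "_ = _ * ?B")
    by (simp add: power2_eq_square algebra_simps)
  finally have B: "\<xi> = \<gamma>\<^sup>2 * ?B" .
  obtain P Q where A: "\<gamma>\<^sup>2 = \<xi> * P" and B: "\<xi> = \<gamma>\<^sup>2 * Q" using A B by blast
  have nB: "c\<^sup>2 = (cub_norm \<gamma>)\<^sup>2 * cub_norm Q" using arg_cong[OF B, of cub_norm] norm by simp
  have nA: "(cub_norm \<gamma>)\<^sup>2 = c\<^sup>2 * cub_norm P" using arg_cong[OF A, of cub_norm] norm by simp
  have "c\<^sup>2 * (cub_norm P * cub_norm Q) = c\<^sup>2 * 1" using nA nB by (metis mult.assoc mult_1_right)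
  then have "cub_norm P * cub_norm Q = 1" using c by (simp only: mult_cancel_left) simp
  \<comment> \<open>Both norms being squares, the unit has norm 1 and not -1, which removes the
    units \<open>-\<theta>^n\<close>.\<close>
  moreover have "0 < cub_norm Q"
  proof -
    have "0 < c\<^sup>2" "0 \<le> (cub_norm \<gamma>)\<^sup>2" using c by simp_all
    then show ?thesis using nB by (metis not_less mult_nonneg_nonpos)
  qed
  ultimately have "cub_norm Q = 1" by (metis mult.commute pos_zmult_eq_1_iff)
  then obtain \<delta> where "Q = \<delta>\<^sup>2 \<or> Q = \<theta> * \<delta>\<^sup>2" using unit_mod_squares by blast
  then have "\<xi> = (\<gamma> * \<delta>)\<^sup>2 \<or> \<xi> = \<theta> * (\<gamma> * \<delta>)\<^sup>2"
    using B by (auto simp: power_mult_distrib ac_simps)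
  then show ?thesis by blast
qed

text \<open>\<open>3x^2 - 4y^2\<close> is the derivative in \<open>x\<close> of the cubic form,
  whose discriminant is -16 times 11. As \<open>c\<close> is odd, a common prime can only be 11,
  with \<open>3/2\<close> a double root modulo 11; there 8 times the form is \<open>11y^3\<close>
  modulo 121, although 121 divides \<open>c^2\<close>.\<close>

lemma coprime_cofactor_odd:
  fixes x y c :: int
  assumes "coprime x y" "odd x" "c\<^sup>2 = x ^ 3 - 4 * x * y\<^sup>2 + 4 * y ^ 3"
  shows "coprime (3 * x\<^sup>2 - 4 * y\<^sup>2) c"
proof (rule coprimeI_prime_int)
  fix l :: int assume l: "prime l" "l dvd 3 * x\<^sup>2 - 4 * y\<^sup>2" "l dvd c"
  have no: "\<not> (l dvd x \<and> l dvd y)" using assms(1) l(1) by (meson coprime_common_divisor not_prime_unit)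
  have "odd (c\<^sup>2)" unfolding assms(3) using assms(2) by simp
  then have "odd c" by simp
  have l2: "\<not> l dvd 2"
  proof
    assume "l dvd 2"
    then have "l = 2" using l(1) by (simp add: primes_dvd_imp_eq)
    then show False using l(3) \<open>odd c\<close> by simp
  qed
  have c2: "l\<^sup>2 dvd c\<^sup>2" using l(3) by (rule dvd_power_same)
  then have lF: "l dvd c\<^sup>2" using l(3) by (simp add: power2_eq_square)
  have "x * (3 * x\<^sup>2 - 4 * y\<^sup>2) - 3 * c\<^sup>2 = 4 * y\<^sup>2 * (2 * x - 3 * y)"
    unfolding assms(3) by (simp add: power2_eq_square power3_eq_cube algebra_simps)
  then have "l dvd 4 * y\<^sup>2 * (2 * x - 3 * y)" using l(2) lF by (metis dvd_diff dvd_mult)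
  moreover have "\<not> l dvd 2 * 2" using l2 l(1) by (simp only: prime_dvd_mult_iff) simp
  then have "\<not> l dvd 4" by simp
  moreover have ny: "\<not> l dvd y"
  proof
    assume y: "l dvd y"
    have "x ^ 3 = c\<^sup>2 + (4 * x * y * y - 4 * y\<^sup>2 * y)"
      unfolding assms(3) by (simp add: power2_eq_square power3_eq_cube algebra_simps)
    then have "l dvd x ^ 3" using y lF by (metis dvd_add dvd_diff dvd_mult)
    then show False using no y l(1) prime_dvd_power by blast
  qed
  ultimately have "l dvd 2 * x - 3 * y" using l(1) by (metis prime_dvd_mult_iff prime_dvd_power)
  then obtain k where k: "2 * x = 3 * y + l * k" by (metis dvdE add.commute diff_add_cancel)
  have "4 * (3 * x\<^sup>2 - 4 * y\<^sup>2) = 3 * (2 * x)\<^sup>2 - 16 * y\<^sup>2" by (simp add: power2_eq_square)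
  also have "\<dots> = 11 * y\<^sup>2 + l * (18 * y * k + 3 * l * k\<^sup>2)"
    unfolding k by (simp add: power2_eq_square algebra_simps)
  finally have "11 * y\<^sup>2 = 4 * (3 * x\<^sup>2 - 4 * y\<^sup>2) - l * (18 * y * k + 3 * l * k\<^sup>2)" by simp
  then have "l dvd 11 * y\<^sup>2" using l(2) by (metis dvd_diff dvd_mult dvd_triv_left)
  then have "l dvd 11" using ny l(1) by (metis prime_dvd_mult_iff prime_dvd_power)
  then have l11: "l = 11" using l(1) by (simp add: primes_dvd_imp_eq)
  have "8 * c\<^sup>2 = (2 * x) ^ 3 - 16 * (2 * x) * y\<^sup>2 + 32 * y ^ 3"
    unfolding assms(3) by (simp add: power2_eq_square power3_eq_cube algebra_simps)
  also have "\<dots> = 11 * y ^ 3 + 121 * (k * y\<^sup>2 + 9 * k\<^sup>2 * y + 11 * k ^ 3)"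
    unfolding k l11 by (simp add: power2_eq_square power3_eq_cube algebra_simps)
  finally have *: "11 * y ^ 3 = 8 * c\<^sup>2 - 121 * (k * y\<^sup>2 + 9 * k\<^sup>2 * y + 11 * k ^ 3)" by simp
  have "121 dvd c\<^sup>2" using c2 l11 by simp
  then have "121 dvd 11 * y ^ 3" unfolding * by simp
  then have "11 * 11 dvd 11 * y ^ 3" by simp
  then have "11 dvd y ^ 3" by (simp only: dvd_mult_cancel_left) simp
  then show False using ny l(1) l11 prime_dvd_power by blast
qed

text \<open>The same argument for a form of discriminant -44, with the double root
  \<open>4/3\<close> modulo 11.\<close>

lemma coprime_cofactor_even:
  fixes x y c :: int
  assumes "coprime x y" "odd x" "c\<^sup>2 = x ^ 3 - 2 * x\<^sup>2 * y + 2 * y ^ 3"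
  shows "coprime (3 * x\<^sup>2 - 4 * x * y) c"
proof (rule coprimeI_prime_int)
  fix l :: int assume l: "prime l" "l dvd 3 * x\<^sup>2 - 4 * x * y" "l dvd c"
  have no: "\<not> (l dvd x \<and> l dvd y)" using assms(1) l(1) by (meson coprime_common_divisor not_prime_unit)
  have "odd (c\<^sup>2)" unfolding assms(3) using assms(2) by simp
  then have "odd c" by simp
  have l2: "\<not> l dvd 2"
  proof
    assume "l dvd 2"
    then have "l = 2" using l(1) by (simp add: primes_dvd_imp_eq)
    then show False using l(3) \<open>odd c\<close> by simp
  qed
  have c2: "l\<^sup>2 dvd c\<^sup>2" using l(3) by (rule dvd_power_same)
  then have lF: "l dvd c\<^sup>2" using l(3) by (simp add: power2_eq_square)
  have ny: "\<not> l dvd y"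
  proof
    assume y: "l dvd y"
    have "x ^ 3 = c\<^sup>2 + (2 * x\<^sup>2 * y - 2 * y\<^sup>2 * y)"
      unfolding assms(3) by (simp add: power2_eq_square power3_eq_cube algebra_simps)
    then have "l dvd x ^ 3" using y lF by (metis dvd_add dvd_diff dvd_mult)
    then show False using no y l(1) prime_dvd_power by blast
  qed
  have nx: "\<not> l dvd x"
  proof
    assume x: "l dvd x"
    have "2 * y ^ 3 = c\<^sup>2 + (2 * x * y * x - x\<^sup>2 * x)"
      unfolding assms(3) by (simp add: power2_eq_square power3_eq_cube algebra_simps)
    then have "l dvd 2 * y ^ 3" using x lF by (metis dvd_add dvd_diff dvd_mult)
    then show False using ny l2 l(1) by (metis prime_dvd_mult_iff prime_dvd_power)
  qed
  have "3 * x\<^sup>2 - 4 * x * y = x * (3 * x - 4 * y)" by (simp add: power2_eq_square algebra_simps)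
  then have "l dvd 3 * x - 4 * y" using l nx by (metis prime_dvd_mult_iff)
  then obtain k where k: "3 * x = 4 * y + l * k" by (metis dvdE add.commute diff_add_cancel)
  have "27 * c\<^sup>2 = (3 * x) ^ 3 - 6 * (3 * x)\<^sup>2 * y + 54 * y ^ 3"
    unfolding assms(3) by (simp add: power2_eq_square power3_eq_cube algebra_simps)
  also have "\<dots> = 22 * y ^ 3 + l\<^sup>2 * (6 * k\<^sup>2 * y + l * k ^ 3)"
    unfolding k by (simp add: power2_eq_square power3_eq_cube algebra_simps)
  finally have *: "22 * y ^ 3 = 27 * c\<^sup>2 - l\<^sup>2 * (6 * k\<^sup>2 * y + l * k ^ 3)" by simp
  have sq: "l\<^sup>2 dvd 22 * y ^ 3" unfolding * using c2 by simp
  moreover have "l dvd l\<^sup>2" by (simp add: power2_eq_square)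
  ultimately have "l dvd 22 * y ^ 3" by (rule dvd_trans[rotated])
  then have "l dvd 2 * 11 * y ^ 3" by simp
  then have "l dvd 11" using ny l2 l(1) by (metis prime_dvd_mult_iff prime_dvd_power)
  then have l11: "l = 11" using l(1) by (simp add: primes_dvd_imp_eq)
  then have "11 * 11 dvd 11 * (2 * y ^ 3)" using sq by simp
  then have "11 dvd 2 * y ^ 3" by (simp only: dvd_mult_cancel_left) simp
  then show False using ny l(1) l11 l2 by (metis prime_dvd_mult_iff prime_dvd_power)
qed

lemma cub_square: "(Cub a b c)\<^sup>2 = Cub (a\<^sup>2 + 2 * (b * c) + c\<^sup>2) (2 * (a * b + b * c + c\<^sup>2)) (b\<^sup>2 + 2 * (a * c + b * c + c\<^sup>2))"
  by (simp add: power2_eq_square[of "Cub _ _ _"] cub_simps) (simp add: power2_eq_square algebra_simps)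

text \<open>With \<open>\<eta> = \<theta>\<^sup>2 - 1\<close>, so that \<open>-1/\<eta>\<close> is a root of \<open>4u\<^sup>3 - 4u\<^sup>2 + 1\<close>, the conclusion says that
  \<open>u + 1/\<eta> = (\<beta>/2e)\<^sup>2\<close> for \<open>u = A/e\<^sup>2\<close>.\<close>

lemma two_descent:
  fixes A e V :: int
  assumes "coprime A e" "V\<^sup>2 = 4 * A ^ 3 - 4 * A\<^sup>2 * e\<^sup>2 + e ^ 6"
  obtains \<beta> where "\<beta>\<^sup>2 = Cub (4 * A - 2 * e\<^sup>2) (2 * e\<^sup>2) 0"
proof (cases "even e")
  case False
  \<comment> \<open>This is \<open>e^2 + A\<eta>\<close>, or
    \<open>e^2 \<eta> (u + 1/\<eta>)\<close>. As \<open>1/\<eta> = (\<theta> - 1)/2\<close>, the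
    factor \<eta> restores integrality for odd \<open>e\<close>.\<close>
  define \<xi> where "\<xi> = Cub (e\<^sup>2 - A) 0 A"
  have e6: "e ^ 6 = (e\<^sup>2) ^ 3" by (simp flip: power_mult)
  have norm: "cub_norm \<xi> = V\<^sup>2"
    unfolding assms(2) e6 by (simp add: \<xi>_def cub_norm_def norm_form_def power2_eq_square power3_eq_cube algebra_simps)
  have "\<xi> \<noteq> 0" using False by (auto simp: \<xi>_def cub_simps)
  then have "V \<noteq> 0" using norm cub_norm_eq_0_iff by force
  have "coprime (e\<^sup>2) A" "odd (e\<^sup>2)" using assms(1) False by (simp_all add: coprime_commute)
  moreover have "V\<^sup>2 = (e\<^sup>2) ^ 3 - 4 * e\<^sup>2 * A\<^sup>2 + 4 * A ^ 3"
    unfolding assms(2) e6 by simp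
  ultimately have "coprime (3 * (e\<^sup>2)\<^sup>2 - 4 * A\<^sup>2) V" by (rule coprime_cofactor_odd)
  moreover have "cub_adj \<xi> - of_int (3 * (e\<^sup>2)\<^sup>2 - 4 * A\<^sup>2) = \<xi> * Cub (- A - 2 * e\<^sup>2) 0 A"
    by (simp add: \<xi>_def cub_adj_def of_int_cub cub_simps power2_eq_square algebra_simps)
  ultimately obtain \<delta> where \<delta>: "\<xi> = \<delta>\<^sup>2 \<or> \<xi> = \<theta> * \<delta>\<^sup>2"
    using square_norm_imp_square[OF norm \<open>V \<noteq> 0\<close>] by blast
  obtain a b c where abc: "\<delta> = Cub a b c" by (cases \<delta>)
  \<comment> \<open>By \<open>cub_square\<close> the \<theta> coordinate of a square is even, which
    would make \<open>e^2\<close> even here.\<close>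
  have "\<xi> \<noteq> \<theta> * \<delta>\<^sup>2"
  proof
    assume "\<xi> = \<theta> * \<delta>\<^sup>2"
    then have "e\<^sup>2 = 2 * (b\<^sup>2 + 2 * (a * c + b * c + c\<^sup>2) + (a * b + b * c + c\<^sup>2))"
      unfolding \<xi>_def \<theta>_def abc cub_square by (simp add: cub_simps)
    then have "even (e\<^sup>2)" by presburger
    then show False using False by simp
  qed
  with \<delta> have *: "Cub (e\<^sup>2 - A) 0 A = \<delta>\<^sup>2" by (simp add: \<xi>_def)
  \<comment> \<open>The multiplier is a square root of
    \<open>4/\<eta> = 2\<theta> - 2\<close>.\<close>
  have "(\<delta> * Cub 1 2 (- 1))\<^sup>2 = Cub (e\<^sup>2 - A) 0 A * (Cub 1 2 (- 1))\<^sup>2" unfolding * by (rule power_mult_distrib)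
  also have "\<dots> = Cub (4 * A - 2 * e\<^sup>2) (2 * e\<^sup>2) 0" by (simp add: cub_square cub_simps)
  finally show thesis by (rule that)
next
  case True
  then obtain f where f: "e = 2 * f" ..
  have "odd A" using assms(1) True by (metis coprime_common_divisor odd_one)
  \<comment> \<open>\<open>e^2 (u + 1/\<eta>)\<close> itself, which is integral for even
    \<open>e\<close>.\<close>
  define \<xi> where "\<xi> = Cub (A - 2 * f\<^sup>2) (2 * f\<^sup>2) 0"
  have "even (V\<^sup>2)" unfolding assms(2) f by simp
  then obtain W where W: "V = 2 * W" by (auto elim: evenE)
  have "4 * W\<^sup>2 = 4 * (A ^ 3 - 4 * A\<^sup>2 * f\<^sup>2 + 16 * f ^ 6)"
    using assms(2) unfolding W f by (simp add: power_mult_distrib)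
  then have W2: "W\<^sup>2 = A ^ 3 - 2 * A\<^sup>2 * (2 * f\<^sup>2) + 2 * (2 * f\<^sup>2) ^ 3"
    by (simp add: power_mult_distrib flip: power_mult)
  have norm: "cub_norm \<xi> = W\<^sup>2"
    unfolding W2 by (simp add: \<xi>_def cub_norm_def norm_form_def power2_eq_square power3_eq_cube algebra_simps)
  have "odd (W\<^sup>2)" unfolding W2 using \<open>odd A\<close> by simp
  then have "W \<noteq> 0" by auto
  have "coprime (3 * A\<^sup>2 - 4 * A * (2 * f\<^sup>2)) W"
    by (rule coprime_cofactor_even[OF _ \<open>odd A\<close> W2]) (use assms \<open>odd A\<close> f in simp)
  moreover have "cub_adj \<xi> - of_int (3 * A\<^sup>2 - 4 * A * (2 * f\<^sup>2)) = \<xi> * Cub (2 * f\<^sup>2 - 2 * A) (2 * f\<^sup>2) 0"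
    by (simp add: \<xi>_def cub_adj_def of_int_cub cub_simps power2_eq_square algebra_simps)
  ultimately obtain \<delta> where \<delta>: "\<xi> = \<delta>\<^sup>2 \<or> \<xi> = \<theta> * \<delta>\<^sup>2"
    using square_norm_imp_square[OF norm \<open>W \<noteq> 0\<close>] by blast
  obtain a b c where abc: "\<delta> = Cub a b c" by (cases \<delta>)
  \<comment> \<open>Again the even \<theta> coordinate of a square; here it would make
    \<open>A\<close> even.\<close>
  have "\<xi> \<noteq> \<theta> * \<delta>\<^sup>2"
  proof
    assume "\<xi> = \<theta> * \<delta>\<^sup>2"
    then have "A = 2 * f\<^sup>2 + (b\<^sup>2 + 2 * (a * c + b * c + c\<^sup>2))"
       "2 * (a * b + b * c + c\<^sup>2) + (b\<^sup>2 + 2 * (a * c + b * c + c\<^sup>2)) = 0"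
      unfolding \<xi>_def \<theta>_def abc cub_square by (simp_all add: cub_simps)
    then have "A = 2 * (f\<^sup>2 - (a * b + b * c + c\<^sup>2))" by simp
    then have "even A" by simp
    then show False using \<open>odd A\<close> by simp
  qed
  with \<delta> have *: "\<delta>\<^sup>2 = Cub (A - 2 * f\<^sup>2) (2 * f\<^sup>2) 0" by (simp add: \<xi>_def)
  have "(of_int 2 * \<delta>)\<^sup>2 = Cub (4 * A - 2 * e\<^sup>2) (2 * e\<^sup>2) 0"
    unfolding power_mult_distrib * by (simp add: of_int_cub cub_square cub_simps f power2_eq_square)
  then show thesis by (rule that)
qed

section \<open>Halving rational points\<close>

text \<open>The conjugates of \<theta> have sum 1, and their squares have sum 3.\<close>

definition cub_trace :: "cub \<Rightarrow> int" where
  "cub_trace x = 3 * co0 x + co1 x + 3 * co2 x"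

text \<open>The conjugates of \<open>cub_adj x\<close> are the products of two conjugates of
  \<open>x\<close>, so its trace is their second elementary symmetric function.\<close>

lemma cub_trace_square: "cub_trace (x\<^sup>2) = (cub_trace x)\<^sup>2 - 2 * cub_trace (cub_adj x)"
  by (cases x) (simp add: cub_trace_def cub_adj_def cub_square, simp add: power2_eq_square algebra_simps)

lemma cub_adj_adj: "cub_adj (cub_adj x) = of_int (cub_norm x) * x"
  by (cases x)
     (simp add: cub_norm_def norm_form_def cub_adj_def of_int_cub cub_simps power2_eq_square
        power3_eq_cube algebra_simps)

lemma cub_trace_of_int_mult: "cub_trace (of_int k * x) = k * cub_trace x"
  by (simp add: cub_trace_def of_int_cub cub_simps algebra_simps)

text \<open>Here \<open>s1\<close>, \<open>s2\<close>, \<open>s3\<close> are the elementary symmetric functions of square roots of \<open>u - \<rho>\<close> for the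
  three roots \<open>\<rho>\<close> of \<open>4u\<^sup>3 - 4u\<^sup>2 + 1\<close>; the second equation says that \<open>(w, v)\<close> doubles to a point
  with abscissa \<open>u\<close>.\<close>

lemma halving_identity:
  fixes u s1 s2 s3 :: "'a::field_char_0"
  assumes 1: "s1\<^sup>2 - 2 * s2 = 3 * u - 1" and 2: "s2\<^sup>2 - 2 * s1 * s3 = 3 * u\<^sup>2 - 2 * u"
    and 3: "4 * s3\<^sup>2 = 4 * u ^ 3 - 4 * u\<^sup>2 + 1"
  defines "w \<equiv> u + s2" and "v \<equiv> 2 * (s1 * s2 - s3)"
  shows "v\<^sup>2 = 4 * w ^ 3 - 4 * w\<^sup>2 + 1" "u * v\<^sup>2 = w ^ 4 - 2 * w + 1"
proof -
  have s1: "s1\<^sup>2 = 3 * u - 1 + 2 * s2" using 1 by (simp add: algebra_simps)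
  have s13: "2 * (s1 * s3) = s2\<^sup>2 - 3 * u\<^sup>2 + 2 * u" using 2 by (simp add: algebra_simps)
  have "v\<^sup>2 = 4 * (s1\<^sup>2 * s2\<^sup>2) - 4 * (s2 * (2 * (s1 * s3))) + 4 * s3\<^sup>2"
    unfolding v_def by (simp add: power2_eq_square algebra_simps)
  also have "\<dots> = 4 * w ^ 3 - 4 * w\<^sup>2 + 1"
    unfolding s1 s13 3 w_def by (simp add: power2_eq_square power3_eq_cube algebra_simps)
  finally show v: "v\<^sup>2 = 4 * w ^ 3 - 4 * w\<^sup>2 + 1" .
  have "(2 * (s1 * s3))\<^sup>2 = s1\<^sup>2 * (4 * s3\<^sup>2)" by (simp add: power_mult_distrib)
  then have "(s2\<^sup>2 - 3 * u\<^sup>2 + 2 * u)\<^sup>2 = (3 * u - 1 + 2 * s2) * (4 * u ^ 3 - 4 * u\<^sup>2 + 1)"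
    unfolding s1 s13 3 .
  moreover have "w ^ 4 - 2 * w + 1 - u * (4 * w ^ 3 - 4 * w\<^sup>2 + 1)
      = (s2\<^sup>2 - 3 * u\<^sup>2 + 2 * u)\<^sup>2 - (3 * u - 1 + 2 * s2) * (4 * u ^ 3 - 4 * u\<^sup>2 + 1)"
    unfolding w_def by (simp add: power2_eq_square power3_eq_cube power4_eq_xxxx algebra_simps)
  ultimately show "u * v\<^sup>2 = w ^ 4 - 2 * w + 1" unfolding v by simp
qed

lemma square_int_rat:
  fixes r :: rat
  assumes "r\<^sup>2 = of_int k"
  obtains l where "r = of_int l"
proof -
  obtain a b where ab: "r = of_int a / of_int b" "b > 0" "coprime a b"
    by (metis Fract_of_int_quotient Rat_cases)
  then have "of_int a = r * of_int b" by simp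
  then have "(of_int (a\<^sup>2) :: rat) = of_int (k * b\<^sup>2)"
    using assms by (simp add: power_mult_distrib)
  then have "a\<^sup>2 = k * b\<^sup>2" by (simp only: of_int_eq_iff)
  then have "b\<^sup>2 dvd a\<^sup>2" by simp
  then have "b dvd a" by simp
  then have "b = 1" using ab by (metis coprime_absorb_right coprime_commute is_unit_normalize normalize_int_def abs_of_pos)
  then show thesis using that ab by simp
qed

text \<open>The denominator \<open>n\<close> of \<open>u\<close> and the form \<open>F\<close> have
  a square product, and \<open>n\<close> is coprime to \<open>F\<close> if odd and to
  \<open>F / 4\<close> if even; hence \<open>n\<close> is a square.\<close>

lemma E2_coords:
  fixes u v :: rat
  assumes "v\<^sup>2 = 4 * u ^ 3 - 4 * u\<^sup>2 + 1"
  obtains A e V :: int where "u = of_int A / of_int e ^ 2" "0 < e" "coprime A e"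
    "V\<^sup>2 = 4 * A ^ 3 - 4 * A\<^sup>2 * e\<^sup>2 + e ^ 6"
proof -
  obtain m n where mn: "u = of_int m / of_int n" "n > 0" "coprime m n"
    by (metis Fract_of_int_quotient Rat_cases)
  define F where "F = 4 * m ^ 3 - 4 * m\<^sup>2 * n + n ^ 3"
  have "(v * of_int n ^ 2)\<^sup>2 = of_int (n * F)"
    using mn(2) unfolding power_mult_distrib assms mn(1) F_def
    by (simp add: field_simps power2_eq_square power3_eq_cube)
  then obtain W where W: "v * of_int n ^ 2 = of_int W" by (rule square_int_rat)
  then have "(of_int (W\<^sup>2) :: rat) = of_int (n * F)" using \<open>(v * of_int n ^ 2)\<^sup>2 = of_int (n * F)\<close> by simp
  then have W2: "W\<^sup>2 = n * F" by (simp only: of_int_eq_iff)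
  have no: "\<not> (l dvd m \<and> l dvd n)" if "prime l" for l
    using mn(3) that by (meson coprime_common_divisor not_prime_unit)
  obtain e where e: "n = e\<^sup>2"
  proof (cases "even n")
    case False
    have "coprime n F"
    proof (rule coprimeI_prime_int)
      fix l :: int assume l: "prime l" "l dvd n" "l dvd F"
      have "2 * 2 * m ^ 3 = F + n * (4 * m\<^sup>2 - n\<^sup>2)"
        unfolding F_def by (simp add: power2_eq_square power3_eq_cube algebra_simps)
      then have "l dvd 2 * 2 * m ^ 3" using l by simp
      moreover have "\<not> l dvd 2"
      proof
        assume "l dvd 2"
        then have "l = 2" using l(1) by (simp add: primes_dvd_imp_eq)
        then show False using l(2) False by simp
      qed
      ultimately have "l dvd m" using l(1) by (metis prime_dvd_mult_iff prime_dvd_power)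
      then show False using no l by blast
    qed
    then show thesis using coprime_mult_square_nonneg[of n F W] W2 mn(2) that by auto
  next
    case True
    then obtain k where k: "n = 2 * k" ..
    define C where "C = m ^ 3 - 2 * m\<^sup>2 * k + 2 * k ^ 3"
    have FC: "F = 4 * C" unfolding F_def C_def k by (simp add: power2_eq_square power3_eq_cube algebra_simps)
    have "even (W\<^sup>2)" unfolding W2 k by simp
    then obtain W' where W': "W = 2 * W'" by (auto elim: evenE)
    have eq: "n * C = W'\<^sup>2" using W2 unfolding FC W' by (simp add: power_mult_distrib)
    have "coprime n C"
    proof (rule coprimeI_prime_int)
      fix l :: int assume l: "prime l" "l dvd n" "l dvd C"
      have "m ^ 3 = C + n * (m\<^sup>2 - k\<^sup>2)"
        unfolding C_def k by (simp add: power2_eq_square power3_eq_cube algebra_simps)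
      then have "l dvd m ^ 3" using l by simp
      then show False using no l prime_dvd_power by blast
    qed
    then show thesis using coprime_mult_square_nonneg[of n C W'] eq mn(2) that by auto
  qed
  have "e \<noteq> 0" using e mn by auto
  have "e\<^sup>2 dvd W\<^sup>2" unfolding W2 e by simp
  then have "e dvd W" by simp
  then obtain V where "W = e * V" ..
  then have V: "V\<^sup>2 = F" using W2 \<open>e \<noteq> 0\<close> unfolding e by (simp add: power_mult_distrib)
  show thesis
  proof (rule that[of m "\<bar>e\<bar>" V])
    show "u = of_int m / of_int \<bar>e\<bar> ^ 2" using mn e by simp
    show "0 < \<bar>e\<bar>" using \<open>e \<noteq> 0\<close> by simp
    show "coprime m \<bar>e\<bar>" using mn e by simp
    have "\<bar>e\<bar> ^ 6 = (e\<^sup>2) ^ 3" by (simp flip: power_mult)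
    then show "V\<^sup>2 = 4 * m ^ 3 - 4 * m\<^sup>2 * \<bar>e\<bar>\<^sup>2 + \<bar>e\<bar> ^ 6" using V e F_def by simp
  qed
qed

text \<open>\<open>\<beta> / 2e\<close> is a square root of \<open>u - \<rho>\<close> inside the
  cubic field, so the symmetric functions \<open>s1\<close>, \<open>s2\<close>, \<open>s3\<close> of
  \<open>halving_identity\<close> are rational: they are \<open>T1 / 2e\<close>,
  \<open>T2 / 4e^2\<close> and \<open>T3 / 8e^3\<close>.\<close>

lemma E2_halving:
  fixes u v :: rat
  assumes "v\<^sup>2 = 4 * u ^ 3 - 4 * u\<^sup>2 + 1"
  obtains w v' where "v'\<^sup>2 = 4 * w ^ 3 - 4 * w\<^sup>2 + 1" "u * v'\<^sup>2 = w ^ 4 - 2 * w + 1"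
proof -
  obtain A e V :: int where u: "u = of_int A / of_int e ^ 2" and e: "0 < e" "coprime A e"
    "V\<^sup>2 = 4 * A ^ 3 - 4 * A\<^sup>2 * e\<^sup>2 + e ^ 6" using E2_coords[OF assms] .
  obtain \<beta> where b: "\<beta>\<^sup>2 = Cub (4 * A - 2 * e\<^sup>2) (2 * e\<^sup>2) 0" using two_descent[OF e(2,3)] .
  define T1 T2 T3 where "T1 = cub_trace \<beta>" and "T2 = cub_trace (cub_adj \<beta>)" and "T3 = cub_norm \<beta>"
  have 1: "T1\<^sup>2 - 2 * T2 = 12 * A - 4 * e\<^sup>2"
    using cub_trace_square[of \<beta>] unfolding b T1_def T2_def by (simp add: cub_trace_def)
  have "T2\<^sup>2 - 2 * (T3 * T1) = cub_trace ((cub_adj \<beta>)\<^sup>2)"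
    unfolding cub_trace_square cub_adj_adj cub_trace_of_int_mult T1_def T2_def T3_def by simp
  also have "(cub_adj \<beta>)\<^sup>2 = cub_adj (\<beta>\<^sup>2)" by (simp add: power2_eq_square cub_adj_mult)
  also have "cub_trace \<dots> = 48 * A\<^sup>2 - 32 * A * e\<^sup>2"
    unfolding b by (simp add: cub_trace_def cub_adj_def power2_eq_square algebra_simps)
  finally have 2: "T2\<^sup>2 - 2 * (T3 * T1) = 48 * A\<^sup>2 - 32 * A * e\<^sup>2" .
  have "T3\<^sup>2 = cub_norm (\<beta>\<^sup>2)" by (simp add: T3_def)
  also have "\<dots> = 16 * (4 * A ^ 3 - 4 * A\<^sup>2 * e\<^sup>2 + (e\<^sup>2) ^ 3)"
    unfolding b by (simp add: cub_norm_def norm_form_def power2_eq_square power3_eq_cube algebra_simps)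
  finally have 3: "T3\<^sup>2 = 16 * (4 * A ^ 3 - 4 * A\<^sup>2 * e\<^sup>2 + (e\<^sup>2) ^ 3)" .
  define a E t1 t2 t3 :: rat where "a = of_int A" and "E = of_int e" and "t1 = of_int T1" and "t2 = of_int T2"
    and "t3 = of_int T3"
  have r: "t1\<^sup>2 - 2 * t2 = 12 * a - 4 * E\<^sup>2" "t2\<^sup>2 - 2 * (t3 * t1) = 48 * a\<^sup>2 - 32 * a * E\<^sup>2"
    "t3\<^sup>2 = 16 * (4 * a ^ 3 - 4 * a\<^sup>2 * E\<^sup>2 + (E\<^sup>2) ^ 3)"
    using arg_cong[OF 1, of "of_int :: int \<Rightarrow> rat"] arg_cong[OF 2, of "of_int :: int \<Rightarrow> rat"]
      arg_cong[OF 3, of "of_int :: int \<Rightarrow> rat"]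
    by (simp_all add: a_def E_def t1_def t2_def t3_def)
  have E: "E \<noteq> 0" and u: "u = a / E\<^sup>2" using e u by (simp_all add: E_def a_def)
  have "(t1 / (2 * E))\<^sup>2 - 2 * (t2 / (4 * E\<^sup>2)) = (t1\<^sup>2 - 2 * t2) / (4 * E\<^sup>2)"
    by (simp add: power_divide power_mult_distrib diff_divide_distrib)
  also have "\<dots> = 3 * u - 1" unfolding r u using E by (simp add: field_simps)
  finally have i: "(t1 / (2 * E))\<^sup>2 - 2 * (t2 / (4 * E\<^sup>2)) = 3 * u - 1" .
  have "(t2 / (4 * E\<^sup>2))\<^sup>2 - 2 * (t1 / (2 * E)) * (t3 / (8 * E ^ 3)) = (t2\<^sup>2 - 2 * (t3 * t1)) / (16 * E ^ 4)"
    using E by (simp add: field_simps power2_eq_square power3_eq_cube power4_eq_xxxx)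
  also have "\<dots> = 3 * u\<^sup>2 - 2 * u" unfolding r u using E by (simp add: field_simps power2_eq_square power4_eq_xxxx)
  finally have ii: "(t2 / (4 * E\<^sup>2))\<^sup>2 - 2 * (t1 / (2 * E)) * (t3 / (8 * E ^ 3)) = 3 * u\<^sup>2 - 2 * u" .
  have "4 * (t3 / (8 * E ^ 3))\<^sup>2 = t3\<^sup>2 / (16 * (E\<^sup>2) ^ 3)"
    by (simp add: power_divide power_mult_distrib flip: power_mult)
  also have "\<dots> = 4 * u ^ 3 - 4 * u\<^sup>2 + 1" unfolding r u using E by (simp add: field_simps power2_eq_square power3_eq_cube)
  finally have iii: "4 * (t3 / (8 * E ^ 3))\<^sup>2 = 4 * u ^ 3 - 4 * u\<^sup>2 + 1" .
  show thesis using that halving_identity[OF i ii iii] by blast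
qed

section \<open>Heights under doubling\<close>

text \<open>\<open>dup\<close> is the duplication formula, from \<open>A / e^2\<close> to
  \<open>A0 / e0^2\<close>, with denominators cleared. At most a factor 11 cancels between its
  numerator and denominator, while the larger of the two grows like the fourth power of the
  height.\<close>

lemma E2_height:
  fixes A e A0 e0 V v' :: int
  assumes cop: "coprime A e" "coprime A0 e0" and pos: "0 < e" "0 < e0"
    and V: "V\<^sup>2 = 4 * A ^ 3 - 4 * A\<^sup>2 * e\<^sup>2 + e ^ 6"
    and dup: "A0 * (e\<^sup>2 * V\<^sup>2) = e0\<^sup>2 * (A ^ 4 - 2 * A * e ^ 6 + e ^ 8)"
    and H: "4 \<le> max \<bar>A\<bar> (e\<^sup>2)"
  shows "max \<bar>A\<bar> (e\<^sup>2) < max \<bar>A0\<bar> (e0\<^sup>2)"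
proof -
  define E where "E = e\<^sup>2"
  define E0 where "E0 = e0\<^sup>2"
  define n where "n = A ^ 4 - 2 * A * E ^ 3 + E ^ 4"
  define F where "F = 4 * A ^ 3 - 4 * A\<^sup>2 * E + E ^ 3"
  have pw: "e ^ 6 = E ^ 3" "e ^ 8 = E ^ 4" by (simp_all add: E_def flip: power_mult)
  have E: "0 < E" "0 < E0" using pos by (simp_all add: E_def E0_def)
  have copE: "coprime A E" "coprime A0 E0" using cop by (simp_all add: E_def E0_def)
  have eq: "A0 * (E * F) = E0 * n" using dup unfolding V pw n_def F_def E_def E0_def by simp
  have "E0 dvd A0 * (E * F)" unfolding eq by simp
  then have "E0 dvd E * F" using copE(2) by (simp add: coprime_dvd_mult_right_iff coprime_commute)
  then obtain g where g: "E * F = E0 * g" ..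
  have "E0 * n = A0 * (E0 * g)" using eq unfolding g by (rule sym)
  then have "E0 * n = E0 * (A0 * g)" by (simp only: mult.left_commute)
  then have n: "n = A0 * g" using E by auto
  have "coprime g E"
  proof (rule coprimeI_prime_int)
    fix l :: int assume l: "prime l" "l dvd g" "l dvd E"
    have "A ^ 4 = n + E * (2 * A * E\<^sup>2 - E ^ 3)" unfolding n_def by (simp add: power2_eq_square power3_eq_cube power4_eq_xxxx algebra_simps)
    then have "l dvd A ^ 4" using l n by simp
    then have "l dvd A" using l(1) prime_dvd_power by blast
    then show False using copE(1) l by (meson coprime_common_divisor not_prime_unit)
  qed
  moreover have "g dvd E * F" unfolding g by simp
  ultimately have "g dvd F" by (simp add: coprime_dvd_mult_right_iff)
  \<comment> \<open>A Bezout identity for numerator and denominator of the duplication formula; 11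
    is the discriminant of the curve up to sign.\<close>
  moreover have "(48 * A\<^sup>2 - 32 * A * E - 16 * E\<^sup>2) * n + (27 * E ^ 3 - 4 * A\<^sup>2 * E - 12 * A ^ 3) * F = 11 * E ^ 6"
    unfolding n_def F_def by (simp add: eval_nat_numeral algebra_simps)
  ultimately have "g dvd 11 * E ^ 6" using n by (metis dvd_add dvd_mult dvd_triv_right)
  then have "g dvd 11" using \<open>coprime g E\<close> by (simp add: coprime_dvd_mult_left_iff)
  then have g11: "\<bar>g\<bar> \<le> 11" by (simp add: zdvd_imp_le)
  have bn: "\<bar>n\<bar> \<le> 11 * \<bar>A0\<bar>" unfolding n abs_mult using g11 mult_left_mono[of "\<bar>g\<bar>" 11 "\<bar>A0\<bar>"] by simp
  have bF: "\<bar>E * F\<bar> \<le> 11 * E0" unfolding g abs_mult using g11 mult_left_mono[of "\<bar>g\<bar>" 11 "\<bar>E0\<bar>"] E by simp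
  have p4: "64 * t \<le> t ^ 4" if "4 \<le> t" for t :: int
    using that power_mono[of 4 t 3] mult_left_mono[of 64 "t ^ 3" t] by (simp add: power3_eq_cube power4_eq_xxxx ac_simps)
  have H': "4 \<le> max \<bar>A\<bar> E" using H by (simp add: E_def)
  have "11 * max \<bar>A\<bar> E < max \<bar>n\<bar> (E * F)"
  proof -
    \<comment> \<open>The cases follow \<open>u = A / E\<close>: the numerator \<open>n\<close> is
      large for \<open>u < 0\<close> and for \<open>u\<close> from 3/2 on, the denominator
      \<open>E * F\<close> in between. The range from 1 to 3/2 is the tightest: height 4 suffices
      there because 64 times 16/81 exceeds 11.\<close>
    consider "A < 0" | "0 \<le> A" "A \<le> E" | "E < A" "3 * E \<le> 2 * A" | "E < A" "2 * A < 3 * E" by linarith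
    then show ?thesis
    proof cases
      case 1
      have "A * E ^ 3 \<le> 0" using 1 E by (intro mult_nonpos_nonneg) simp_all
      then have "A ^ 4 + E ^ 4 \<le> n" by (simp add: n_def mult.assoc)
      moreover have "\<bar>A\<bar> ^ 4 = A ^ 4" by simp
      moreover have "64 * max \<bar>A\<bar> E \<le> max \<bar>A\<bar> E ^ 4" using p4 H by (simp add: E_def)
      moreover have "max \<bar>A\<bar> E ^ 4 \<le> A ^ 4 + E ^ 4" by (simp add: max_def)
      ultimately show ?thesis using H unfolding E_def[symmetric] by linarith
    next
      case 2
      have H4: "4 \<le> E" and M: "max \<bar>A\<bar> E = E" using 2 H' by linarith+
      \<comment> \<open>\<open>4u^3 - 4u^2 + 1\<close> has the minimum 11/27 on nonnegative
        \<open>u\<close>, attained at 2/3.\<close>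
      have "27 * F - 11 * E ^ 3 = 4 * ((3 * A - 2 * E)\<^sup>2 * (3 * A + E))"
        unfolding F_def by (simp add: power2_eq_square power3_eq_cube algebra_simps)
      also have "0 \<le> \<dots>" using 2 E by simp
      finally have "E * (11 * E ^ 3) \<le> E * (27 * F)" using E by (intro mult_left_mono) simp_all
      then have "11 * E ^ 4 \<le> 27 * (E * F)" by (simp add: power3_eq_cube power4_eq_xxxx ac_simps)
      then show ?thesis unfolding M using p4[OF H4] H4 by linarith
    next
      case 3
      have H4: "4 \<le> A" and M: "max \<bar>A\<bar> E = A" using 3 E H' by linarith+
      have "(3 * E) ^ 3 \<le> (2 * A) ^ 3" using 3 E by (intro power_mono) simp_all
      then have "A * (27 * E ^ 3) \<le> A * (8 * A ^ 3)" using H4 by (intro mult_left_mono) simp_all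
      then have "27 * (A * E ^ 3) \<le> 8 * A ^ 4" by (simp add: power3_eq_cube power4_eq_xxxx ac_simps)
      moreover have "0 \<le> A * E ^ 3" "0 \<le> E ^ 4" using H4 E by simp_all
      moreover have "n = A ^ 4 - 2 * (A * E ^ 3) + E ^ 4" by (simp add: n_def)
      ultimately have "2 * A ^ 4 \<le> 5 * n" by linarith
      then show ?thesis unfolding M using p4[OF H4] H4 by linarith
    next
      case 4
      have H4: "4 \<le> A" and M: "max \<bar>A\<bar> E = A" using 4 E H' by linarith+
      have "F - E ^ 3 = 4 * A\<^sup>2 * (A - E)" unfolding F_def by (simp add: power2_eq_square power3_eq_cube algebra_simps)
      also have "0 \<le> \<dots>" using 4 by simp
      finally have "E * E ^ 3 \<le> E * F" using E by (intro mult_left_mono) simp_all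
      then have "E ^ 4 \<le> E * F" by (simp add: power3_eq_cube power4_eq_xxxx)
      moreover have "(2 * A) ^ 4 \<le> (3 * E) ^ 4" using 4 H4 by (intro power_mono) simp_all
      then have "16 * A ^ 4 \<le> 81 * E ^ 4" by (simp add: power_mult_distrib)
      ultimately show ?thesis unfolding M using p4[OF H4] H4 by linarith
    qed
  qed
  then have "11 * max \<bar>A\<bar> E < 11 * max \<bar>A0\<bar> E0" using bn bF by linarith
  then show ?thesis by (simp add: E_def E0_def)
qed

lemma E2_small:
  fixes A e V :: int
  assumes "0 < e" "V\<^sup>2 = 4 * A ^ 3 - 4 * A\<^sup>2 * e\<^sup>2 + e ^ 6" "max \<bar>A\<bar> (e\<^sup>2) < 4"
  shows "e = 1 \<and> A \<in> {0, 1}"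
proof -
  have "e = 1"
  proof (rule ccontr)
    assume "e \<noteq> 1"
    then have "2\<^sup>2 \<le> e\<^sup>2" using assms(1) by (intro power_mono) simp_all
    then show False using assms(3) by simp
  qed
  moreover have "A \<in> {-3, -2, -1, 0, 1, 2, 3}" using assms(3) by auto
  \<comment> \<open>17 and 73 are the values for \<open>A = 2\<close> and \<open>A = 3\<close>; for
    negative \<open>A\<close> the value is negative.\<close>
  moreover have "V\<^sup>2 \<noteq> 17" "V\<^sup>2 \<noteq> 73"
  proof -
    have "\<bar>V\<bar>\<^sup>2 \<noteq> 17"
    proof
      assume *: "\<bar>V\<bar>\<^sup>2 = 17"
      then have "4\<^sup>2 < \<bar>V\<bar>\<^sup>2" "\<bar>V\<bar>\<^sup>2 < 5\<^sup>2" by simp_all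
      then have "4 < \<bar>V\<bar>" "\<bar>V\<bar> < 5" using power2_less_imp_less by fastforce+
      then show False by simp
    qed
    moreover have "\<bar>V\<bar>\<^sup>2 \<noteq> 73"
    proof
      assume *: "\<bar>V\<bar>\<^sup>2 = 73"
      then have "8\<^sup>2 < \<bar>V\<bar>\<^sup>2" "\<bar>V\<bar>\<^sup>2 < 9\<^sup>2" by simp_all
      then have "8 < \<bar>V\<bar>" "\<bar>V\<bar> < 9" using power2_less_imp_less by fastforce+
      then show False by simp
    qed
    ultimately show "V\<^sup>2 \<noteq> 17" "V\<^sup>2 \<noteq> 73" by simp_all
  qed
  moreover have "0 \<le> V\<^sup>2" by simp
  ultimately show ?thesis using assms(2) by auto
qed

text \<open>The abscissa \<open>w\<close> of a half either has height below 4, and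
  \<open>E2_small\<close> applies, or has smaller height than \<open>u\<close>, and the induction
  hypothesis applies. In both cases it is 0 or 1, and doubling interchanges these two.\<close>

lemma E2_rat_aux:
  fixes u v :: rat and A e :: int
  assumes "v\<^sup>2 = 4 * u ^ 3 - 4 * u\<^sup>2 + 1" "u = of_int A / of_int e ^ 2" "0 < e" "coprime A e"
  shows "u \<in> {0, 1}"
  using assms
proof (induction "nat (max \<bar>A\<bar> (e\<^sup>2))" arbitrary: A e u v rule: less_induct)
  case less
  obtain w v' where w: "v'\<^sup>2 = 4 * w ^ 3 - 4 * w\<^sup>2 + 1" "u * v'\<^sup>2 = w ^ 4 - 2 * w + 1"
    using E2_halving[OF less.prems(1)] .
  obtain B f V where f: "w = of_int B / of_int f ^ 2" "0 < f" "coprime B f"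
    "V\<^sup>2 = 4 * B ^ 3 - 4 * B\<^sup>2 * f\<^sup>2 + f ^ 6"
    using E2_coords[OF w(1)] .
  have "w \<in> {0, 1}"
  proof (cases "max \<bar>B\<bar> (f\<^sup>2) < 4")
    case True
    then show ?thesis using E2_small[OF f(2,4)] f(1) by auto
  next
    case False
    define b F a E :: rat where "b = of_int B" and "F = of_int f" and "a = of_int A" and "E = of_int e"
    have nz: "F \<noteq> 0" "E \<noteq> 0" using f less.prems by (simp_all add: F_def E_def)
    have ww: "w = b / F\<^sup>2" "u = a / E\<^sup>2" using f less.prems by (simp_all add: F_def E_def a_def b_def)
    have "a * (4 * w ^ 3 - 4 * w\<^sup>2 + 1) = E\<^sup>2 * (w ^ 4 - 2 * w + 1)"
      using w(2) nz unfolding w(1) ww(2) by (simp add: field_simps)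
    then have "F ^ 8 * (a * (4 * w ^ 3 - 4 * w\<^sup>2 + 1)) = F ^ 8 * (E\<^sup>2 * (w ^ 4 - 2 * w + 1))" by simp
    moreover have "F ^ 8 * (a * (4 * w ^ 3 - 4 * w\<^sup>2 + 1)) = a * (F\<^sup>2 * (4 * b ^ 3 - 4 * b\<^sup>2 * F\<^sup>2 + F ^ 6))"
      unfolding ww using nz by (simp add: field_simps eval_nat_numeral)
    moreover have "F ^ 8 * (E\<^sup>2 * (w ^ 4 - 2 * w + 1)) = E\<^sup>2 * (b ^ 4 - 2 * b * F ^ 6 + F ^ 8)"
      unfolding ww using nz by (simp add: field_simps eval_nat_numeral)
    ultimately have "a * (F\<^sup>2 * (4 * b ^ 3 - 4 * b\<^sup>2 * F\<^sup>2 + F ^ 6)) = E\<^sup>2 * (b ^ 4 - 2 * b * F ^ 6 + F ^ 8)"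
      by (simp only:)
    then have "(of_int (A * (f\<^sup>2 * V\<^sup>2)) :: rat) = of_int (e\<^sup>2 * (B ^ 4 - 2 * B * f ^ 6 + f ^ 8))"
      unfolding f(4) a_def b_def F_def E_def by simp
    then have "A * (f\<^sup>2 * V\<^sup>2) = e\<^sup>2 * (B ^ 4 - 2 * B * f ^ 6 + f ^ 8)" by (simp only: of_int_eq_iff)
    moreover have "4 \<le> max \<bar>B\<bar> (f\<^sup>2)" using False by linarith
    ultimately have "max \<bar>B\<bar> (f\<^sup>2) < max \<bar>A\<bar> (e\<^sup>2)"
      by (rule E2_height[OF f(3) less.prems(4) f(2) less.prems(3) f(4)])
    then have "nat (max \<bar>B\<bar> (f\<^sup>2)) < nat (max \<bar>A\<bar> (e\<^sup>2))" using False by linarith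
    then show ?thesis using less.hyps w(1) f by blast
  qed
  then show ?case using w by auto
qed

lemma E2_rat:
  fixes u v :: rat
  assumes "v\<^sup>2 = 4 * u ^ 3 - 4 * u\<^sup>2 + 1"
  shows "u \<in> {0, 1}"
  using E2_coords[OF assms] E2_rat_aux[OF assms] by metis

section \<open>Rational and quadratic abscissae\<close>

lemma E1_rat:
  fixes x y :: rat
  assumes "y\<^sup>2 = - ((x\<^sup>2 - 3) * (x\<^sup>2 + 1))"
  shows "x \<in> {1, -1}"
proof -
  obtain p q where pq: "x = of_int p / of_int q" "q > 0" "coprime p q"
    by (metis Fract_of_int_quotient Rat_cases)
  have "(y * of_int q ^ 2)\<^sup>2 = of_int ((3 * q\<^sup>2 - p\<^sup>2) * (q\<^sup>2 + p\<^sup>2))"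
    using pq(2) unfolding power_mult_distrib assms pq(1) by (simp add: field_simps power2_eq_square)
  then obtain g where "y * of_int q ^ 2 = of_int g" by (rule square_int_rat)
  with \<open>(y * _)\<^sup>2 = _\<close> have "(of_int (g\<^sup>2) :: rat) = of_int ((3 * q\<^sup>2 - p\<^sup>2) * (q\<^sup>2 + p\<^sup>2))" by simp
  then have "(3 * q\<^sup>2 - p\<^sup>2) * (q\<^sup>2 + p\<^sup>2) = g\<^sup>2" by (simp only: of_int_eq_iff)
  moreover have "coprime q p" using pq(3) by (simp add: coprime_commute)
  ultimately have "q\<^sup>2 = p\<^sup>2" by (rule E1_int)
  then have "p = q \<or> p = - q" by (simp add: power2_eq_iff) linarith
  then show ?thesis using pq(1,2) by auto
qed

lemma E2_rat_x:
  fixes x z :: rat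
  assumes "z\<^sup>2 = - 2 * (x ^ 3 - x\<^sup>2 - x - 1)"
  shows "x \<in> {1, -1}"
proof -
  have "(z / 2)\<^sup>2 = 4 * ((1 - x) / 2) ^ 3 - 4 * ((1 - x) / 2)\<^sup>2 + 1"
    unfolding power_divide assms by (simp add: power2_eq_square power3_eq_cube field_simps)
  then have "(1 - x) / 2 \<in> {0, 1}" by (rule E2_rat)
  then show ?thesis by (auto simp: field_simps)
qed

section \<open>Rational abscissa, irrational ordinates\<close>

text \<open>Modulo \<open>3q^2 - p^2\<close> the cubic form is \<open>2q^2(p - 2q)\<close>, and
  modulo \<open>q^2 + p^2\<close> it is \<open>-2pq^2\<close>; so only 2 can divide both
  products.\<close>

lemma prime_common_twist:
  fixes p q l :: int
  assumes "prime l" "coprime p q" "\<not> l dvd 2" "l dvd (3 * q\<^sup>2 - p\<^sup>2) * (q\<^sup>2 + p\<^sup>2)"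
    "l dvd 2 * q * (p ^ 3 - p\<^sup>2 * q - p * q\<^sup>2 - q ^ 3)"
  shows False
proof -
  have no: "\<not> (l dvd p \<and> l dvd q)" using assms(1,2) by (meson coprime_common_divisor not_prime_unit)
  have pd: "l dvd a \<or> l dvd b" if "l dvd a * b" for a b using that assms(1) by (simp add: prime_dvd_mult_iff)
  have pp: "l dvd a" if "l dvd a ^ n" for a n using that assms(1) prime_dvd_power by blast
  have q: "\<not> l dvd q"
  proof
    assume q: "l dvd q"
    have "p ^ 4 = q * (q * (3 * q\<^sup>2 + 2 * p\<^sup>2)) - (3 * q\<^sup>2 - p\<^sup>2) * (q\<^sup>2 + p\<^sup>2)"
      by (simp add: power2_eq_square power4_eq_xxxx algebra_simps)
    then have "l dvd p ^ 4" using assms(4) q by simp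
    then show False using no q pp by blast
  qed
  then have C: "l dvd p ^ 3 - p\<^sup>2 * q - p * q\<^sup>2 - q ^ 3" using assms(3,5) pd by blast
  from pd[OF assms(4)] show False
  proof
    assume l: "l dvd 3 * q\<^sup>2 - p\<^sup>2"
    have "2 * (q ^ 2 * (p - 2 * q)) = (p ^ 3 - p\<^sup>2 * q - p * q\<^sup>2 - q ^ 3) + (p - q) * (3 * q\<^sup>2 - p\<^sup>2)"
      by (simp add: power2_eq_square power3_eq_cube algebra_simps)
    then have "l dvd 2 * (q ^ 2 * (p - 2 * q))" using C l by simp
    then have "l dvd p - 2 * q" using assms(3) q pd pp by blast
    moreover have "q ^ 2 = - ((3 * q\<^sup>2 - p\<^sup>2) + (p - 2 * q) * (p + 2 * q))"
      by (simp add: power2_eq_square algebra_simps)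
    ultimately have "l dvd q ^ 2" using l by (metis dvd_add dvd_minus_iff dvd_mult2)
    then show False using q pp by blast
  next
    assume l: "l dvd q\<^sup>2 + p\<^sup>2"
    have "2 * (p * q ^ 2) = (p - q) * (q\<^sup>2 + p\<^sup>2) - (p ^ 3 - p\<^sup>2 * q - p * q\<^sup>2 - q ^ 3)"
      by (simp add: power2_eq_square power3_eq_cube algebra_simps)
    then have "l dvd 2 * (p * q ^ 2)" using C l by (metis dvd_diff dvd_mult)
    then have p: "l dvd p" using assms(3) q pd pp by blast
    have "q ^ 2 = (q\<^sup>2 + p\<^sup>2) - p * p" by (simp add: power2_eq_square)
    then have "l dvd q ^ 2" using l p by (metis dvd_diff dvd_mult)
    then show False using q pp by blast
  qed
qed

text \<open>Away from 2 the first two factors are coprime to the rest, so their product is a square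
  up to sign. The sign 1 is E1 itself. The sign -1 survives only for \<open>p\<close> and
  \<open>q\<close> of different parity, where \<open>p^2 + q^2\<close> and \<open>p^2 - 3q^2\<close>
  are coprime and hence squares.\<close>

lemma twist_int:
  fixes p q w :: int
  assumes "coprime p q" "q \<noteq> 0" "w \<noteq> 0"
    "(3 * q\<^sup>2 - p\<^sup>2) * (q\<^sup>2 + p\<^sup>2) * (2 * q * (p ^ 3 - p\<^sup>2 * q - p * q\<^sup>2 - q ^ 3)) = - (w\<^sup>2)"
  shows "q\<^sup>2 = p\<^sup>2"
proof -
  define G where "G = (3 * q\<^sup>2 - p\<^sup>2) * (q\<^sup>2 + p\<^sup>2)"
  define D where "D = 2 * q * (p ^ 3 - p\<^sup>2 * q - p * q\<^sup>2 - q ^ 3)"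
  have GD: "G * - D = w\<^sup>2" using assms(4) by (simp add: G_def D_def)
  have cop: "coprime g (- D)" if "odd g" "g dvd G" for g
  proof (rule coprimeI_prime_int)
    fix l :: int assume l: "prime l" "l dvd g" "l dvd - D"
    have "\<not> l dvd 2"
    proof
      assume "l dvd 2"
      then have "l = 2" using l(1) by (simp add: primes_dvd_imp_eq)
      then show False using l(2) that(1) by simp
    qed
    moreover have "l dvd G" using l(2) that(2) by (rule dvd_trans)
    ultimately show False using prime_common_twist[OF l(1) assms(1)] l(3) unfolding G_def D_def by simp
  qed
  show ?thesis
  proof (cases "odd p \<and> odd q")
    case True
    obtain i j where ij: "p\<^sup>2 = 8 * i + 1" "q\<^sup>2 = 8 * j + 1"
      using odd_square_int[of p] odd_square_int[of q] True by metis
    define g where "g = 4 * ((3 * j - i) * (4 * j + 4 * i + 1) + j + i) + 1"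
    have G: "G = 4 * g" unfolding G_def g_def ij by (simp add: algebra_simps)
    have "odd g" by (simp add: g_def)
    have "even (w\<^sup>2)" unfolding GD[symmetric] G by simp
    then obtain w' where w': "w = 2 * w'" by (auto elim: evenE)
    have "4 * (g * - D) = 4 * w'\<^sup>2" using GD unfolding G w' by (simp add: power_mult_distrib)
    then have "g * - D = w'\<^sup>2" by linarith
    moreover have "w' \<noteq> 0" using assms(3) w' by simp
    ultimately obtain e x where e: "e \<in> {1, -1}" "g = e * x\<^sup>2"
      using coprime_mult_square[OF cop[OF \<open>odd g\<close>]] G by (metis dvd_triv_right)
    have "odd x" using \<open>odd g\<close> e by auto
    then obtain k where k: "x\<^sup>2 = 8 * k + 1" by (rule odd_square_int)
    \<comment> \<open>\<open>g\<close> is 1 modulo 4, and minus an odd square is not.\<close>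
    have "e \<noteq> - 1"
    proof
      assume "e = - 1"
      then have "4 * ((3 * j - i) * (4 * j + 4 * i + 1) + j + i) + 1 = - (8 * k + 1)" using e(2) k g_def by simp
      then show False by presburger
    qed
    then have "G = (2 * x)\<^sup>2" using e G by (simp add: power_mult_distrib)
    then show ?thesis using E1_int[of q p "2 * x"] assms(1) by (simp add: G_def coprime_commute)
  next
    case False
    then have par: "odd p \<noteq> odd q" using assms(1) by (metis coprime_common_divisor odd_one)
    then have "odd G" unfolding G_def by auto
    obtain e x where e: "e \<in> {1, -1}" "G = e * x\<^sup>2"
      using coprime_mult_square[OF cop[OF \<open>odd G\<close>] GD assms(3)] by (metis dvd_refl)
    show ?thesis
    proof (cases "e = 1")
      case True
      then show ?thesis using E1_int[of q p x] assms(1) e by (simp add: G_def coprime_commute)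
    next
      case False
      then have prod: "(p\<^sup>2 + q\<^sup>2) * (p\<^sup>2 - 3 * q\<^sup>2) = x\<^sup>2"
        using e unfolding G_def by (simp add: algebra_simps)
      have cop2: "coprime (p\<^sup>2 + q\<^sup>2) (p\<^sup>2 - 3 * q\<^sup>2)"
      proof (rule coprimeI_prime_int)
        fix l :: int assume l: "prime l" "l dvd p\<^sup>2 + q\<^sup>2" "l dvd p\<^sup>2 - 3 * q\<^sup>2"
        have "odd (p\<^sup>2 + q\<^sup>2)" using par by auto
        have l2: "\<not> l dvd 2"
        proof
          assume "l dvd 2"
          then have "l = 2" using l(1) by (simp add: primes_dvd_imp_eq)
          then show False using l(2) \<open>odd (p\<^sup>2 + q\<^sup>2)\<close> by simp
        qed
        have "2 * (2 * q ^ 2) = (p\<^sup>2 + q\<^sup>2) - (p\<^sup>2 - 3 * q\<^sup>2)" by simp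
        then have "l dvd 2 * (2 * q ^ 2)" using l by (metis dvd_diff)
        then have q: "l dvd q" using l2 l(1) prime_dvd_power by (metis prime_dvd_mult_iff)
        have "p ^ 2 = (p\<^sup>2 + q\<^sup>2) - q * q" by (simp add: power2_eq_square)
        then have "l dvd p ^ 2" using l q by (metis dvd_diff dvd_mult)
        then have "l dvd p" using l(1) prime_dvd_power by blast
        then show False using q assms(1) l(1) by (meson coprime_common_divisor not_prime_unit)
      qed
      have pos: "0 < p\<^sup>2 + q\<^sup>2" using assms(2) by (simp add: sum_power2_gt_zero_iff)
      then have nn: "0 \<le> p\<^sup>2 - 3 * q\<^sup>2" using prod by (metis mult_pos_neg not_le zero_le_power2)
      obtain r where "p\<^sup>2 + q\<^sup>2 = r\<^sup>2" using coprime_mult_square_nonneg[OF cop2 prod] pos by auto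
      moreover obtain s where "p\<^sup>2 - 3 * q\<^sup>2 = s\<^sup>2"
        using coprime_mult_square_nonneg[of "p\<^sup>2 - 3 * q\<^sup>2" "p\<^sup>2 + q\<^sup>2" x] cop2 prod nn
        by (auto simp: coprime_commute mult.commute)
      ultimately have "q = 0" using concordant_forms assms(1) by blast
      then show ?thesis using assms(2) by simp
    qed
  qed
qed

text \<open>Multiplied by \<open>Q^4\<close>, the equation reads \<open>- D = b^2 G\<close>; so
  \<open>b G\<close> is a rational number with the integral square \<open>- (G D)\<close>, hence an
  integer.\<close>

lemma twist_rat:
  fixes x b :: rat
  assumes "- 2 * (x ^ 3 - x\<^sup>2 - x - 1) = b\<^sup>2 * - ((x\<^sup>2 - 3) * (x\<^sup>2 + 1))"
  shows "x \<in> {1, -1}"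
proof (cases "b = 0")
  case True
  then have "0\<^sup>2 = - 2 * (x ^ 3 - x\<^sup>2 - x - 1)" using assms by simp
  then show ?thesis by (rule E2_rat_x)
next
  case False
  obtain p q where pq: "x = of_int p / of_int q" "q > 0" "coprime p q"
    by (metis Fract_of_int_quotient Rat_cases)
  define P Q :: rat where "P = of_int p" and "Q = of_int q"
  have Q: "Q \<noteq> 0" "x = P / Q" using pq by (simp_all add: P_def Q_def)
  define G where "G = (3 * q\<^sup>2 - p\<^sup>2) * (q\<^sup>2 + p\<^sup>2)"
  define D where "D = 2 * q * (p ^ 3 - p\<^sup>2 * q - p * q\<^sup>2 - q ^ 3)"
  have G: "of_int G = Q ^ 4 * - ((x\<^sup>2 - 3) * (x\<^sup>2 + 1))"
    unfolding Q(2) using Q(1) by (simp add: G_def P_def Q_def field_simps power2_eq_square power4_eq_xxxx)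
  have D: "of_int D = Q ^ 4 * (2 * (x ^ 3 - x\<^sup>2 - x - 1))"
    unfolding Q(2) using Q(1) by (simp add: D_def P_def Q_def field_simps power2_eq_square power3_eq_cube power4_eq_xxxx)
  have "of_int (- D) = b\<^sup>2 * of_int G"
    using arg_cong[OF assms, of "\<lambda>t. Q ^ 4 * t"] unfolding of_int_minus D G by (simp add: algebra_simps)
  have "(b * of_int G)\<^sup>2 = (b\<^sup>2 * of_int G) * of_int G" by (simp add: power2_eq_square ac_simps)
  also have "\<dots> = of_int (- D) * of_int G" by (simp only: \<open>of_int (- D) = b\<^sup>2 * of_int G\<close>)
  finally have sq: "(b * of_int G)\<^sup>2 = of_int (- (G * D))" by (simp add: mult.commute)
  then obtain w where w: "b * of_int G = of_int w" by (rule square_int_rat)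
  have "(of_int (G * D) :: rat) = of_int (- (w\<^sup>2))" using sq w by simp
  then have GD: "G * D = - (w\<^sup>2)" by (simp only: of_int_eq_iff)
  show ?thesis
  proof (cases "G = 0")
    case True
    then have "0\<^sup>2 = - ((x\<^sup>2 - 3) * (x\<^sup>2 + 1))" using G Q(1) by simp
    then show ?thesis by (rule E1_rat)
  next
    case nz: False
    then have "w \<noteq> 0" using w False by auto
    then have "q\<^sup>2 = p\<^sup>2" using twist_int[OF pq(3)] pq(2) GD unfolding G_def D_def by simp
    then have "p = q \<or> p = - q" by (simp add: power2_eq_iff) linarith
    then show ?thesis using pq(1,2) by auto
  qed
qed

section \<open>Conjugate pairs with quadratic abscissa\<close>

text \<open>\<open>c0\<close> and \<open>c1\<close> say that \<open>X^2 + mX + n\<close> divides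
  \<open>(a + bX)^2 + 2(X^3 - X^2 - X - 1)\<close>; the remaining root is the abscissa of the third
  point on the line.\<close>

lemma quadratic_point_E2:
  fixes m n a b :: rat
  assumes c0: "a\<^sup>2 - b\<^sup>2 * n + 2 * (m * n + n - 1) = 0" and c1: "2 * a * b - b\<^sup>2 * m + 2 * (m\<^sup>2 - n + m - 1) = 0"
  shows "\<exists>t. m = t\<^sup>2 / 2 \<and> n = 2 * t - 1 - t\<^sup>2 / 2 \<or> m = t\<^sup>2 / 2 - 2 \<and> n = t\<^sup>2 / 2 + 2 * t + 1"
proof -
  \<comment> \<open>The third root, from the sum of the three roots.\<close>
  define r where "r = m + 1 - b\<^sup>2 / 2"
  have b2: "b\<^sup>2 = 2 * (m + 1 - r)" by (simp add: r_def)
  have "(a + b * r)\<^sup>2 + 2 * (r ^ 3 - r\<^sup>2 - r - 1) = a\<^sup>2 + 2 * a * b * r + b\<^sup>2 * r\<^sup>2 + 2 * (r ^ 3 - r\<^sup>2 - r - 1)"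
    by (simp add: power2_eq_square algebra_simps)
  also have "\<dots> = (2 * a * b - b\<^sup>2 * m + 2 * (m\<^sup>2 - n + m - 1)) * r + (a\<^sup>2 - b\<^sup>2 * n + 2 * (m * n + n - 1))"
    unfolding b2 by (simp add: power2_eq_square power3_eq_cube algebra_simps)
  finally have "(a + b * r)\<^sup>2 = - 2 * (r ^ 3 - r\<^sup>2 - r - 1)" unfolding c0 c1 by simp
  moreover from this have r: "r \<in> {1, -1}" by (rule E2_rat_x)
  ultimately have "(a + b * r)\<^sup>2 = 2\<^sup>2" by auto
  then have "a + b * r = 2 \<or> a + b * r = - 2" by (simp only: power2_eq_iff)
  \<comment> \<open>\<open>t\<close> is \<open>b\<close> or \<open>- b\<close>: negating the line
    leaves \<open>m\<close> and \<open>n\<close> unchanged, so its ordinate at \<open>r\<close> may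
    be taken to be 2.\<close>
  then obtain t where t: "t\<^sup>2 = b\<^sup>2" "a\<^sup>2 = (2 - t * r)\<^sup>2"
  proof
    assume "a + b * r = 2"
    then have "a = 2 - b * r" by simp
    then show thesis using that[of b] by simp
  next
    assume "a + b * r = - 2"
    then have "a = - (2 - (- b) * r)" by simp
    then have "a\<^sup>2 = (2 - (- b) * r)\<^sup>2" by (simp only: power2_minus)
    then show thesis using that[of "- b"] power2_minus[of b] by blast
  qed
  from r show ?thesis
  proof (elim insertE emptyE)
    assume r1: "r = 1"
    then have m: "m = t\<^sup>2 / 2" using b2 t by simp
    have "(2 - t)\<^sup>2 - t\<^sup>2 * n + 2 * (t\<^sup>2 / 2 * n + n - 1) = 0" using c0 unfolding t(1)[symmetric] t(2) r1 m by simp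
    moreover have "(2 - t)\<^sup>2 - t\<^sup>2 * n + 2 * (t\<^sup>2 / 2 * n + n - 1) = 2 * (n - (2 * t - 1 - t\<^sup>2 / 2))"
      by (simp add: power2_diff algebra_simps)
    ultimately have "n = 2 * t - 1 - t\<^sup>2 / 2" by simp
    then show ?thesis using m by blast
  next
    assume r1: "r = - 1"
    then have m: "m = t\<^sup>2 / 2 - 2" using b2 t by simp
    have "(2 + t)\<^sup>2 - t\<^sup>2 * n + 2 * ((t\<^sup>2 / 2 - 2) * n + n - 1) = 0" using c0 unfolding t(1)[symmetric] t(2) r1 m by simp
    moreover have "(2 + t)\<^sup>2 - t\<^sup>2 * n + 2 * ((t\<^sup>2 / 2 - 2) * n + n - 1) = 2 * (t\<^sup>2 / 2 + 2 * t + 1 - n)"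
      by (simp add: power2_sum algebra_simps)
    ultimately have "n = t\<^sup>2 / 2 + 2 * t + 1" by simp
    then show ?thesis using m by blast
  qed
qed

text \<open>\<open>c0\<close> and \<open>c1\<close> say that \<open>X^2 + mX + n\<close> divides
  \<open>(a + bX)^2 + (X^2 - 3)(X^2 + 1)\<close>. Adding \<open>k(X^2 + mX + n)\<close> to the line
  gives the parabolas through the pair, and \<open>k\<close> is chosen to reach (1, 2). The leading
  coefficient \<open>K = k^2 + 1\<close> is nonzero, so the cofactor has the two roots 1 and
  \<open>r\<close>.\<close>

lemma quadratic_point_E1:
  fixes m n a b :: rat
  assumes c0: "a\<^sup>2 - b\<^sup>2 * n = m\<^sup>2 * n - n\<^sup>2 - 2 * n + 3" and c1: "2 * a * b - b\<^sup>2 * m = m ^ 3 - 2 * m * n - 2 * m"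
    and nz: "1 + m + n \<noteq> 0"
  shows "\<exists>k. (k\<^sup>2 + 1) * m = 2 - 2 * k\<^sup>2 \<and> (k\<^sup>2 + 1) * n = k\<^sup>2 + 4 * k + 1
    \<or> m = 0 \<and> (k\<^sup>2 + 1) * n = - (k\<^sup>2 - 4 * k + 1)
    \<or> (k\<^sup>2 + 1) * m = 4 * k \<and> (k\<^sup>2 + 1) * n = 3 - k\<^sup>2"
proof -
  define k where "k = (2 - a - b) / (1 + m + n)"
  have k: "a + b + k * (1 + m + n) = 2" using nz by (simp add: k_def)
  define A where "A = a + k * n"
  define B where "B = b + k * m"
  define K where "K = k\<^sup>2 + 1"
  have "0 < K" by (simp add: K_def add_nonneg_pos)
  have AB: "A = 2 - B - k" using k by (simp add: A_def B_def algebra_simps)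
  define c where "c = 2 * k * B - K * m"
  define d where "d = B\<^sup>2 + 2 * k * A - 2 - K * n - m * c"
  have e1: "2 * A * B = m * d + n * c"
  proof -
    have "2 * A * B - (m * d + n * c) = (2 * a * b - b\<^sup>2 * m) - (m ^ 3 - 2 * m * n - 2 * m)"
      unfolding A_def B_def c_def d_def K_def by (simp add: power2_eq_square power3_eq_cube algebra_simps)
    then show ?thesis using c1 by simp
  qed
  have e0: "A\<^sup>2 - 3 = n * d"
  proof -
    have "A\<^sup>2 - 3 - n * d = (a\<^sup>2 - b\<^sup>2 * n) - (m\<^sup>2 * n - n\<^sup>2 - 2 * n + 3)"
      unfolding A_def B_def c_def d_def K_def by (simp add: power2_eq_square power3_eq_cube algebra_simps)
    then show ?thesis using c0 by simp
  qed
  have fac: "(A + B * t + k * t\<^sup>2)\<^sup>2 + (t\<^sup>2 - 3) * (t\<^sup>2 + 1) = (t\<^sup>2 + m * t + n) * (K * t\<^sup>2 + c * t + d)" for t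
  proof -
    have "(A + B * t + k * t\<^sup>2)\<^sup>2 + (t\<^sup>2 - 3) * (t\<^sup>2 + 1)
        = (A\<^sup>2 - 3) + 2 * A * B * t + (B\<^sup>2 + 2 * k * A - 2) * t\<^sup>2 + 2 * k * B * t ^ 3 + K * t ^ 4"
      unfolding K_def by (simp add: power2_eq_square power3_eq_cube power4_eq_xxxx algebra_simps)
    also have "\<dots> = n * d + (m * d + n * c) * t + (d + K * n + m * c) * t\<^sup>2 + (c + K * m) * t ^ 3 + K * t ^ 4"
      unfolding e0 e1 by (simp add: c_def d_def)
    also have "\<dots> = (t\<^sup>2 + m * t + n) * (K * t\<^sup>2 + c * t + d)"
      by (simp add: power2_eq_square power3_eq_cube power4_eq_xxxx algebra_simps)
    finally show ?thesis .
  qed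
  have "(1 + m + n) * (K + c + d) = 0" using fac[of 1] AB by simp
  then have c: "c = - K - d" using nz by simp
  define r where "r = d / K"
  have d: "d = K * r" using \<open>0 < K\<close> by (simp add: r_def)
  have "K * r\<^sup>2 + c * r + d = 0" unfolding c d by (simp add: power2_eq_square algebra_simps)
  then have r2: "(A + B * r + k * r\<^sup>2)\<^sup>2 = - ((r\<^sup>2 - 3) * (r\<^sup>2 + 1))" using fac[of r] by simp
  then have r: "r \<in> {1, -1}" by (rule E1_rat)
  then consider "r = 1" | "r = - 1" by auto
  then show ?thesis
  proof cases
    case 1
    have p: "2 * k * B = K * (m - 2)" "B\<^sup>2 + 2 * k * A - 2 = K * (n - 2 * m + 1)" "2 * A * B = K * (m - 2 * n)"
      "A\<^sup>2 - 3 = K * n"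
    proof -
      have c': "c = - 2 * K" and d': "d = K" using c d 1 by simp_all
      have "2 * k * B = c + K * m" by (simp add: c_def)
      then show "2 * k * B = K * (m - 2)" unfolding c' by (simp add: algebra_simps)
      have "B\<^sup>2 + 2 * k * A - 2 = d + K * n + m * c" by (simp add: d_def)
      then show "B\<^sup>2 + 2 * k * A - 2 = K * (n - 2 * m + 1)" unfolding c' d' by (simp add: algebra_simps)
      show "2 * A * B = K * (m - 2 * n)" using e1 unfolding c' d' by (simp add: algebra_simps)
      show "A\<^sup>2 - 3 = K * n" using e0 unfolding d' by simp
    qed
    \<comment> \<open>The derivative of \<open>fac\<close> at 1, where 1 is a double root of the
      cofactor. As \<open>t^4 - 2t^2 - 3\<close> is stationary there, the parabola has a horizontal
      tangent at (1, 2).\<close>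
    have "2 * (B + 2 * k) * (A + B + k) = 4 * K + 3 * (2 * k * B) + 2 * (B\<^sup>2 + 2 * k * A - 2) + 2 * A * B"
      unfolding K_def by (simp add: power2_eq_square algebra_simps)
    also have "\<dots> = 0" unfolding p by (simp add: algebra_simps)
    finally have "B = - 2 * k" unfolding AB by simp
    then have "K * m = 2 - 2 * k\<^sup>2" "K * n = k\<^sup>2 + 4 * k + 1"
      using p(1,4) unfolding AB K_def by (simp_all add: power2_eq_square algebra_simps)
    then show ?thesis unfolding K_def by blast
  next
    case 2
    have p: "2 * k * B = K * m" "A\<^sup>2 - 3 = - (K * n)"
      using c d e0 2 by (simp_all add: c_def)
    have "(A - B + k)\<^sup>2 = 2\<^sup>2" using r2 2 by simp
    then have "A - B + k = 2 \<or> A - B + k = - 2" by (simp only: power2_eq_iff)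
    then show ?thesis
    proof
      assume "A - B + k = 2"
      then have B: "B = 0" "A = 2 - k" using AB by simp_all
      then have "m = 0" using p(1) \<open>0 < K\<close> by simp
      moreover have "K * n = - (k\<^sup>2 - 4 * k + 1)"
        using p(2) unfolding B(2) by (simp add: power2_eq_square algebra_simps)
      ultimately show ?thesis unfolding K_def by blast
    next
      assume "A - B + k = - 2"
      then have B: "B = 2" "A = - k" using AB by simp_all
      then have "K * m = 4 * k" "K * n = 3 - k\<^sup>2" using p by (simp_all add: algebra_simps)
      then show ?thesis unfolding K_def by blast
    qed
  qed
qed

text \<open>For \<open>m = 0\<close> the value of \<open>s\<close> is known at once. Otherwise
  \<open>K s\<close> and \<open>K s^2\<close> are polynomials in \<open>k\<close>, and
  \<open>(K s)^2 = K (K s^2)\<close> eliminates \<open>s\<close>. The rational solutions only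
  produce \<open>X^2 - 1\<close>, \<open>(X + 1)^2\<close> and \<open>(X - 1)^2\<close>.\<close>

lemma no_common_quadratic:
  fixes m n s k :: rat
  assumes irr: "\<And>t. t\<^sup>2 + m * t + n \<noteq> 0"
    and E2: "m = s\<^sup>2 / 2 \<and> n = 2 * s - 1 - s\<^sup>2 / 2 \<or> m = s\<^sup>2 / 2 - 2 \<and> n = s\<^sup>2 / 2 + 2 * s + 1"
    and E1: "(k\<^sup>2 + 1) * m = 2 - 2 * k\<^sup>2 \<and> (k\<^sup>2 + 1) * n = k\<^sup>2 + 4 * k + 1
    \<or> m = 0 \<and> (k\<^sup>2 + 1) * n = - (k\<^sup>2 - 4 * k + 1)
    \<or> (k\<^sup>2 + 1) * m = 4 * k \<and> (k\<^sup>2 + 1) * n = 3 - k\<^sup>2"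
  shows False
proof -
  have irr': "\<not> (m = 0 \<and> n = - 1)" "\<not> (m = 2 \<and> n = 1)" "\<not> (m = - 2 \<and> n = 1)"
    using irr[of 1] irr[of "- 1"] by auto
  define K where "K = k\<^sup>2 + 1"
  have K: "0 < K" by (simp add: K_def add_nonneg_pos)
  have Ks: "K * (K * s\<^sup>2) = (K * s)\<^sup>2" by (simp add: power2_eq_square)
  from E2 consider (a) "m = s\<^sup>2 / 2" "n = 2 * s - 1 - s\<^sup>2 / 2" | (b) "m = s\<^sup>2 / 2 - 2" "n = s\<^sup>2 / 2 + 2 * s + 1"
    by blast
  then show False
  proof cases
    case a
    have mn: "K * s\<^sup>2 = 2 * (K * m)" "2 * (K * s) = K * m + K * n + K"
      unfolding a by (simp_all add: algebra_simps)
    from E1[folded K_def] consider (i) "K * m = 2 - 2 * k\<^sup>2" "K * n = k\<^sup>2 + 4 * k + 1"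
      | (ii) "m = 0" | (iii) "K * m = 4 * k" "K * n = 3 - k\<^sup>2" by blast
    then show False
    proof cases
      case i
      have Ks1: "K * s = 2 + 2 * k" using mn(2) unfolding i by (simp add: K_def)
      have "(2 + 2 * k)\<^sup>2 = K * (2 * (2 - 2 * k\<^sup>2))" using Ks mn(1) unfolding Ks1 i by simp
      then have "(1 + k) * (k * (k\<^sup>2 - k + 2)) = 0"
        unfolding K_def by (simp add: power2_eq_square algebra_simps)
      moreover have "k\<^sup>2 - k + 2 = (k - 1 / 2)\<^sup>2 + 7 / 4" by (simp add: power2_eq_square algebra_simps)
      then have "k\<^sup>2 - k + 2 \<noteq> 0" using zero_le_power2[of "k - 1 / 2"] by linarith
      ultimately have "k = - 1 \<or> k = 0" by (auto simp: add_eq_0_iff)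
      then show False using i irr' by (auto simp: K_def)
    next
      case ii
      then show False using a irr' by simp
    next
      case iii
      have Ks1: "K * s = 2 + 2 * k" using mn(2) unfolding iii by (simp add: K_def)
      have "(2 + 2 * k)\<^sup>2 = K * (2 * (4 * k))" using Ks mn(1) unfolding Ks1 iii by simp
      then have "(k - 1) * (2 * k\<^sup>2 + k + 1) = 0"
        unfolding K_def by (simp add: power2_eq_square algebra_simps)
      moreover have "2 * k\<^sup>2 + k + 1 = 2 * (k + 1 / 4)\<^sup>2 + 7 / 8" by (simp add: power2_eq_square algebra_simps)
      then have "2 * k\<^sup>2 + k + 1 \<noteq> 0" using zero_le_power2[of "k + 1 / 4"] by linarith
      ultimately have "k = 1" by simp
      then show False using iii irr' by (auto simp: K_def)
    qed
  next
    case b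
    have mn: "K * s\<^sup>2 = 2 * (K * m) + 4 * K" "2 * (K * s) = K * n - K * m - 3 * K"
      unfolding b by (simp_all add: algebra_simps)
    from E1[folded K_def] consider (i) "K * m = 2 - 2 * k\<^sup>2" "K * n = k\<^sup>2 + 4 * k + 1"
      | (ii) "m = 0" "K * n = - (k\<^sup>2 - 4 * k + 1)" | (iii) "K * m = 4 * k" "K * n = 3 - k\<^sup>2" by blast
    then show False
    proof cases
      case i
      have Ks1: "K * s = 2 * k - 2" using mn(2) unfolding i by (simp add: K_def)
      have "(2 * k - 2)\<^sup>2 = K * (2 * (2 - 2 * k\<^sup>2) + 4 * K)" using Ks mn(1) unfolding Ks1 i by simp
      then have "(k + 1)\<^sup>2 = 0"
        unfolding K_def by (simp add: power2_eq_square algebra_simps)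
      then have "k = - 1" by (simp add: add_eq_0_iff)
      then show False using i irr' by (auto simp: K_def)
    next
      case ii
      then have "s\<^sup>2 = 2\<^sup>2" using b by simp
      then have "s = 2 \<or> s = - 2" by (simp only: power2_eq_iff)
      then show False
      proof
        assume "s = 2"
        then have "8 * k\<^sup>2 - 4 * k + 8 = 0" using ii(2) b by (simp add: K_def algebra_simps)
        moreover have "8 * k\<^sup>2 - 4 * k + 8 = 8 * (k - 1 / 4)\<^sup>2 + 15 / 2" by (simp add: power2_eq_square algebra_simps)
        moreover have "0 \<le> (k - 1 / 4)\<^sup>2" by simp
        ultimately show False by linarith
      next
        assume "s = - 2"
        then show False using b irr' by simp
      qed
    next
      case iii
      have Ks1: "K * s = - 2 * k * (k + 1)" using mn(2) unfolding iii by (simp add: K_def power2_eq_square algebra_simps)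
      have "(- 2 * k * (k + 1))\<^sup>2 = K * (2 * (4 * k) + 4 * K)" using Ks mn(1) unfolding Ks1 iii by simp
      then have "(k + 1)\<^sup>2 = 0"
        unfolding K_def by (simp add: power2_eq_square algebra_simps)
      then have "k = - 1" by (simp add: add_eq_0_iff)
      then show False using iii irr' by (auto simp: K_def)
    qed
  qed
qed

section \<open>Points over the algebraic closure\<close>

lemma Qbar_simps [simp]:
  "carrier Qbar = UNIV" "x \<otimes>\<^bsub>Qbar\<^esub> y = x * y" "x \<oplus>\<^bsub>Qbar\<^esub> y = x + y" "\<one>\<^bsub>Qbar\<^esub> = 1" "\<zero>\<^bsub>Qbar\<^esub> = 0"
  by (simp_all add: ring_of_type_algebra_def)

lemma field_Qbar: "field Qbar"
  by (rule field_from_type_algebra)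

interpretation Qbar: cring Qbar
  by (rule cring_from_type_algebra)

lemma Qbar_a_inv [simp]: "\<ominus>\<^bsub>Qbar\<^esub> x = - x"
  by (rule Qbar.minus_equality) simp_all

lemma Qbar_m_inv [simp]: "x \<noteq> 0 \<Longrightarrow> inv\<^bsub>Qbar\<^esub> x = inverse x"
  by (rule Qbar.comm_inv_char) simp_all

lemma subfield_Rats: "subfield \<rat> Qbar"
proof (rule field.subfieldI'[OF field_Qbar])
  show "subring \<rat> Qbar" by (rule Qbar.subringI) auto
  show "inv\<^bsub>Qbar\<^esub> k \<in> \<rat>" if "k \<in> \<rat> - {\<zero>\<^bsub>Qbar\<^esub>}" for k using that by auto
qed

lemma Rats_subset_generate_field: "\<rat> \<subseteq> generate_field Qbar H"
proof
  fix x :: qbar assume "x \<in> \<rat>"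
  then obtain a b where ab: "x = of_int a / of_int b" "0 < b" by (auto elim: Rats_cases')
  have nat: "of_nat n \<in> generate_field Qbar H" for n
  proof (induction n)
    case 0
    then show ?case using field.zero_in_generate[OF field_Qbar] by simp
  next
    case (Suc n)
    then show ?case using generate_field.eng_add[OF generate_field.one, of _ Qbar H] by simp
  qed
  have int: "of_int k \<in> generate_field Qbar H" for k
  proof (cases k rule: int_cases2)
    case (nonneg n)
    then show ?thesis using nat by simp
  next
    case (nonpos n)
    then show ?thesis using generate_field.a_inv[OF nat[of n]] by simp
  qed
  have "inverse (of_int b) \<in> generate_field Qbar H"
    using generate_field.m_inv[OF int[of b]] ab(2) by simp
  then have "of_int a * inverse (of_int b) \<in> generate_field Qbar H"
    using generate_field.eng_mult[OF int[of a]] by (simp only: Qbar_simps)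
  then show "x \<in> generate_field Qbar H"
    using ab(1) by (simp only: divide_inverse)
qed

lemma generate_field_Rats:
  assumes "H \<subseteq> \<rat>"
  shows "generate_field Qbar H = \<rat>"
  using field.generate_field_min_subfield1[OF field_Qbar _ subfield_Rats assms] Rats_subset_generate_field by auto

text \<open>For irrational \<open>t\<close> the list \<open>t\<close>, 1 is independent; an
  \<open>s\<close> outside its span would give three independent elements.\<close>

lemma dimension_le_2_span:
  assumes dim: "ring.dimension Qbar n \<rat> F" "n \<le> 2" and F: "1 \<in> F" "t \<in> F" "s \<in> F" and t: "t \<notin> \<rat>"
  obtains a b where "s = of_rat a + of_rat b * t"
proof -
  note sub = subfield_Rats
  have mem: "u \<in> Qbar.line_extension \<rat> v E \<longleftrightarrow> (\<exists>k\<in>\<rat>. \<exists>w\<in>E. u = k * v + w)" for u v E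
    using Qbar.line_extension_mem_iff[of u \<rat> v E] by simp
  have sp1: "u \<in> Qbar.Span \<rat> [1] \<longleftrightarrow> u \<in> \<rat>" for u by (simp add: mem)
  have sp2: "u \<in> Qbar.Span \<rat> [t, 1] \<longleftrightarrow> (\<exists>k\<in>\<rat>. \<exists>w\<in>\<rat>. u = k * t + w)" for u
  proof -
    have "Qbar.Span \<rat> [t, 1] = Qbar.line_extension \<rat> t (Qbar.Span \<rat> [1])" by simp
    then show ?thesis using sp1 mem[of u t "Qbar.Span \<rat> [1]"] by blast
  qed
  have ind: "Qbar.independent \<rat> [t, 1]"
  proof (intro Qbar.independent.intros)
    show "t \<notin> Qbar.Span \<rat> [1]" using sp1 t by blast
  qed simp_all
  have "s \<in> Qbar.Span \<rat> [t, 1]"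
  proof (rule ccontr)
    assume s: "s \<notin> Qbar.Span \<rat> [t, 1]"
    have "Qbar.independent \<rat> [s, t, 1]" by (rule Qbar.li_Cons[OF _ s ind]) simp
    moreover have "set [s, t, 1] \<subseteq> F" using F by simp
    ultimately have "length [s, t, 1] \<le> n"
      by (rule Qbar.independent_length_le_dimension[OF sub dim(1)])
    then show False using dim(2) by simp
  qed
  then obtain k w where "k \<in> \<rat>" "w \<in> \<rat>" "s = k * t + w" using sp2 by blast
  then show thesis using that by (auto elim!: Rats_cases simp: add.commute)
qed

lemma rat_combination_eq_0:
  fixes t :: "'a::field_char_0"
  assumes "t \<notin> \<rat>" "of_rat a + of_rat b * t = 0"
  shows "a = 0 \<and> b = 0"
proof -
  have "b = 0"
  proof (rule ccontr)
    assume "b \<noteq> 0"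
    then have "t = of_rat (- a / b)" using assms(2)
      by (simp add: of_rat_divide of_rat_minus field_simps eq_neg_iff_add_eq_0 add.commute)
    then show False using assms(1) by simp
  qed
  then show ?thesis using assms(2) by simp
qed

text \<open>Reduced by the quadratic equation of \<open>x\<close>, both curve equations become
  rational combinations of 1 and \<open>x\<close> equal to 0; their vanishing coefficients are the
  hypotheses of \<open>quadratic_point_E1\<close> and \<open>quadratic_point_E2\<close>.\<close>

lemma no_quadratic_x:
  fixes x :: "'a::field_char_0"
  assumes x: "x \<notin> \<rat>" and y: "(of_rat a + of_rat b * x)\<^sup>2 = - ((x\<^sup>2 - 3) * (x\<^sup>2 + 1))"
    and z: "(of_rat c + of_rat d * x)\<^sup>2 = - 2 * (x ^ 3 - x\<^sup>2 - x - 1)"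
    and x2: "x\<^sup>2 = of_rat p + of_rat q * x"
  shows False
proof -
  define m n where "m = - q" and "n = - p"
  have x2: "x\<^sup>2 = - of_rat m * x - of_rat n" using x2 by (simp add: m_def n_def of_rat_minus)
  have x3: "x ^ 3 = (of_rat m ^ 2 - of_rat n) * x + of_rat m * of_rat n"
  proof -
    have "x ^ 3 = x * x\<^sup>2" by (simp add: power2_eq_square power3_eq_cube)
    also have "\<dots> = x * (- of_rat m * x - of_rat n)" by (simp only: x2)
    also have "\<dots> = - of_rat m * x\<^sup>2 - of_rat n * x" by (simp add: power2_eq_square algebra_simps)
    also have "\<dots> = (of_rat m ^ 2 - of_rat n) * x + of_rat m * of_rat n"
      unfolding x2 by (simp add: power2_eq_square algebra_simps)
    finally show ?thesis .
  qed
  have irr: "t\<^sup>2 + m * t + n \<noteq> 0" for t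
  proof
    assume "t\<^sup>2 + m * t + n = 0"
    then have n: "- t\<^sup>2 - m * t = n" by (simp add: algebra_simps)
    have "(x - of_rat t) * (x + of_rat (t + m)) = x\<^sup>2 + of_rat m * x + of_rat (- t\<^sup>2 - m * t)"
      by (simp add: of_rat_diff of_rat_mult of_rat_power of_rat_minus of_rat_add power2_eq_square algebra_simps)
    then have "(x - of_rat t) * (x + of_rat (t + m)) = 0" unfolding n x2 by simp
    then have "x = of_rat t \<or> x = - of_rat (t + m)" by (simp only: mult_eq_0_iff right_minus_eq eq_neg_iff_add_eq_0)
    then show False using x by (metis Rats_minus_iff Rats_of_rat)
  qed
  have "of_rat (c\<^sup>2 - d\<^sup>2 * n + 2 * (m * n + n - 1)) + of_rat (2 * c * d - d\<^sup>2 * m + 2 * (m\<^sup>2 - n + m - 1)) * x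
     = (of_rat c + of_rat d * x)\<^sup>2 + 2 * (x ^ 3 - x\<^sup>2 - x - 1)"
  proof -
    have "(of_rat c + of_rat d * x)\<^sup>2 = of_rat c ^ 2 + 2 * of_rat c * of_rat d * x + of_rat d ^ 2 * x\<^sup>2"
      by (simp add: power2_eq_square algebra_simps)
    then show ?thesis unfolding x3 x2
      by (simp add: of_rat_diff of_rat_mult of_rat_power of_rat_minus of_rat_add algebra_simps)
  qed
  also have "\<dots> = 0" unfolding z by simp
  finally have "\<exists>s. m = s\<^sup>2 / 2 \<and> n = 2 * s - 1 - s\<^sup>2 / 2 \<or> m = s\<^sup>2 / 2 - 2 \<and> n = s\<^sup>2 / 2 + 2 * s + 1"
    using rat_combination_eq_0[OF x] quadratic_point_E2 by blast
  moreover
  have "of_rat (a\<^sup>2 - b\<^sup>2 * n - (m\<^sup>2 * n - n\<^sup>2 - 2 * n + 3)) + of_rat (2 * a * b - b\<^sup>2 * m - (m ^ 3 - 2 * m * n - 2 * m)) * x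
     = (of_rat a + of_rat b * x)\<^sup>2 + (x\<^sup>2 - 3) * (x\<^sup>2 + 1)"
  proof -
    have "(x\<^sup>2 - 3) * (x\<^sup>2 + 1) = x * x ^ 3 - 2 * x\<^sup>2 - 3"
      by (simp add: power2_eq_square power3_eq_cube algebra_simps)
    also have "x * x ^ 3 = (of_rat m ^ 2 - of_rat n) * x\<^sup>2 + of_rat m * of_rat n * x"
      unfolding x3 by (simp add: power2_eq_square algebra_simps)
    finally have 1: "(x\<^sup>2 - 3) * (x\<^sup>2 + 1) = (of_rat m ^ 2 - of_rat n) * x\<^sup>2 + of_rat m * of_rat n * x - 2 * x\<^sup>2 - 3" .
    have 2: "(of_rat a + of_rat b * x)\<^sup>2 = of_rat a ^ 2 + 2 * of_rat a * of_rat b * x + of_rat b ^ 2 * x\<^sup>2"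
      by (simp add: power2_eq_square algebra_simps)
    show ?thesis unfolding 1 2 unfolding x2
      by (simp add: of_rat_diff of_rat_mult of_rat_power of_rat_minus of_rat_add power2_eq_square power3_eq_cube algebra_simps)
  qed
  then have "of_rat (a\<^sup>2 - b\<^sup>2 * n - (m\<^sup>2 * n - n\<^sup>2 - 2 * n + 3)) + of_rat (2 * a * b - b\<^sup>2 * m - (m ^ 3 - 2 * m * n - 2 * m)) * x = 0"
    unfolding y by simp
  from rat_combination_eq_0[OF x this]
  have "a\<^sup>2 - b\<^sup>2 * n = m\<^sup>2 * n - n\<^sup>2 - 2 * n + 3" "2 * a * b - b\<^sup>2 * m = m ^ 3 - 2 * m * n - 2 * m" by simp_all
  moreover have "1 + m + n \<noteq> 0" using irr[of 1] by (simp add: algebra_simps)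
  ultimately show False using quadratic_point_E1 no_common_quadratic[OF irr] by blast
qed

lemma of_rat_E1: "- (((of_rat r :: 'a::field_char_0)\<^sup>2 - 3) * ((of_rat r)\<^sup>2 + 1)) = of_rat (- ((r\<^sup>2 - 3) * (r\<^sup>2 + 1)))"
  by (simp add: of_rat_diff of_rat_mult of_rat_power of_rat_minus of_rat_add)

lemma of_rat_E2: "- 2 * ((of_rat r :: 'a::field_char_0) ^ 3 - (of_rat r)\<^sup>2 - of_rat r - 1) = of_rat (- 2 * (r ^ 3 - r\<^sup>2 - r - 1))"
  by (simp add: of_rat_diff of_rat_mult of_rat_power of_rat_minus of_rat_add)

text \<open>For irrational \<open>y\<close>, the rationality of \<open>z^2\<close> kills the cross
  term \<open>2ab\<close>, so \<open>z\<close> is rational or a rational multiple of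
  \<open>y\<close>.\<close>

lemma rational_x:
  fixes y z :: "'a::field_char_0"
  assumes y: "y\<^sup>2 = - (((of_rat r)\<^sup>2 - 3) * ((of_rat r)\<^sup>2 + 1))"
    and z: "z\<^sup>2 = - 2 * ((of_rat r) ^ 3 - (of_rat r)\<^sup>2 - of_rat r - 1)"
    and span: "y \<notin> \<rat> \<Longrightarrow> \<exists>a b. z = of_rat a + of_rat b * y"
  shows "r \<in> {1, -1}"
proof (cases "y \<in> \<rat>")
  case True
  then obtain s where "y = of_rat s" by (rule Rats_cases)
  then have "(of_rat (s\<^sup>2) :: 'a) = of_rat (- ((r\<^sup>2 - 3) * (r\<^sup>2 + 1)))" using y unfolding of_rat_E1 by (simp add: of_rat_power)
  then have "s\<^sup>2 = - ((r\<^sup>2 - 3) * (r\<^sup>2 + 1))" by (simp only: of_rat_eq_iff)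
  then show ?thesis by (rule E1_rat)
next
  case False
  then obtain a b where ab: "z = of_rat a + of_rat b * y" using span by blast
  define f g where "f = - ((r\<^sup>2 - 3) * (r\<^sup>2 + 1))" and "g = - 2 * (r ^ 3 - r\<^sup>2 - r - 1)"
  have f: "y\<^sup>2 = of_rat f" and g: "z\<^sup>2 = of_rat g" using y z unfolding of_rat_E1 of_rat_E2 f_def g_def .
  have "z\<^sup>2 = of_rat a ^ 2 + of_rat b ^ 2 * y\<^sup>2 + 2 * of_rat a * of_rat b * y"
    unfolding ab by (simp add: power2_eq_square algebra_simps)
  then have "of_rat (a\<^sup>2 + b\<^sup>2 * f - g) + of_rat (2 * a * b) * y = 0"
    unfolding f g by (simp add: of_rat_diff of_rat_mult of_rat_power of_rat_add)
  from rat_combination_eq_0[OF False this] have *: "a\<^sup>2 + b\<^sup>2 * f = g" "a = 0 \<or> b = 0" by auto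
  from *(2) show ?thesis
  proof
    assume "a = 0"
    then have "g = b\<^sup>2 * f" using *(1) by simp
    then show ?thesis unfolding f_def g_def by (rule twist_rat)
  next
    assume "b = 0"
    then have "a\<^sup>2 = g" using *(1) by simp
    then show ?thesis unfolding g_def by (rule E2_rat_x)
  qed
qed

theorem theorem5p4:
  shows "points_of_degree_le 2 Y_points = rational_points Y_points
    \<and> rational_points Y_points = {1, -1} \<times> {2, -2} \<times> {2, -2}"
proof -
  let ?S = "{1, -1} \<times> {2, -2} \<times> {2, -2} :: point set"
  have 1: "P \<in> ?S" if "P \<in> points_of_degree_le 2 Y_points" for P
  proof -
    obtain x y z where P: "P = (x, y, z)" by (cases P)
    define F where "F = generate_field Qbar {x, y, z}"
    from that obtain n where n: "n \<le> 2" "Qbar.dimension n \<rat> F"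
      and y: "y\<^sup>2 = - ((x\<^sup>2 - 3) * (x\<^sup>2 + 1))" and z: "z\<^sup>2 = - 2 * (x ^ 3 - x\<^sup>2 - x - 1)"
      by (auto simp: points_of_degree_le_def Y_points_def P F_def)
    have F: "1 \<in> F" "x \<in> F" "y \<in> F" "z \<in> F" "x\<^sup>2 \<in> F"
      using generate_field.one[of Qbar "{x, y, z}"] generate_field.incl[of _ "{x, y, z}" Qbar]
        generate_field.eng_mult[of x Qbar "{x, y, z}" x]
      by (simp_all add: F_def power2_eq_square)
    note span = dimension_le_2_span[OF n(2,1) F(1)]
    have "x \<in> \<rat>"
    proof (rule ccontr)
      assume x: "x \<notin> \<rat>"
      obtain a b where "y = of_rat a + of_rat b * x" using span[OF F(2,3) x] .
      moreover obtain c d where "z = of_rat c + of_rat d * x" using span[OF F(2,4) x] .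
      \<comment> \<open>Applied to \<open>x^2\<close>, the span lemma supplies the quadratic
        equation of \<open>x\<close>.\<close>
      moreover obtain p q where "x\<^sup>2 = of_rat p + of_rat q * x" using span[OF F(2,5) x] .
      ultimately show False using no_quadratic_x[OF x] y z by blast
    qed
    then obtain r where r: "x = of_rat r" by (rule Rats_cases)
    have "\<exists>a b. z = of_rat a + of_rat b * y" if "y \<notin> \<rat>"
      using span[OF F(3,4) that] by metis
    with y z have "r \<in> {1, -1}" unfolding r by (rule rational_x)
    then have x: "x = 1 \<or> x = - 1" using r by (auto simp: of_rat_minus)
    then have "y\<^sup>2 = 2\<^sup>2" "z\<^sup>2 = 2\<^sup>2" using y z by auto
    then show ?thesis using x unfolding P power2_eq_iff by auto
  qed
  moreover have 2: "?S \<subseteq> rational_points Y_points"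
    by (auto simp: rational_points_def Y_points_def)
  moreover have "P \<in> points_of_degree_le 2 Y_points" if "P \<in> rational_points Y_points" for P
  proof -
    obtain x y z where P: "P = (x, y, z)" by (cases P)
    have "generate_field Qbar {x, y, z} = \<rat>"
      using that by (intro generate_field_Rats) (auto simp: rational_points_def P)
    then have "Qbar.dimension 1 \<rat> (point_field P)"
      using Qbar.dimension_one[OF subfield_Rats] by (simp add: P)
    then show ?thesis
      using that by (auto simp: points_of_degree_le_def rational_points_def intro!: exI[of _ 1])
  qed
  ultimately show ?thesis by blast
qed

end
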